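(* Let $\mathbb{F}$ be a field. Every $\mathbb{F}$-representable matroid $M$ is a minor of an $\mathbb{F}$-representable matroid $N$ such that $\mathrm{cdd}(N)\le 2\,\mathrm{bd}(M)\cdot\big(4^{\mathrm{bd}(M)}-1\big)+1$.
   Context: For a matroid $M$ with rank function $r_M$ and disjoint sets $X,Y$ of elements, $\lambda_M(X,Y)=r_M(X)+r_M(Y)-r_M(X\cup Y)$. For pairwise disjoint sets $X_1,\dots,X_k$ of elements, $\lambda^*_M(X_1,\dots,X_k)=\max_{I\subseteq[k]}\lambda_M\big(\bigcup_{i\in I}X_i,\bigcup_{i\in[k]\setminus I}X_i\big)$. A $(d,r)$-decomposition of a matroid $M$ is a tree $T$ of radius $d$ whose leaves are in one-to-one correspondence with the elements of $M$, such that for every inner (non-leaf) vertex $v$ of $T$ with $k$ neighbours, if $X_1,\dots,X_k$ are the sets of elements of $M$ assigned to the leaves of the $k$ components of $T\setminus v$, then $\lambda^*_M(X_1,\dots,X_k)\le r$. The branch-depth $\mathrm{bd}(M)$ is the minimum $k$ such that $M$ has a $(d,r)$-decomposition with $d\le k$ and $r\le k$. The contraction-deletion-depth $\mathrm{cdd}(M)$ is defined recursively: if $M$ has a single element, $\mathrm{cdd}(M)=1$; if $M$ is not connected, $\mathrm{cdd}(M)$ is the maximum of $\mathrm{cdd}$ over the components of $M$ (restrictions of $M$ to its components, a component being an inclusion-wise maximal set of elements any two of which lie in a common circuit); otherwise $\mathrm{cdd}(M)=1+\min_{e}\min\{\mathrm{cdd}(M/e),\mathrm{cdd}(M\setminus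 e)\}$, the minimum over elements $e$ of $M$. *)

theory Defs
  imports Main
begin

record 'a matroid =
  ground :: "'a set"
  indep  :: "'a set set"

definition is_matroid :: "'a matroid \<Rightarrow> bool" where
  "is_matroid M \<longleftrightarrow> finite (ground M) \<and> {} \<in> indep M
     \<and> (\<forall>I\<in>indep M. I \<subseteq> ground M)
     \<and> (\<forall>I J. J \<in> indep M \<and> I \<subseteq> J \<longrightarrow> I \<in> indep M)
     \<and> (\<forall>I J. I \<in> indep M \<and> J \<in> indep M \<and> card I < card J
           \<longrightarrow> (\<exists>x\<in>J - I. insert x I \<in> indep M))"

definition rank :: "'a matroid \<Rightarrow> 'a set \<Rightarrow> nat" where
  "rank M X = Max (card ` {I \<in> indep M. I \<subseteq> X})"

definition conn_lambda :: "'a matroid \<Rightarrow> 'a set \<Rightarrow> 'a set \<Rightarrow> int" where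
  "conn_lambda M X Y = int (rank M X) + int (rank M Y) - int (rank M (X \<union> Y))"

definition circuit :: "'a matroid \<Rightarrow> 'a set \<Rightarrow> bool" where
  "circuit M C \<longleftrightarrow> C \<subseteq> ground M \<and> C \<notin> indep M \<and> (\<forall>x\<in>C. C - {x} \<in> indep M)"

definition restrict_matroid :: "'a matroid \<Rightarrow> 'a set \<Rightarrow> 'a matroid" where
  "restrict_matroid M S = \<lparr>ground = S, indep = {I \<in> indep M. I \<subseteq> S}\<rparr>"

definition delete :: "'a matroid \<Rightarrow> 'a set \<Rightarrow> 'a matroid" where
  "delete M D = restrict_matroid M (ground M - D)"

definition contract :: "'a matroid \<Rightarrow> 'a set \<Rightarrow> 'a matroid" where
  "contract M C = \<lparr>ground = ground M - C,
     indep = {I. I \<subseteq> ground M - C \<and>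
                 int (rank M (I \<union> C)) - int (rank M C) = int (card I)}\<rparr>"

definition is_minor :: "'a matroid \<Rightarrow> 'a matroid \<Rightarrow> bool" where
  "is_minor M' N \<longleftrightarrow> (\<exists>C D. C \<subseteq> ground N \<and> D \<subseteq> ground N \<and> C \<inter> D = {}
                        \<and> M' = delete (contract N C) D)"

definition map_matroid :: "('a \<Rightarrow> 'b) \<Rightarrow> 'a matroid \<Rightarrow> 'b matroid" where
  "map_matroid f M = \<lparr>ground = f ` ground M, indep = (\<lambda>I. f ` I) ` indep M\<rparr>"

text \<open>A family (\<phi> x)_{x\<in>X} of vectors in 'f^\<nat> (finitely many coordinates matter)
  is linearly independent.\<close>
definition lin_indep_family :: "('a \<Rightarrow> nat \<Rightarrow> 'f::field) \<Rightarrow> 'a set \<Rightarrow> bool" where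
  "lin_indep_family \<phi> X \<longleftrightarrow> finite X \<and>
     (\<forall>c :: 'a \<Rightarrow> 'f. (\<forall>i. (\<Sum>x\<in>X. c x * \<phi> x i) = 0) \<longrightarrow> (\<forall>x\<in>X. c x = 0))"

definition representable_over :: "'f::field itself \<Rightarrow> 'a matroid \<Rightarrow> bool" where
  "representable_over TYPE('f) M \<longleftrightarrow> is_matroid M \<and>
     (\<exists>\<phi> :: 'a \<Rightarrow> nat \<Rightarrow> 'f. \<forall>X. X \<in> indep M \<longleftrightarrow> X \<subseteq> ground M \<and> lin_indep_family \<phi> X)"

definition common_circuit_set :: "'a matroid \<Rightarrow> 'a set \<Rightarrow> bool" where
  "common_circuit_set M S \<longleftrightarrow>
     (\<forall>x\<in>S. \<forall>y\<in>S. x \<noteq> y \<longrightarrow> (\<exists>C. circuit M C \<and> x \<in> C \<and> y \<in> C))"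

definition components :: "'a matroid \<Rightarrow> 'a set set" where
  "components M = {S. S \<noteq> {} \<and> S \<subseteq> ground M \<and> common_circuit_set M S \<and>
      (\<forall>T. S \<subseteq> T \<and> T \<subseteq> ground M \<and> common_circuit_set M T \<longrightarrow> T = S)}"

definition connected_matroid :: "'a matroid \<Rightarrow> bool" where
  "connected_matroid M \<longleftrightarrow> common_circuit_set M (ground M)"

inductive has_cdd :: "'a matroid \<Rightarrow> nat \<Rightarrow> bool" where
  single: "card (ground M) = 1 \<Longrightarrow> has_cdd M 1"
| disconnected: "\<lbrakk>card (ground M) \<ge> 2; \<not> connected_matroid M;
     \<forall>C\<in>components M. has_cdd (restrict_matroid M C) (f C)\<rbrakk>
     \<Longrightarrow> has_cdd M (Max (f ` components M))"
| connected: "\<lbrakk>card (ground M) \<ge> 2; connected_matroid M;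
     \<forall>e\<in>ground M. has_cdd (contract M {e}) (g e) \<and> has_cdd (delete M {e}) (h e)\<rbrakk>
     \<Longrightarrow> has_cdd M (1 + Min ((\<lambda>e. min (g e) (h e)) ` ground M))"

fun within :: "('v \<Rightarrow> 'v \<Rightarrow> bool) \<Rightarrow> nat \<Rightarrow> 'v \<Rightarrow> 'v \<Rightarrow> bool" where
  "within G 0 u v = (u = v)"
| "within G (Suc n) u v = (within G n u v \<or> (\<exists>w. G u w \<and> within G n w v))"

definition is_tree :: "'v set \<Rightarrow> ('v \<Rightarrow> 'v \<Rightarrow> bool) \<Rightarrow> bool" where
  "is_tree V G \<longleftrightarrow> finite V \<and> V \<noteq> {}
     \<and> (\<forall>u v. G u v \<longrightarrow> u \<in> V \<and> v \<in> V \<and> u \<noteq> v \<and> G v u)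
     \<and> (\<forall>u\<in>V. \<forall>v\<in>V. \<exists>n. within G n u v)
     \<and> card {{u, v} | u v. G u v} + 1 = card V"

definition tree_radius :: "'v set \<Rightarrow> ('v \<Rightarrow> 'v \<Rightarrow> bool) \<Rightarrow> nat" where
  "tree_radius V G = (LEAST d. \<exists>c\<in>V. \<forall>v\<in>V. within G d c v)"

definition neighbours :: "('v \<Rightarrow> 'v \<Rightarrow> bool) \<Rightarrow> 'v \<Rightarrow> 'v set" where
  "neighbours G v = {u. G v u}"

text \<open>leaves: vertices of degree at most 1 (a one-vertex tree has one leaf)\<close>
definition leaves :: "'v set \<Rightarrow> ('v \<Rightarrow> 'v \<Rightarrow> bool) \<Rightarrow> 'v set" where
  "leaves V G = {v \<in> V. card (neighbours G v) \<le> 1}"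

definition comp_minus :: "('v \<Rightarrow> 'v \<Rightarrow> bool) \<Rightarrow> 'v \<Rightarrow> 'v \<Rightarrow> 'v set" where
  "comp_minus G v u = {w. \<exists>n. within (\<lambda>a b. G a b \<and> a \<noteq> v \<and> b \<noteq> v) n u w}"

definition lambda_star :: "'a matroid \<Rightarrow> 'i set \<Rightarrow> ('i \<Rightarrow> 'a set) \<Rightarrow> int" where
  "lambda_star M K X = Max ((\<lambda>I. conn_lambda M (\<Union>i\<in>I. X i) (\<Union>i\<in>K - I. X i)) ` Pow K)"

definition is_decomposition :: "'a matroid \<Rightarrow> nat \<Rightarrow> nat \<Rightarrow> bool" where
  "is_decomposition M d r \<longleftrightarrow>
     (\<exists>(V :: nat set) G f. is_tree V G \<and> tree_radius V G = d
        \<and> bij_betw f (leaves V G) (ground M)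
        \<and> (\<forall>v \<in> V - leaves V G.
             lambda_star M (neighbours G v)
               (\<lambda>u. f ` (leaves V G \<inter> comp_minus G v u)) \<le> int r))"

definition branch_depth :: "'a matroid \<Rightarrow> nat" where
  "branch_depth M = (LEAST k. \<exists>d r. d \<le> k \<and> r \<le> k \<and> is_decomposition M d r)"

end

theory Submission
  imports Defs "HOL.Vector_Spaces" "HOL-Library.Function_Algebras" "HOL-Library.Disjoint_Sets"
begin

text \<open>
  A represented matroid is encoded by its space \<open>Z\<close> of linear dependencies. Then
  \<open>\<lambda>(A, E - A)\<close> is the dimension of the projection of \<open>Z\<close> to \<open>A\<close> modulo the dependencies
  supported in \<open>A\<close>, contracting elements projects \<open>Z\<close>, and deleting elements intersects it with
  a coordinate subspace. If all unions of the parts of a partition have connectivity at most \<open>r\<close>,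
  then dropping at most \<open>r\<^sup>2\<close> generators of \<open>Z\<close> and adding at most \<open>r\<^sup>2\<close> others
  yields a space that is a direct sum over the parts: choose a maximal set \<open>D\<close> of parts on which the
  projection of \<open>Z\<close> splits; by the connectivity bound this costs at most \<open>r\<close> generators on either
  side, and maximality makes the boundary dimension of every remaining part drop.

  A dropped generator becomes a new element that is contracted to obtain \<open>M\<close> and deleted when bounding
  the depth; an added generator becomes a new element with the two roles exchanged. The connectivity of
  each summand is bounded by that of \<open>M\<close>, so one can recurse along the decomposition tree rooted at
  its centre. A tree of radius \<open>d\<close> thus gives depth at most \<open>2 r\<^sup>2 d + 1\<close>, and
  \<open>k\<^sup>2 \<le> 4^k - 1\<close>.
\<close>

section \<open>Configurations: matroids given by their space of dependencies\<close>

text \<open>One new element acts as a switch for one generator. If a generator \<open>s\<close> of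
  the space is replaced by \<open>s + unit q\<close>, then deleting \<open>q\<close> removes the
  generator and contracting \<open>q\<close> restores it. The depth charges 1 for either operation,
  so one construction serves for dropped and for added generators.

  The recursion has to survive the perturbation: the summand on a part \<open>A\<close> need not be
  a minor of the given matroid, so no bound for minors applies to it. What is kept is that its space
  lies between the dependencies supported in \<open>A\<close> and the projection of \<open>Z\<close>
  to \<open>A\<close>. On any \<open>A' \<subseteq> A\<close> such a space has no more traces than
  \<open>Z\<close> and no fewer dependencies, so every cut further down the decomposition tree keeps
  its bound.

  The number \<open>r * r\<close> is rounds times price. A single part has boundary dimension at
  most \<open>r\<close>, each round lowers this bound for all remaining parts, and each round pays
  at most \<open>r\<close> generators on either side because a union of parts is itself a bounded
  cut.\<close>

definition fscale :: "'f::field \<Rightarrow> ('e \<Rightarrow> 'f) \<Rightarrow> 'e \<Rightarrow> 'f" where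
  "fscale c z = (\<lambda>x. c * z x)"

interpretation fs: vector_space fscale
  by unfold_locales (auto simp: fscale_def fun_eq_iff algebra_simps)

definition supp :: "('e \<Rightarrow> 'f::zero) \<Rightarrow> 'e set" where
  "supp z = {x. z x \<noteq> 0}"

definition res :: "'e set \<Rightarrow> ('e \<Rightarrow> 'f::zero) \<Rightarrow> 'e \<Rightarrow> 'f" where
  "res A z = (\<lambda>x. if x \<in> A then z x else 0)"

text \<open>\<open>part Z A\<close> is the dependency space of the restriction to \<open>A\<close>,
  whereas the image of \<open>Z\<close> under \<open>res A\<close> is that of the contraction onto
  \<open>A\<close>.\<close>

definition part :: "('e \<Rightarrow> 'f::zero) set \<Rightarrow> 'e set \<Rightarrow> ('e \<Rightarrow> 'f) set" where
  "part Z A = {z \<in> Z. supp z \<subseteq> A}"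

definition config :: "'e set \<Rightarrow> ('e \<Rightarrow> 'f::field) set \<Rightarrow> bool" where
  "config G Z \<longleftrightarrow> finite G \<and> fs.subspace Z \<and> (\<forall>z\<in>Z. supp z \<subseteq> G)"

text \<open>The matroid on \<open>G\<close> whose space of linear dependencies is \<open>Z\<close>.\<close>
definition mat :: "'e set \<Rightarrow> ('e \<Rightarrow> 'f::field) set \<Rightarrow> 'e matroid" where
  "mat G Z = \<lparr>ground = G, indep = {I. I \<subseteq> G \<and> (\<forall>z\<in>Z. supp z \<subseteq> I \<longrightarrow> z = 0)}\<rparr>"

lemma fscale_apply [simp]: "fscale c z x = c * z x"
  by (simp add: fscale_def)

lemma sum_fun_apply: "(\<Sum>i\<in>S. f i) x = (\<Sum>i\<in>S. f i (x :: 'e) :: 'f::field)"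
  by (induction S rule: infinite_finite_induct) auto

lemma supp_0 [simp]: "supp 0 = {}"
  by (auto simp: supp_def)

lemma supp_empty_iff [simp]: "supp z = {} \<longleftrightarrow> z = 0"
  by (auto simp: supp_def fun_eq_iff)

lemma res_apply: "res A z x = (if x \<in> A then z x else 0)"
  by (simp add: res_def)

lemma res_add: "res A (z + w) = res A z + res A (w :: 'e \<Rightarrow> 'f::field)"
  by (auto simp: res_def fun_eq_iff)

lemma res_diff: "res A (z - w) = res A z - res A (w :: 'e \<Rightarrow> 'f::field)"
  by (auto simp: res_def fun_eq_iff)

lemma res_fscale: "res A (fscale c z) = fscale c (res A z)"
  by (auto simp: res_def fun_eq_iff)

lemma res_0 [simp]: "res A 0 = 0"
  by (auto simp: res_def fun_eq_iff)

lemma res_empty [simp]: "res {} z = 0"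
  by (auto simp: res_def fun_eq_iff)

lemma res_res [simp]: "res A (res B z) = res (A \<inter> B) z"
  by (auto simp: res_def fun_eq_iff)

lemma res_eq_self: "supp z \<subseteq> A \<Longrightarrow> res A z = z"
  by (auto simp: res_def supp_def fun_eq_iff)

lemma supp_res [simp]: "supp (res A z) = supp z \<inter> A"
  by (auto simp: res_def supp_def)

lemma supp_add: "supp (z + w) \<subseteq> supp z \<union> supp (w :: 'e \<Rightarrow> 'f::field)"
  by (auto simp: supp_def)

lemma supp_diff: "supp (z - w) \<subseteq> supp z \<union> supp (w :: 'e \<Rightarrow> 'f::field)"
  by (auto simp: supp_def)

lemma supp_fscale: "supp (fscale c z) \<subseteq> supp z"
  by (auto simp: supp_def)

lemma subspace_supp: "fs.subspace {z. supp z \<subseteq> A}"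
  unfolding fs.subspace_def by (auto dest!: subsetD[OF supp_add] subsetD[OF supp_fscale])

lemma subspace_res: "fs.subspace Z \<Longrightarrow> fs.subspace (res A ` Z)"
proof -
  assume Z: "fs.subspace Z"
  have "0 = res A 0" by simp
  then have 0: "0 \<in> res A ` Z" using fs.subspace_0[OF Z] by blast
  show ?thesis
    unfolding fs.subspace_def
    using 0 fs.subspace_add[OF Z] fs.subspace_scale[OF Z]
    by (auto simp flip: res_add res_fscale)
qed

lemma subspace_part: "fs.subspace Z \<Longrightarrow> fs.subspace (part Z A)"
proof -
  assume Z: "fs.subspace Z"
  have "part Z A = Z \<inter> {z. supp z \<subseteq> A}" by (auto simp: part_def)
  then show ?thesis using fs.subspace_inter[OF Z subspace_supp] by simp
qed

lemma part_mono: "A \<subseteq> B \<Longrightarrow> part Z A \<subseteq> part Z B"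
  by (auto simp: part_def)

lemma part_subset: "part Z A \<subseteq> Z"
  by (auto simp: part_def)

lemma config_part: "config G Z \<Longrightarrow> A \<subseteq> G \<Longrightarrow> config A (part Z A)"
  by (auto simp: config_def subspace_part finite_subset) (auto simp: part_def)

lemma config_res: "config G Z \<Longrightarrow> A \<subseteq> G \<Longrightarrow> config A (res A ` Z)"
  by (auto simp: config_def subspace_res finite_subset)

section \<open>Exchange axiom and representability from a space of dependencies\<close>

lemma homogeneous_system:
  fixes a :: "'i \<Rightarrow> 'j \<Rightarrow> 'f::field"
  assumes "finite I" "finite J" "card I < card J"
  shows "\<exists>c. (\<exists>x\<in>J. c x \<noteq> 0) \<and> (\<forall>i\<in>I. (\<Sum>x\<in>J. c x * a x i) = 0)"
  using assms
proof (induction I arbitrary: J a rule: finite_induct)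
  case empty
  then obtain x where "x \<in> J" by fastforce
  then show ?case by (intro exI[of _ "\<lambda>_. 1"]) auto
next
  case (insert i I)
  show ?case
  proof (cases "\<forall>x\<in>J. a x i = 0")
    case True
    then show ?thesis using insert.IH[of J a] insert.prems insert.hyps by auto
  next
    case False
    then obtain y where y: "y \<in> J" "a y i \<noteq> 0" by auto
    define J' where "J' = J - {y}"
    have J': "finite J'" "card I < card J'" "J = insert y J'" "y \<notin> J'"
      using insert y unfolding J'_def by auto
    \<comment> \<open>Equation \<open>i\<close> is solved for the unknown \<open>y\<close> and
      substituted into the others, which leaves one equation and one unknown fewer.\<close>
    obtain c where c: "\<exists>x\<in>J'. c x \<noteq> 0"
      "\<forall>l\<in>I. (\<Sum>x\<in>J'. c x * (a x l - a x i / a y i * a y l)) = 0"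
      using insert.IH[OF J'(1,2), of "\<lambda>x l. a x l - a x i / a y i * a y l"] by blast
    define s where "s = (\<Sum>x\<in>J'. c x * a x i)"
    define c' where "c' = c(y := - s / a y i)"
    have sum': "(\<Sum>x\<in>J. c' x * a x l) = - s / a y i * a y l + (\<Sum>x\<in>J'. c x * a x l)" for l
    proof -
      have "(\<Sum>x\<in>J'. c' x * a x l) = (\<Sum>x\<in>J'. c x * a x l)"
        using J' by (intro sum.cong) (auto simp: c'_def)
      then show ?thesis using J' by (simp add: c'_def)
    qed
    have "(\<Sum>x\<in>J. c' x * a x l) = 0" if "l \<in> I" for l
    proof -
      have "0 = (\<Sum>x\<in>J'. c x * (a x l - a x i / a y i * a y l))" using c that by simp
      also have "\<dots> = (\<Sum>x\<in>J'. c x * a x l) - (\<Sum>x\<in>J'. c x * a x i * (a y l / a y i))"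
        by (simp add: algebra_simps sum_subtractf)
      also have "\<dots> = (\<Sum>x\<in>J'. c x * a x l) - s * (a y l / a y i)"
        by (simp only: s_def sum_distrib_right)
      finally show ?thesis by (simp add: sum')
    qed
    moreover have "(\<Sum>x\<in>J. c' x * a x i) = 0"
      using y by (simp add: sum' s_def)
    moreover have "\<exists>x\<in>J. c' x \<noteq> 0" using c(1) J' by (auto simp: c'_def)
    ultimately show ?thesis by blast
  qed
qed

lemma ground_mat [simp]: "ground (mat G Z) = G"
  by (simp add: mat_def)

lemma indep_mat: "I \<in> indep (mat G Z) \<longleftrightarrow> I \<subseteq> G \<and> (\<forall>z\<in>Z. supp z \<subseteq> I \<longrightarrow> z = 0)"
  by (simp add: mat_def)

text \<open>This is the fundamental circuit of \<open>x\<close> over \<open>I\<close>: a dependency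
  inside \<open>insert x I\<close> must involve \<open>x\<close>, because \<open>I\<close> alone
  carries none, and it can then be scaled.\<close>

lemma fundamental_relation:
  assumes "config G Z" "I \<in> indep (mat G Z)" "x \<in> G" "insert x I \<notin> indep (mat G Z)"
  shows "\<exists>w. w \<in> Z \<and> w x = 1 \<and> supp w \<subseteq> insert x I"
proof -
  obtain z where z: "z \<in> Z" "supp z \<subseteq> insert x I" "z \<noteq> 0"
    using assms by (auto simp: indep_mat)
  have "z x \<noteq> 0"
  proof
    assume "z x = 0"
    then have "supp z \<subseteq> I" using z by (auto simp: supp_def)
    then show False using z assms by (auto simp: indep_mat)
  qed
  then show ?thesis
    using z assms supp_fscale[of "1 / z x" z]
    by (intro exI[of _ "fscale (1 / z x) z"]) (auto simp: config_def fs.subspace_scale)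
qed

text \<open>On the coordinates in \<open>D\<close> the vectors \<open>w x\<close> look like unit
  vectors, so a combination with prescribed values on \<open>D\<close> can be written down directly.
  Fundamental relations of elements outside a basis have this shape.\<close>

lemma elimination:
  fixes w :: "'e \<Rightarrow> 'e \<Rightarrow> 'f::field" and z :: "'e \<Rightarrow> 'f"
  assumes "finite D" and w: "\<And>x. x \<in> D \<Longrightarrow> w x x = 1"
    "\<And>x y. x \<in> D \<Longrightarrow> y \<in> D \<Longrightarrow> y \<noteq> x \<Longrightarrow> w x y = 0"
  defines "y \<equiv> \<Sum>x\<in>D. fscale (z x) (w x)"
  shows "y \<in> fs.span (w ` D)" "x \<in> D \<Longrightarrow> y x = z x"
    "supp y \<subseteq> (\<Union>x\<in>D. supp (w x))"
proof -
  show "y \<in> fs.span (w ` D)" unfolding y_def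
    by (intro fs.span_sum fs.span_scale fs.span_base) auto
  show "y x = z x" if "x \<in> D"
  proof -
    have "y x = (\<Sum>x'\<in>D. if x' = x then z x else 0)"
      unfolding y_def sum_fun_apply using w that
      by (intro sum.cong) auto
    then show ?thesis using that \<open>finite D\<close> by simp
  qed
  show "supp y \<subseteq> (\<Union>x\<in>D. supp (w x))"
  proof
    fix e assume "e \<in> supp y"
    then have "(\<Sum>x\<in>D. z x * w x e) \<noteq> 0" by (simp add: supp_def y_def sum_fun_apply)
    then obtain x where "x \<in> D" "z x * w x e \<noteq> 0" by (meson sum.neutral)
    then show "e \<in> (\<Union>x\<in>D. supp (w x))" by (auto simp: supp_def)
  qed
qed

text \<open>If no element of \<open>J - I\<close> extended \<open>I\<close>, each would have a
  fundamental relation over \<open>I\<close>. There are more of these than elements of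
  \<open>I - J\<close>, so a nontrivial combination vanishes on \<open>I - J\<close>; it is a
  nonzero dependency inside \<open>J\<close>.\<close>

lemma indep_mat_augment:
  assumes c: "config G Z" and I: "I \<in> indep (mat G Z)" and J: "J \<in> indep (mat G Z)"
    and less: "card I < card J"
  shows "\<exists>x\<in>J - I. insert x I \<in> indep (mat G Z)"
proof (rule ccontr)
  assume neg: "\<not> ?thesis"
  have fin: "finite I" "finite J"
    using c I J by (auto simp: config_def indep_mat intro: finite_subset)
  have "\<exists>w. w \<in> Z \<and> w x = 1 \<and> supp w \<subseteq> insert x I" if "x \<in> J - I" for x
  proof (rule fundamental_relation[OF c I])
    show "x \<in> G" using that J unfolding indep_mat by blast
    show "insert x I \<notin> indep (mat G Z)" using neg that by blast
  qed
  then obtain w where w: "\<And>x. x \<in> J - I \<Longrightarrow> w x \<in> Z \<and> w x x = 1 \<and> supp (w x) \<subseteq> insert x I"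
    by metis
  have "card (I - J) < card (J - I)"
    using less fin by (metis card_less_sym_Diff)
  then obtain c' where c': "\<exists>x\<in>J - I. c' x \<noteq> 0"
    "\<forall>i\<in>I - J. (\<Sum>x\<in>J - I. c' x * w x i) = 0"
    using homogeneous_system[of "I - J" "J - I" w] fin by blast
  define y where "y = (\<Sum>x\<in>J - I. fscale (c' x) (w x))"
  have w0: "w x x' = 0" if "x \<in> J - I" "x' \<in> J - I" "x' \<noteq> x" for x x'
    using w[OF that(1)] that by (auto simp: supp_def)
  note el = elimination[where D = "J - I" and w = w and z = c', folded y_def]
  have yZ: "y \<in> Z"
    unfolding y_def using c w by (intro fs.subspace_sum fs.subspace_scale) (auto simp: config_def)
  have y1: "y x = c' x" if "x \<in> J - I" for x
    by (rule el(2)) (use fin w w0 that in auto)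
  have "supp y \<subseteq> (\<Union>x\<in>J - I. supp (w x))"
    by (rule el(3)) (use fin w w0 in auto)
  also have "\<dots> \<subseteq> I \<union> J" using w by blast
  finally have "supp y \<subseteq> I \<union> J" .
  moreover have "y i = 0" if "i \<in> I - J" for i
    using c'(2) that by (simp add: y_def sum_fun_apply)
  ultimately have "supp y \<subseteq> J" by (auto simp: supp_def)
  then have "y = 0" using J yZ by (auto simp: indep_mat)
  then show False using y1 c'(1) by auto
qed

lemma indep_mat_mono: "I \<in> indep (mat G Z) \<Longrightarrow> J \<subseteq> I \<Longrightarrow> J \<in> indep (mat G Z)"
  unfolding indep_mat by blast

lemma indep_mat_empty: "{} \<in> indep (mat G Z)"
  by (simp add: indep_mat)

lemma is_matroid_mat:
  assumes c: "config G Z"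
  shows "is_matroid (mat G Z)"
  unfolding is_matroid_def
proof (intro conjI allI impI ballI)
  show "finite (ground (mat G Z))" using c by (simp add: config_def)
  show "{} \<in> indep (mat G Z)" by (rule indep_mat_empty)
  show "I \<subseteq> ground (mat G Z)" if "I \<in> indep (mat G Z)" for I
    using that by (simp add: indep_mat)
  show "I \<in> indep (mat G Z)" if "J \<in> indep (mat G Z) \<and> I \<subseteq> J" for I J
    using that indep_mat_mono by blast
  show "\<exists>x\<in>J - I. insert x I \<in> indep (mat G Z)"
    if "I \<in> indep (mat G Z) \<and> J \<in> indep (mat G Z) \<and> card I < card J" for I J
    using that indep_mat_augment[OF c] by blast
qed

definition basis_of :: "'e set \<Rightarrow> ('e \<Rightarrow> 'f::field) set \<Rightarrow> 'e set \<Rightarrow> 'e set \<Rightarrow> bool" where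
  "basis_of G Z X B \<longleftrightarrow> B \<in> indep (mat G Z) \<and> B \<subseteq> X \<and> (\<forall>x\<in>X - B. insert x B \<notin> indep (mat G Z))"

lemma basis_extend:
  assumes "config G Z" "X \<subseteq> G" "I \<in> indep (mat G Z)" "I \<subseteq> X"
  obtains B where "basis_of G Z X B" "I \<subseteq> B"
proof -
  let ?S = "{B. B \<in> indep (mat G Z) \<and> I \<subseteq> B \<and> B \<subseteq> X}"
  have "finite ?S"
    by (rule finite_subset[of _ "Pow X"]) (use assms in \<open>auto simp: config_def intro: finite_subset\<close>)
  moreover have "I \<in> ?S" using assms by auto
  ultimately obtain B where B: "B \<in> ?S" "\<forall>B'\<in>?S. B \<subseteq> B' \<longrightarrow> B = B'"
    using finite_has_maximal[of ?S] by blast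
  have "basis_of G Z X B"
    unfolding basis_of_def using B by blast
  then show ?thesis using that B by blast
qed

lemma rank_mat:
  assumes c: "config G Z" and B: "basis_of G Z X B"
  shows "rank (mat G Z) X = card B"
  unfolding rank_def
proof (rule Max_eqI)
  let ?S = "{I \<in> indep (mat G Z). I \<subseteq> X}"
  have "?S \<subseteq> Pow G" by (auto simp: indep_mat)
  then show "finite (card ` ?S)" using c by (meson config_def finite_Pow_iff finite_imageI finite_subset)
  show "card B \<in> card ` ?S" using B by (auto simp: basis_of_def)
  fix n assume "n \<in> card ` ?S"
  then obtain I where I: "I \<in> indep (mat G Z)" "I \<subseteq> X" "n = card I" by auto
  show "n \<le> card B"
  proof (rule ccontr)
    assume "\<not> n \<le> card B"
    then obtain x where "x \<in> I - B" "insert x B \<in> indep (mat G Z)"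
      using indep_mat_augment[OF c _ I(1), of B] B I by (auto simp: basis_of_def)
    then show False using B I by (auto simp: basis_of_def)
  qed
qed

text \<open>The vector \<open>z\<close> is arbitrary: dependencies inside \<open>X\<close> take any
  values on \<open>X - B\<close>, with one fundamental relation per coordinate. If \<open>z\<close>
  is a dependency, subtracting \<open>y\<close> clears these coordinates.\<close>

lemma reduce_to_basis:
  assumes c: "config G Z" and B: "basis_of G Z X B" and X: "X \<subseteq> G"
  obtains y where "y \<in> part Z X" "\<And>x. x \<in> X - B \<Longrightarrow> y x = z x"
proof -
  have fin: "finite (X - B)" using c X by (auto simp: config_def intro: finite_subset)
  have "\<exists>w. w \<in> Z \<and> w x = 1 \<and> supp w \<subseteq> insert x B" if "x \<in> X - B" for x
    using fundamental_relation[OF c, of B x] B that X unfolding basis_of_def by blast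
  then obtain w where w: "\<And>x. x \<in> X - B \<Longrightarrow> w x \<in> Z \<and> w x x = 1 \<and> supp (w x) \<subseteq> insert x B"
    by metis
  define y where "y = (\<Sum>x\<in>X - B. fscale (z x) (w x))"
  have w0: "w x x' = 0" if "x \<in> X - B" "x' \<in> X - B" "x' \<noteq> x" for x x'
    using w[OF that(1)] that by (auto simp: supp_def)
  note el = elimination[where D = "X - B" and w = w and z = z, folded y_def]
  have yZ: "y \<in> Z"
    unfolding y_def using c w by (intro fs.subspace_sum fs.subspace_scale) (auto simp: config_def)
  have "supp y \<subseteq> (\<Union>x\<in>X - B. supp (w x))"
    by (rule el(3)) (use fin w w0 in auto)
  also have "\<dots> \<subseteq> X" using w B by (auto simp: basis_of_def)
  finally have "y \<in> part Z X" using yZ by (auto simp: part_def)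
  moreover have "y x = z x" if "x \<in> X - B" for x
    by (rule el(2)) (use fin w w0 that in auto)
  ultimately show ?thesis using that by blast
qed

lemma basis_spans:
  assumes c: "config G Z" and B: "basis_of G Z G B" and z: "z \<in> Z" "\<And>x. x \<in> G - B \<Longrightarrow> z x = 0"
  shows "z = 0"
proof -
  have "supp z \<subseteq> B" using c z by (auto simp: config_def supp_def)
  then show ?thesis using B z by (auto simp: basis_of_def indep_mat)
qed

text \<open>The vectors are the columns of a standard matrix with an identity block for a basis
  \<open>B\<close>. Because \<open>w x x = 1\<close>, the relation \<open>w x\<close> expresses
  \<open>x\<close> as minus the combination of \<open>B\<close> given by its other coordinates;
  hence the sign in \<open>\<phi>\<close>.\<close>

lemma representable_mat:
  fixes Z :: "('e \<Rightarrow> 'f::field) set"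
  assumes c: "config G Z"
  shows "representable_over TYPE('f) (mat G Z)"
proof -
  obtain B where B: "basis_of G Z G B"
    using basis_extend[OF c order_refl indep_mat_empty] by blast
  have fin: "finite G" "finite B" "B \<subseteq> G"
    using c B by (auto simp: config_def basis_of_def intro: finite_subset)
  have "\<exists>w. w \<in> Z \<and> w x = 1 \<and> supp w \<subseteq> insert x B" if "x \<in> G - B" for x
    using fundamental_relation[OF c, of B x] B that unfolding basis_of_def by blast
  then obtain w where w: "\<And>x. x \<in> G - B \<Longrightarrow> w x \<in> Z \<and> w x x = 1 \<and> supp (w x) \<subseteq> insert x B"
    by metis
  have w0: "w x x' = 0" if "x \<in> G - B" "x' \<in> G - B" "x' \<noteq> x" for x x'
    using w[OF that(1)] that by (auto simp: supp_def)
  obtain ix :: "'e \<Rightarrow> nat" where ix: "inj_on ix G"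
    using finite_imp_inj_to_nat_seg[OF fin(1)] by blast
  define \<phi> :: "'e \<Rightarrow> nat \<Rightarrow> 'f" where
    "\<phi> x i = (\<Sum>b\<in>B. if ix b = i then (if x \<in> B then (if x = b then 1 else 0) else - w x b) else 0)" for x i
  have \<phi>b: "\<phi> x (ix b) = (if x \<in> B then (if x = b then 1 else 0) else - w x b)" if "b \<in> B" for x b
  proof -
    have "\<phi> x (ix b) = (\<Sum>b'\<in>B. if b' = b then (if x \<in> B then (if x = b' then 1 else 0) else - w x b') else 0)"
      unfolding \<phi>_def using ix that fin by (intro sum.cong) (auto dest: inj_onD)
    then show ?thesis using that fin by (simp only: sum.delta if_True)
  qed
  \<comment> \<open>\<open>y\<close> is the member of \<open>Z\<close> that agrees with
    \<open>c\<close> off \<open>B\<close>. Coordinate \<open>b\<close> of the linear combination is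
    the deviation \<open>c b - y b\<close>, so the combination vanishes exactly if \<open>c\<close>
    equals \<open>y\<close> on \<open>G\<close>.\<close>
  have rel: "(\<forall>i. (\<Sum>x\<in>G. c x * \<phi> x i) = 0) \<longleftrightarrow> res G c \<in> Z" for c
  proof -
    define y where "y = (\<Sum>x\<in>G - B. fscale (c x) (w x))"
    note el = elimination[where D = "G - B" and w = w and z = c, folded y_def]
    have yZ: "y \<in> Z" unfolding y_def using \<open>config G Z\<close> w
      by (intro fs.subspace_sum fs.subspace_scale) (auto simp: config_def)
    have y1: "y x = c x" if "x \<in> G - B" for x
      by (rule el(2)) (use fin w w0 that in auto)
    have eq: "(\<Sum>x\<in>G. c x * \<phi> x (ix b)) = c b - y b" if b: "b \<in> B" for b
    proof -
      have "(\<Sum>x\<in>G. c x * \<phi> x (ix b)) = (\<Sum>x\<in>B. c x * \<phi> x (ix b)) + (\<Sum>x\<in>G - B. c x * \<phi> x (ix b))"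
        using sum.subset_diff[OF fin(3,1), of "\<lambda>x. c x * \<phi> x (ix b)"] by simp
      also have "(\<Sum>x\<in>B. c x * \<phi> x (ix b)) = (\<Sum>x\<in>B. if x = b then c b else 0)"
        using b by (intro sum.cong) (auto simp: \<phi>b)
      also have "\<dots> = c b" using b fin by simp
      also have "(\<Sum>x\<in>G - B. c x * \<phi> x (ix b)) = - y b"
        unfolding y_def sum_fun_apply using b
        by (simp add: \<phi>b sum_negf[symmetric])
      finally show ?thesis by simp
    qed
    have "(\<forall>i. (\<Sum>x\<in>G. c x * \<phi> x i) = 0) \<longleftrightarrow> (\<forall>b\<in>B. c b = y b)"
    proof
      assume "\<forall>i. (\<Sum>x\<in>G. c x * \<phi> x i) = 0"
      then show "\<forall>b\<in>B. c b = y b" using eq by (metis eq_iff_diff_eq_0)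
    next
      assume a: "\<forall>b\<in>B. c b = y b"
      show "\<forall>i. (\<Sum>x\<in>G. c x * \<phi> x i) = 0"
      proof
        fix i
        show "(\<Sum>x\<in>G. c x * \<phi> x i) = 0"
        proof (cases "i \<in> ix ` B")
          case True
          then show ?thesis using eq a by auto
        next
          case False
          then have "\<phi> x i = 0" for x unfolding \<phi>_def by (intro sum.neutral) auto
          then show ?thesis by simp
        qed
      qed
    qed
    also have "\<dots> \<longleftrightarrow> res G c = y"
    proof
      assume "\<forall>b\<in>B. c b = y b"
      moreover have "supp y \<subseteq> G" using yZ \<open>config G Z\<close> by (auto simp: config_def)
      ultimately show "res G c = y" using y1
        by (auto simp: fun_eq_iff res_def supp_def)
    next
      assume "res G c = y"
      then show "\<forall>b\<in>B. c b = y b" using fin by (metis res_apply subsetD)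
    qed
    also have "\<dots> \<longleftrightarrow> res G c \<in> Z"
    proof
      assume "res G c \<in> Z"
      then have "res G c - y \<in> Z" using yZ \<open>config G Z\<close> by (auto simp: config_def fs.subspace_diff)
      then have "res G c - y = 0"
        by (rule basis_spans[OF \<open>config G Z\<close> B]) (use y1 in \<open>auto simp: res_apply\<close>)
      then show "res G c = y" by simp
    qed (use yZ in auto)
    finally show ?thesis .
  qed
  have "I \<in> indep (mat G Z) \<longleftrightarrow> I \<subseteq> G \<and> lin_indep_family \<phi> I" for I
  proof (cases "I \<subseteq> G")
    case True
    have sumI: "(\<Sum>x\<in>I. c x * \<phi> x i) = (\<Sum>x\<in>G. res I c x * \<phi> x i)" for c i
      using True fin by (intro sum.mono_neutral_cong_left) (auto simp: res_apply)
    have GI: "G \<inter> I = I" using True by auto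
    have rI: "(\<forall>i. (\<Sum>x\<in>I. c x * \<phi> x i) = 0) \<longleftrightarrow> res I c \<in> Z" for c
      unfolding sumI rel by (simp add: GI)
    have "(\<forall>z\<in>Z. supp z \<subseteq> I \<longrightarrow> z = 0) \<longleftrightarrow> (\<forall>c. res I c \<in> Z \<longrightarrow> (\<forall>x\<in>I. c x = 0))"
    proof safe
      fix c x assume "\<forall>z\<in>Z. supp z \<subseteq> I \<longrightarrow> z = 0" "res I c \<in> Z" "x \<in> I"
      then have "res I c = 0" by simp
      then show "c x = 0" using \<open>x \<in> I\<close> by (metis res_apply zero_fun_apply)
    next
      fix z assume a: "\<forall>c. res I c \<in> Z \<longrightarrow> (\<forall>x\<in>I. c x = 0)" "z \<in> Z" "supp z \<subseteq> I"
      then have "\<forall>x\<in>I. z x = 0" using res_eq_self[OF a(3)] by auto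
      then show "z = 0" using a(3) by (auto simp: supp_def fun_eq_iff)
    qed
    then show ?thesis
      using True finite_subset[OF True fin(1)] by (simp add: indep_mat lin_indep_family_def rI)
  qed (simp add: indep_mat)
  then show ?thesis
    unfolding representable_over_def by (intro conjI is_matroid_mat[OF c] exI[of _ \<phi>] allI) simp
qed

section \<open>Minors of a configuration\<close>

lemma mat_restrict:
  assumes "S \<subseteq> G"
  shows "restrict_matroid (mat G Z) S = mat S (part Z S)"
proof -
  have "{I \<in> indep (mat G Z). I \<subseteq> S} = indep (mat S (part Z S))"
    using assms by (auto simp: indep_mat part_def) blast
  then show ?thesis by (simp add: restrict_matroid_def mat_def)
qed

lemma mat_delete: "delete (mat G Z) D = mat (G - D) (part Z (G - D))"
  by (simp add: delete_def mat_restrict)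

text \<open>The rank condition says that \<open>I \<union> B\<close> is independent for a basis
  \<open>B\<close> of \<open>C\<close>. A dependency whose trace off \<open>C\<close> lies in
  \<open>I\<close> can be corrected by one inside \<open>C\<close> until it is supported in
  \<open>I \<union> B\<close>, so independence of \<open>I \<union> B\<close> is a statement about
  traces off \<open>C\<close>.\<close>

lemma mat_contract:
  assumes c: "config G Z" and C: "C \<subseteq> G"
  shows "contract (mat G Z) C = mat (G - C) (res (G - C) ` Z)"
proof -
  obtain B where B: "basis_of G Z C B"
    using basis_extend[OF c C indep_mat_empty] by blast
  have BC: "B \<subseteq> C" using B by (auto simp: basis_of_def)
  have fin: "finite G" using c by (auto simp: config_def)
  have eqv: "int (rank (mat G Z) (I \<union> C)) - int (rank (mat G Z) C) = int (card I)
     \<longleftrightarrow> (\<forall>z\<in>res (G - C) ` Z. supp z \<subseteq> I \<longrightarrow> z = 0)" if I: "I \<subseteq> G - C" for I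
  proof -
    have IC: "I \<union> C \<subseteq> G" using I C by auto
    have finI: "finite I" "finite B" using fin I BC C by (auto intro: finite_subset)
    obtain B' where B': "basis_of G Z (I \<union> C) B'" "B \<subseteq> B'"
      using basis_extend[OF c IC, of B] B by (auto simp: basis_of_def)
    have finB': "finite B'" using B' IC fin by (auto simp: basis_of_def intro: finite_subset)
    have B'C: "B' \<inter> C = B"
    proof
      show "B' \<inter> C \<subseteq> B"
      proof
        fix x assume x: "x \<in> B' \<inter> C"
        show "x \<in> B"
        proof (rule ccontr)
          assume "x \<notin> B"
          then have "insert x B \<notin> indep (mat G Z)" using B x by (auto simp: basis_of_def)
          moreover have "insert x B \<subseteq> B'" using x B' by auto
          ultimately show False using B'(1) indep_mat_mono by (metis basis_of_def)
        qed
      qed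
    qed (use B'(2) BC in auto)
    have B'sub: "B' \<subseteq> I \<union> B" using B'(1) B'C by (auto simp: basis_of_def)
    have "int (rank (mat G Z) (I \<union> C)) - int (rank (mat G Z) C) = int (card I) \<longleftrightarrow> card B' = card I + card B"
      unfolding rank_mat[OF c B] rank_mat[OF c B'(1)] by linarith
    also have "\<dots> \<longleftrightarrow> B' = I \<union> B"
    proof -
      have "card (I \<union> B) = card I + card B"
        using I BC finI by (intro card_Un_disjoint) auto
      then show ?thesis
        using card_subset_eq[of "I \<union> B" B'] B'sub finI by auto
    qed
    also have "\<dots> \<longleftrightarrow> I \<union> B \<in> indep (mat G Z)"
    proof
      assume ind: "I \<union> B \<in> indep (mat G Z)"
      show "B' = I \<union> B"
      proof (rule ccontr)
        assume "B' \<noteq> I \<union> B"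
        then obtain x where "x \<in> I \<union> B" "x \<notin> B'" using B'sub by auto
        then have "insert x B' \<notin> indep (mat G Z)" "insert x B' \<subseteq> I \<union> B"
          using B'(1) B'sub B'(2) by (auto simp: basis_of_def)
        then show False using ind indep_mat_mono by blast
      qed
    qed (use B'(1) in \<open>auto simp: basis_of_def\<close>)
    also have "\<dots> \<longleftrightarrow> (\<forall>z\<in>Z. supp z \<subseteq> I \<union> B \<longrightarrow> z = 0)"
      using I BC C by (auto simp: indep_mat)
    also have "\<dots> \<longleftrightarrow> (\<forall>z\<in>Z. supp z \<inter> (G - C) \<subseteq> I \<longrightarrow> res (G - C) z = 0)"
    proof safe
      fix z assume a: "\<forall>z\<in>Z. supp z \<subseteq> I \<union> B \<longrightarrow> z = 0" "z \<in> Z" "supp z \<inter> (G - C) \<subseteq> I"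
      obtain y where y: "y \<in> part Z C" "\<And>x. x \<in> C - B \<Longrightarrow> y x = z x"
        using reduce_to_basis[OF c B C, of z] by blast
      have "supp z \<subseteq> G" using a c by (auto simp: config_def)
      moreover have "supp y \<subseteq> C" using y by (auto simp: part_def)
      ultimately have "supp (z - y) \<subseteq> I \<union> B"
      proof (intro subsetI)
        fix x assume x: "x \<in> supp (z - y)" and sub: "supp z \<subseteq> G" "supp y \<subseteq> C"
        show "x \<in> I \<union> B"
        proof (cases "x \<in> C")
          case True
          then show ?thesis using y(2)[of x] x by (auto simp: supp_def)
        next
          case False
          then have "y x = 0" using sub by (auto simp: supp_def)
          then have "x \<in> supp z" using x by (auto simp: supp_def)
          then show ?thesis using a(3) sub False by blast
        qed
      qed
      moreover have "z - y \<in> Z" using a y c by (auto simp: part_def config_def fs.subspace_diff)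
      ultimately have "z - y = 0" using a by blast
      then have "z = y" by simp
      then show "res (G - C) z = 0" using \<open>supp y \<subseteq> C\<close> by (auto simp: res_def supp_def fun_eq_iff)
    next
      fix z assume a: "\<forall>z\<in>Z. supp z \<inter> (G - C) \<subseteq> I \<longrightarrow> res (G - C) z = 0" "z \<in> Z" "supp z \<subseteq> I \<union> B"
      then have "res (G - C) z = 0" using BC by auto
      then have "supp z \<inter> (G - C) = {}" by (metis supp_res supp_0)
      then have "supp z \<subseteq> B" using a(3) I by auto
      then show "z = 0" using B a(2) by (auto simp: basis_of_def indep_mat)
    qed
    finally show ?thesis by simp
  qed
  have "{I. I \<subseteq> G - C \<and> int (rank (mat G Z) (I \<union> C)) - int (rank (mat G Z) C) = int (card I)}
    = indep (mat (G - C) (res (G - C) ` Z))"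
    unfolding set_eq_iff mem_Collect_eq indep_mat by (intro allI conj_cong refl eqv)
  then show ?thesis by (simp add: contract_def mat_def)
qed

text \<open>\<open>res A ` Z\<close> has dimension at most \<open>r\<close> modulo \<open>part Z A\<close>; this is \<open>\<lambda>(A, G - A) \<le> r\<close>.\<close>
definition cut :: "('e \<Rightarrow> 'f::field) set \<Rightarrow> nat \<Rightarrow> 'e set \<Rightarrow> bool" where
  "cut Z r A \<longleftrightarrow> (\<exists>S. finite S \<and> card S \<le> r \<and> res A ` Z \<subseteq> fs.span (part Z A \<union> S))"

text \<open>A smaller space of traces on \<open>A\<close>, taken modulo a larger space of
  dependencies inside \<open>A\<close>, has no larger dimension. This is how the perturbed summands
  inherit the cuts of the original matroid.\<close>

lemma cut_mono:
  assumes "cut Z r A" "res A ` Y \<subseteq> res A ` Z" "part Z A \<subseteq> part Y A"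
  shows "cut Y r A"
proof -
  obtain S where S: "finite S" "card S \<le> r" "res A ` Z \<subseteq> fs.span (part Z A \<union> S)"
    using assms by (auto simp: cut_def)
  have "fs.span (part Z A \<union> S) \<subseteq> fs.span (part Y A \<union> S)"
    using assms by (intro fs.span_mono) auto
  then have "res A ` Y \<subseteq> fs.span (part Y A \<union> S)"
    using S(3) assms(2) by (meson order_trans)
  then show ?thesis unfolding cut_def using S(1,2) by (intro exI[of _ S] conjI)
qed

text \<open>For bases \<open>B1\<close> and \<open>B2\<close> of the two sides and a basis
  \<open>B\<close> with \<open>B1 \<subseteq> B \<subseteq> B1 \<union> B2\<close>, the connectivity
  is the number of elements of \<open>D = B2 - B\<close>. The fundamental relations of
  \<open>D\<close>, traced to \<open>A\<close>, generate all traces modulo the dependencies inside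
  \<open>A\<close>.\<close>

lemma cut_if_conn_lambda:
  assumes c: "config G Z" and A: "A \<subseteq> G" and l: "conn_lambda (mat G Z) A (G - A) \<le> int r"
  shows "cut Z r A"
proof -
  have fin: "finite G" using c by (auto simp: config_def)
  have Ac: "G - A \<subseteq> G" by auto
  obtain B1 where B1: "basis_of G Z A B1"
    using basis_extend[OF c A indep_mat_empty] by blast
  obtain B2 where B2: "basis_of G Z (G - A) B2"
    using basis_extend[OF c Ac indep_mat_empty] by blast
  have sub: "B1 \<subseteq> A" "B2 \<subseteq> G - A" using B1 B2 by (auto simp: basis_of_def)
  then have sub': "B1 \<union> B2 \<subseteq> G" using A by auto
  obtain B where B: "basis_of G Z (B1 \<union> B2) B" "B1 \<subseteq> B"
    using basis_extend[OF c sub', of B1] B1 by (auto simp: basis_of_def)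
  have Bsub: "B \<subseteq> B1 \<union> B2" using B by (auto simp: basis_of_def)
  \<comment> \<open>An element outside \<open>B1 \<union> B2\<close> depends on \<open>B1\<close> or
    on \<open>B2\<close>. Elements of \<open>B1 \<union> B2\<close> outside \<open>B\<close> that
    occur in this relation are eliminated by a dependency inside
    \<open>B1 \<union> B2\<close>.\<close>
  have BG: "basis_of G Z G B"
    unfolding basis_of_def
  proof (intro conjI ballI)
    show "B \<in> indep (mat G Z)" "B \<subseteq> G" using B Bsub sub' by (auto simp: basis_of_def)
    fix x assume x: "x \<in> G - B"
    show "insert x B \<notin> indep (mat G Z)"
    proof
      assume ind: "insert x B \<in> indep (mat G Z)"
      obtain w where w: "w \<in> Z" "w x = 1" "supp w \<subseteq> insert x (B1 \<union> B2)"
      proof (cases "x \<in> B1 \<union> B2")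
        case True
        then show ?thesis using B ind x by (auto simp: basis_of_def)
      next
        case False
        show ?thesis
        proof (cases "x \<in> A")
          case True
          then have "insert x B1 \<notin> indep (mat G Z)" using False B1 by (auto simp: basis_of_def)
          then show ?thesis using fundamental_relation[OF c, of B1 x] B1 x that
            by (auto simp: basis_of_def)
        next
          case F2: False
          then have "insert x B2 \<notin> indep (mat G Z)" using False B2 x by (auto simp: basis_of_def)
          then show ?thesis using fundamental_relation[OF c, of B2 x] B2 x that
            by (auto simp: basis_of_def)
        qed
      qed
      obtain y where y: "y \<in> part Z (B1 \<union> B2)" "\<And>e. e \<in> B1 \<union> B2 - B \<Longrightarrow> y e = w e"
        using reduce_to_basis[OF c B(1) sub', of w] by blast
      have xn: "x \<notin> B1 \<union> B2"
        using B ind x by (auto simp: basis_of_def)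
      have "supp (w - y) \<subseteq> insert x B"
      proof
        fix e assume e: "e \<in> supp (w - y)"
        show "e \<in> insert x B"
        proof (rule ccontr)
          assume n: "e \<notin> insert x B"
          then have "e \<notin> B1 \<union> B2" using y(2)[of e] e by (auto simp: supp_def)
          moreover from this have "y e = 0" using y(1) by (auto simp: part_def supp_def)
          then have "e \<in> supp w" using e by (simp add: supp_def)
          ultimately show False using w(3) n by blast
        qed
      qed
      moreover have "w - y \<in> Z" using w y c by (auto simp: part_def config_def fs.subspace_diff)
      ultimately have "w - y = 0" using ind by (auto simp: indep_mat)
      then have "w = y" by simp
      then have "x \<in> supp y" using w by (simp add: supp_def)
      then show False using y(1) xn unfolding part_def by blast
    qed
  qed
  define D where "D = B2 - B"
  have finD: "finite D" "finite B1" "finite B2" "finite B"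
    using fin sub' Bsub by (auto simp: D_def intro: finite_subset)
  have "card B1 + card B2 \<le> r + card B"
  proof -
    have "A \<union> (G - A) = G" using A by auto
    then show ?thesis using l unfolding conn_lambda_def
      using rank_mat[OF c B1] rank_mat[OF c B2] rank_mat[OF c BG] by simp
  qed
  moreover have "B1 \<union> B2 = B \<union> D" using B Bsub by (auto simp: D_def)
  moreover have "card (B1 \<union> B2) = card B1 + card B2"
    using sub finD by (intro card_Un_disjoint) auto
  moreover have "card (B \<union> D) = card B + card D"
    using finD by (intro card_Un_disjoint) (auto simp: D_def)
  ultimately have cD: "card D \<le> r" by simp
  have "\<exists>w. w \<in> Z \<and> w x = 1 \<and> supp w \<subseteq> insert x B" if "x \<in> D" for x
    using fundamental_relation[OF c, of B x] BG that sub unfolding basis_of_def D_def by blast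
  then obtain w where w: "\<And>x. x \<in> D \<Longrightarrow> w x \<in> Z \<and> w x x = 1 \<and> supp (w x) \<subseteq> insert x B"
    by metis
  have w0: "w x x' = 0" if "x \<in> D" "x' \<in> D" "x' \<noteq> x" for x x'
    using w[OF that(1)] that by (auto simp: supp_def D_def)
  define S where "S = (\<lambda>x. res A (w x)) ` D"
  have "res A z \<in> fs.span (part Z A \<union> S)" if z: "z \<in> Z" for z
  proof -
    \<comment> \<open>\<open>y1\<close> clears the far side outside \<open>B2\<close> and has no
      trace on \<open>A\<close>; \<open>y2\<close> clears \<open>A\<close> outside \<open>B1\<close>
      and lies in \<open>part Z A\<close>. The remainder \<open>u\<close> lives on
      \<open>B1 \<union> B2\<close> and is determined by its coordinates in
      \<open>D\<close>.\<close>
    obtain y1 where y1: "y1 \<in> part Z (G - A)" "\<And>x. x \<in> G - A - B2 \<Longrightarrow> y1 x = z x"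
      using reduce_to_basis[OF c B2 Ac, of z] by blast
    obtain y2 where y2: "y2 \<in> part Z A" "\<And>x. x \<in> A - B1 \<Longrightarrow> y2 x = (z - y1) x"
      using reduce_to_basis[OF c B1 A, of "z - y1"] by blast
    define u where "u = z - y1 - y2"
    define y where "y = (\<Sum>x\<in>D. fscale (u x) (w x))"
    note el = elimination[where D = D and w = w and z = u, folded y_def]
    have uZ: "u \<in> Z" using z y1 y2 c by (auto simp: u_def part_def config_def fs.subspace_diff)
    have yZ: "y \<in> Z" unfolding y_def using c w
      by (intro fs.subspace_sum fs.subspace_scale) (auto simp: config_def)
    have "u - y = 0"
    proof (rule basis_spans[OF c BG])
      show "u - y \<in> Z" using uZ yZ c by (auto simp: config_def fs.subspace_diff)
      fix x assume x: "x \<in> G - B"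
      show "(u - y) x = 0"
      proof (cases "x \<in> D")
        case True
        have "y x = u x"
          by (rule el(2)) (use True finD w w0 in auto)
        then show ?thesis by simp
      next
        case False
        have "supp y \<subseteq> (\<Union>x\<in>D. supp (w x))"
          by (rule el(3)) (use finD w w0 in auto)
        then have "supp y \<subseteq> B \<union> D" using w by blast
        then have "y x = 0" using x False by (auto simp: supp_def)
        moreover have "u x = 0"
        proof (cases "x \<in> A")
          case True
          moreover have "x \<notin> B1" using x B(2) by blast
          ultimately show ?thesis using y2(2)[of x] by (simp add: u_def)
        next
          case F: False
          then have "y2 x = 0" using y2 by (auto simp: part_def supp_def)
          moreover have "x \<in> G - A - B2" using F x False by (simp add: D_def)
          ultimately show ?thesis using y1(2)[of x] by (simp add: u_def)
        qed
        ultimately show ?thesis by simp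
      qed
    qed
    then have "z = y1 + y2 + y" by (simp add: u_def algebra_simps)
    moreover have "res A y1 = 0" using y1 by (auto simp: part_def res_def supp_def fun_eq_iff)
    moreover have "res A y2 = y2" using y2 by (auto simp: part_def res_eq_self)
    ultimately have "res A z = y2 + res A y" by (simp add: res_add)
    moreover have "res A y = (\<Sum>x\<in>D. fscale (u x) (res A (w x)))"
      unfolding y_def by (auto simp: fun_eq_iff res_apply sum_fun_apply)
    moreover have "(\<Sum>x\<in>D. fscale (u x) (res A (w x))) \<in> fs.span (part Z A \<union> S)"
      by (intro fs.span_sum fs.span_scale fs.span_base) (auto simp: S_def)
    ultimately show ?thesis using y2 by (metis UnI1 fs.span_add fs.span_base)
  qed
  moreover have "finite S" "card S \<le> r"
    using finD cD card_image_le[OF finD(1), of "\<lambda>x. res A (w x)"] by (auto simp: S_def)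
  ultimately show ?thesis unfolding cut_def by (intro exI[of _ S] conjI) auto
qed

lemma cut_singleton:
  assumes "1 \<le> r"
  shows "cut Z r {x}"
proof -
  have "res {x} z = fscale (z x) (\<lambda>y. if y = x then 1 else 0)" for z :: "'a \<Rightarrow> 'b"
    by (auto simp: res_def fun_eq_iff)
  then have "res {x} ` Z \<subseteq> fs.span (part Z {x} \<union> {\<lambda>y. if y = x then 1 else 0})"
    by (auto intro: fs.span_scale fs.span_base)
  moreover have "card {\<lambda>y. if y = x then 1 else (0::'b)} \<le> r" using assms by simp
  ultimately show ?thesis
    unfolding cut_def by (intro exI[of _ "{\<lambda>y. if y = x then 1 else 0}"] conjI) auto
qed

lemma cut_trivial: "config G Z \<Longrightarrow> cut Z r {}" "config G Z \<Longrightarrow> cut Z r G"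
proof -
  assume c: "config G Z"
  have 0: "0 \<in> part Z A" for A using c by (auto simp: part_def config_def fs.subspace_0)
  then have "res {} ` Z \<subseteq> part Z {}" by auto
  then show "cut Z r {}" unfolding cut_def
    by (intro exI[of _ "{}"]) (use fs.span_superset in fastforce)
  have "res G ` Z \<subseteq> part Z G" using c by (auto simp: config_def part_def res_eq_self)
  then show "cut Z r G" unfolding cut_def
    by (intro exI[of _ "{}"]) (use fs.span_superset in fastforce)
qed

section \<open>Contraction-deletion-depth and separators\<close>

text \<open>\<open>has_cdd\<close> is a relation and not a function, so a bound is the existence of
  a derivation with a small value.\<close>

definition cdd_le :: "'a matroid \<Rightarrow> nat \<Rightarrow> bool" where
  "cdd_le M k \<longleftrightarrow> (\<exists>d\<le>k. has_cdd M d)"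

lemma cdd_le_mono: "cdd_le M k \<Longrightarrow> k \<le> l \<Longrightarrow> cdd_le M l"
  unfolding cdd_le_def by (meson order_trans)

lemma cdd_le_single: "card (ground M) = 1 \<Longrightarrow> 1 \<le> k \<Longrightarrow> cdd_le M k"
  unfolding cdd_le_def using has_cdd.single by blast

text \<open>The connected rule demands derivations for all elements under both operations although
  only the smallest value counts, so some derivation must be available everywhere. The ground set
  has to be nonempty: no rule of \<open>has_cdd\<close> applies to an empty one.\<close>

lemma has_cdd_exists:
  "finite (ground M) \<Longrightarrow> ground M \<noteq> {} \<Longrightarrow> \<exists>d. has_cdd M d"
proof (induction "card (ground M)" arbitrary: M rule: less_induct)
  case less
  have pos: "card (ground M) \<noteq> 0" using less.prems by simp
  show ?case
  proof (cases "card (ground M) = 1")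
    case True
    then show ?thesis using has_cdd.single by blast
  next
    case False
    then have 2: "card (ground M) \<ge> 2" using pos by linarith
    show ?thesis
    proof (cases "connected_matroid M")
      case True
      have ex: "\<exists>d. has_cdd N d" if "e \<in> ground M" "ground N = ground M - {e}" for e N
      proof (rule less.hyps)
        have c: "card (ground N) = card (ground M) - 1" using that less.prems by simp
        then show "card (ground N) < card (ground M)" using 2 by linarith
        show "finite (ground N)" using that less.prems by simp
        have "card (ground N) \<noteq> 0" using c 2 by linarith
        then show "ground N \<noteq> {}" by auto
      qed
      have "\<forall>e\<in>ground M. \<exists>d. has_cdd (contract M {e}) d"
        by (auto intro!: ex simp: contract_def)
      moreover have "\<forall>e\<in>ground M. \<exists>d. has_cdd (delete M {e}) d"
        by (auto intro!: ex simp: delete_def restrict_matroid_def)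
      ultimately show ?thesis using has_cdd.connected[OF 2 True] by metis
    next
      case False
      have "\<exists>d. has_cdd (restrict_matroid M C) d" if C: "C \<in> components M" for C
      proof (rule less.hyps)
        have "C \<subseteq> ground M" "C \<noteq> {}" "C \<noteq> ground M"
          using C False by (auto simp: components_def connected_matroid_def)
        then show "card (ground (restrict_matroid M C)) < card (ground M)"
          "finite (ground (restrict_matroid M C))" "ground (restrict_matroid M C) \<noteq> {}"
          using less.prems by (auto simp: restrict_matroid_def psubset_card_mono finite_subset)
      qed
      then show ?thesis using has_cdd.disconnected[OF 2 False] by metis
    qed
  qed
qed

lemma cdd_le_connected:
  assumes fin: "finite (ground M)" and card: "card (ground M) \<ge> 2" and con: "connected_matroid M"
    and e: "e \<in> ground M" and k: "cdd_le (contract M {e}) k \<or> cdd_le (delete M {e}) k"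
  shows "cdd_le M (k + 1)"
proof -
  have ne: "ground M - {x} \<noteq> {}" for x
  proof
    assume "ground M - {x} = {}"
    then have "card (ground M) \<le> card {x}" by (intro card_mono) auto
    then show False using card by simp
  qed
  have g: "\<forall>x. \<exists>d. has_cdd (contract M {x}) d"
    using fin ne by (intro allI has_cdd_exists) (simp_all add: contract_def)
  have h: "\<forall>x. \<exists>d. has_cdd (delete M {x}) d"
    using fin ne by (intro allI has_cdd_exists) (simp_all add: delete_def restrict_matroid_def)
  have "\<exists>g h. (\<forall>x. has_cdd (contract M {x}) (g x) \<and> has_cdd (delete M {x}) (h x)) \<and> min (g e) (h e) \<le> k"
  proof -
    obtain g0 h0 where gh: "\<And>x. has_cdd (contract M {x}) (g0 x)" "\<And>x. has_cdd (delete M {x}) (h0 x)"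
      using g h by metis
    from k show ?thesis
    proof
      assume "cdd_le (contract M {e}) k"
      then obtain d where "d \<le> k" "has_cdd (contract M {e}) d" by (auto simp: cdd_le_def)
      \<comment> \<open>Arbitrary derivations serve away from \<open>e\<close>, since the minimum is
        at most the value at \<open>e\<close>.\<close>
      then show ?thesis using gh by (intro exI[of _ "g0(e := d)"] exI[of _ h0]) auto
    next
      assume "cdd_le (delete M {e}) k"
      then obtain d where "d \<le> k" "has_cdd (delete M {e}) d" by (auto simp: cdd_le_def)
      then show ?thesis using gh by (intro exI[of _ g0] exI[of _ "h0(e := d)"]) auto
    qed
  qed
  then obtain g h where gh: "\<And>x. has_cdd (contract M {x}) (g x) \<and> has_cdd (delete M {x}) (h x)"
    "min (g e) (h e) \<le> k" by blast
  have "has_cdd M (1 + Min ((\<lambda>e. min (g e) (h e)) ` ground M))"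
    using has_cdd.connected[OF card con] gh(1) by blast
  moreover have "Min ((\<lambda>e. min (g e) (h e)) ` ground M) \<le> min (g e) (h e)"
    using fin e by (intro Min_le) auto
  ultimately show ?thesis unfolding cdd_le_def using gh(2) by (intro exI[of _ "1 + Min ((\<lambda>e. min (g e) (h e)) ` ground M)"]) linarith
qed

section \<open>Circuits, components and separators\<close>

lemma circuit_part: "S \<subseteq> G \<Longrightarrow> circuit (mat S (part Z S)) C \<longleftrightarrow> circuit (mat G Z) C \<and> C \<subseteq> S"
  unfolding circuit_def mat_restrict[symmetric] by (auto simp: restrict_matroid_def)

lemma circuit_relation:
  assumes "circuit (mat G Z) C"
  obtains z where "z \<in> Z" "supp z = C" "z \<noteq> 0"
proof -
  obtain z where z: "z \<in> Z" "supp z \<subseteq> C" "z \<noteq> 0"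
    using assms by (auto simp: circuit_def indep_mat)
  have "C \<subseteq> supp z"
  proof
    fix x assume "x \<in> C"
    then have "C - {x} \<in> indep (mat G Z)" using assms by (auto simp: circuit_def)
    then show "x \<in> supp z" using z unfolding indep_mat by blast
  qed
  then show ?thesis using that z by blast
qed

lemma circuit_minimal:
  assumes "circuit (mat G Z) C" "z \<in> Z" "supp z \<subset> C"
  shows "z = 0"
proof -
  obtain x where "x \<in> C" "supp z \<subseteq> C - {x}" using assms by blast
  then show ?thesis using assms by (auto simp: circuit_def indep_mat)
qed

lemma circuit_subset_eq:
  assumes "circuit (mat G Z) C" "circuit (mat G Z) C'" "C \<subseteq> C'"
  shows "C = C'"
  using assms circuit_relation[OF assms(1)] circuit_minimal[OF assms(2)] by (metis psubsetI)

lemma circuit_supp: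
  assumes "config G Z" "z \<in> Z" "z \<noteq> 0" "\<And>z'. z' \<in> Z \<Longrightarrow> supp z' \<subset> supp z \<Longrightarrow> z' = 0"
  shows "circuit (mat G Z) (supp z)"
  unfolding circuit_def indep_mat ground_mat
proof (intro conjI ballI impI)
  show "supp z \<subseteq> G" using assms(1,2) by (auto simp: config_def)
  then show "supp z - {x} \<subseteq> G" for x by blast
  show "\<not> (supp z \<subseteq> G \<and> (\<forall>z'\<in>Z. supp z' \<subseteq> supp z \<longrightarrow> z' = 0))"
    using assms(2,3) by blast
  show "z' = 0" if "x \<in> supp z" "z' \<in> Z" "supp z' \<subseteq> supp z - {x}" for x z'
    using assms(4)[of z'] that by blast
qed

text \<open>Induction on the size of the support. A smaller nonzero dependency either contains
  \<open>x\<close> and replaces \<open>z\<close>, or a multiple of it is subtracted to remove a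
  point \<open>t\<close> of the support while the coordinate at \<open>x\<close> stays.\<close>

lemma circuit_through:
  assumes c: "config G Z"
  shows "z \<in> Z \<Longrightarrow> x \<in> supp z \<Longrightarrow> \<exists>C. circuit (mat G Z) C \<and> x \<in> C \<and> C \<subseteq> supp z"
proof (induction "card (supp z)" arbitrary: z rule: less_induct)
  case less
  have fin: "finite (supp z)" using c less.prems by (auto simp: config_def intro: finite_subset)
  show ?case
  proof (cases "\<exists>z'\<in>Z. supp z' \<subset> supp z \<and> z' \<noteq> 0")
    case True
    then obtain z' where z': "z' \<in> Z" "supp z' \<subset> supp z" "z' \<noteq> 0" by blast
    show ?thesis
    proof (cases "x \<in> supp z'")
      case True
      then show ?thesis using less.hyps[of z'] z' fin by (meson psubset_card_mono psubsetE subset_trans)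
    next
      case False
      obtain t where t: "t \<in> supp z'" using z' by (metis all_not_in_conv supp_empty_iff)
      define y where "y = z - fscale (z t / z' t) z'"
      have y: "y \<in> Z" using c less.prems z' by (auto simp: y_def config_def fs.subspace_diff fs.subspace_scale)
      have xy: "x \<in> supp y" using False less.prems by (auto simp: y_def supp_def)
      have "supp y \<subseteq> supp z" "t \<notin> supp y" using z' t by (auto simp: y_def supp_def)
      then have sub: "supp y \<subset> supp z" using t z' by blast
      then show ?thesis using less.hyps[of y] y xy fin by (meson psubset_card_mono psubsetE subset_trans)
    qed
  next
    case False
    have "circuit (mat G Z) (supp z)"
      by (rule circuit_supp[OF c]) (use False less.prems in auto)
    then show ?thesis using less.prems by blast
  qed
qed

lemma circuit_elimination:
  assumes c: "config G Z" and C: "circuit (mat G Z) C1" "circuit (mat G Z) C2"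
    and x: "x \<in> C1 - C2" and y: "y \<in> C1 \<inter> C2"
  shows "\<exists>C. circuit (mat G Z) C \<and> x \<in> C \<and> C \<subseteq> C1 \<union> C2 - {y}"
proof -
  obtain z1 where z1: "z1 \<in> Z" "supp z1 = C1" using circuit_relation[OF C(1)] by blast
  obtain z2 where z2: "z2 \<in> Z" "supp z2 = C2" using circuit_relation[OF C(2)] by blast
  define z where "z = z1 - fscale (z1 y / z2 y) z2"
  have y0: "z2 y \<noteq> 0" using y z2 by (auto simp: supp_def)
  have "z \<in> Z" using c z1 z2 by (auto simp: z_def config_def fs.subspace_diff fs.subspace_scale)
  moreover have "x \<in> supp z" using x z1 z2 by (auto simp: z_def supp_def)
  moreover have "supp z \<subseteq> C1 \<union> C2" using z1 z2 by (auto simp: z_def supp_def)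
  moreover have "y \<notin> supp z" using y0 by (auto simp: z_def supp_def)
  ultimately show ?thesis using circuit_through[OF c, of z x] by blast
qed

text \<open>Induction on the size of \<open>C1 \<union> C2\<close>. Eliminating a common element
  \<open>y\<close> gives circuits \<open>C3\<close> through \<open>x\<close> and \<open>C4\<close>
  through \<open>w\<close> that avoid \<open>y\<close>. If \<open>C3\<close> covers
  \<open>C1 - C2\<close>, it meets \<open>C4\<close>, which is not contained in \<open>C2\<close>,
  and the union of these two is smaller. Otherwise \<open>C3\<close> and \<open>C2\<close> have a
  smaller union, and they meet because \<open>C3\<close> is not contained in
  \<open>C1\<close>.\<close>

lemma common_circuit_trans:
  assumes c: "config G Z"
  shows "circuit (mat G Z) C1 \<Longrightarrow> circuit (mat G Z) C2 \<Longrightarrow> C1 \<inter> C2 \<noteq> {} \<Longrightarrow> x \<in> C1 \<Longrightarrow> w \<in> C2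
    \<Longrightarrow> \<exists>C. circuit (mat G Z) C \<and> x \<in> C \<and> w \<in> C"
proof (induction "card (C1 \<union> C2)" arbitrary: C1 C2 rule: less_induct)
  case less
  have fin: "finite (C1 \<union> C2)"
    using c less.prems by (auto simp: config_def circuit_def intro: finite_subset)
  show ?case
  proof (cases "x \<in> C2 \<or> w \<in> C1")
    case True
    then show ?thesis using less.prems by blast
  next
    case False
    obtain y where y: "y \<in> C1" "y \<in> C2" using less.prems by blast
    obtain C3 where C3: "circuit (mat G Z) C3" "x \<in> C3" "C3 \<subseteq> C1 \<union> C2 - {y}"
      using circuit_elimination[OF c, of C1 C2 x y] less.prems y False by blast
    obtain C4 where C4: "circuit (mat G Z) C4" "w \<in> C4" "C4 \<subseteq> C1 \<union> C2 - {y}"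
      using circuit_elimination[OF c, of C2 C1 w y] less.prems y False by blast
    have n3: "\<not> C3 \<subseteq> C1" using circuit_subset_eq[OF C3(1) less.prems(1)] C3 y by blast
    have n4: "\<not> C4 \<subseteq> C2" using circuit_subset_eq[OF C4(1) less.prems(2)] C4 y by blast
    show ?thesis
    proof (cases "C1 \<union> C2 \<subseteq> C3 \<union> C2")
      case True
      have "C3 \<inter> C4 \<noteq> {}" using n4 C4(3) True by blast
      moreover have "card (C3 \<union> C4) < card (C1 \<union> C2)"
        by (rule psubset_card_mono[OF fin]) (use C3 C4 y in blast)
      ultimately show ?thesis using less.hyps[of C3 C4] C3 C4 by blast
    next
      case F: False
      have "card (C3 \<union> C2) < card (C1 \<union> C2)"
        by (rule psubset_card_mono[OF fin]) (use C3 F in blast)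
      moreover have "C3 \<inter> C2 \<noteq> {}" using n3 C3 by blast
      ultimately show ?thesis using less.hyps[of C3 C2] C3 less.prems by blast
    qed
  qed
qed

text \<open>For a subspace \<open>Z\<close> the rest \<open>z - res X z\<close> then lies in
  \<open>Z\<close> as well, so \<open>Z\<close> is the direct sum of its dependencies on
  \<open>X\<close> and off \<open>X\<close>.\<close>

definition separator :: "('e \<Rightarrow> 'f::field) set \<Rightarrow> 'e set \<Rightarrow> bool" where
  "separator Z X \<longleftrightarrow> (\<forall>z\<in>Z. res X z \<in> Z)"

lemma separator_circuit:
  assumes "separator Z X" "circuit (mat G Z) C" "C \<inter> X \<noteq> {}"
  shows "C \<subseteq> X"
proof (rule ccontr)
  assume n: "\<not> C \<subseteq> X"
  obtain z where z: "z \<in> Z" "supp z = C" using circuit_relation[OF assms(2)] by blast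
  have "res X z \<in> Z" using assms z by (auto simp: separator_def)
  moreover have "supp (res X z) \<subset> C" using n z by auto
  ultimately have "res X z = 0" using circuit_minimal[OF assms(2)] by blast
  then have "supp (res X z) = {}" by simp
  then show False using z assms by simp
qed

text \<open>By transitivity through a common point, \<open>S \<union> C\<close> again has common
  circuits for all pairs, so the maximality of \<open>S\<close> absorbs \<open>C\<close>.\<close>

lemma component_circuit:
  assumes c: "config G Z" and S: "S \<in> components (mat G Z)" and C: "circuit (mat G Z) C" "C \<inter> S \<noteq> {}"
  shows "C \<subseteq> S"
proof -
  obtain y where y: "y \<in> C" "y \<in> S" using C by blast
  have S': "S \<subseteq> G" "common_circuit_set (mat G Z) S"
    "\<And>T. S \<subseteq> T \<Longrightarrow> T \<subseteq> G \<Longrightarrow> common_circuit_set (mat G Z) T \<Longrightarrow> T = S"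
    using S by (auto simp: components_def)
  have main: "\<exists>C'. circuit (mat G Z) C' \<and> u \<in> C' \<and> v \<in> C'" if u: "u \<in> S" and v: "v \<in> C" for u v
  proof (cases "u = y")
    case True
    then show ?thesis using y v C by blast
  next
    case False
    then obtain C1 where "circuit (mat G Z) C1" "u \<in> C1" "y \<in> C1"
      using S'(2) u y by (auto simp: common_circuit_set_def)
    then show ?thesis using common_circuit_trans[OF c, of C1 C u v] C y v by blast
  qed
  have "common_circuit_set (mat G Z) (S \<union> C)"
    unfolding common_circuit_set_def
  proof (intro ballI impI)
    fix u v assume uv: "u \<in> S \<union> C" "v \<in> S \<union> C" "u \<noteq> v"
    show "\<exists>C'. circuit (mat G Z) C' \<and> u \<in> C' \<and> v \<in> C'"
    proof (cases "u \<in> S \<and> v \<in> S")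
      case True
      then show ?thesis using S'(2) uv by (auto simp: common_circuit_set_def)
    next
      case False
      then show ?thesis using uv main[of u v] main[of v u] C by blast
    qed
  qed
  moreover have "S \<union> C \<subseteq> G" using S' C by (auto simp: circuit_def)
  ultimately show ?thesis using S'(3)[of "S \<union> C"] by blast
qed

text \<open>A dependency is a combination of circuit vectors, obtained by repeatedly cancelling a
  point of its support, and each circuit lies in \<open>S\<close> or avoids it.\<close>

lemma component_separator:
  assumes c: "config G Z" and S: "S \<in> components (mat G Z)"
  shows "separator Z S"
proof -
  have "z \<in> Z \<Longrightarrow> res S z \<in> Z" for z
  proof (induction "card (supp z)" arbitrary: z rule: less_induct)
    case less
    have sub: "fs.subspace Z" using c by (simp add: config_def)
    show ?case
    proof (cases "z = 0")
      case True
      then show ?thesis using less by simp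
    next
      case False
      then obtain x where x: "x \<in> supp z" by (metis all_not_in_conv supp_empty_iff)
      obtain C where C: "circuit (mat G Z) C" "x \<in> C" "C \<subseteq> supp z"
        using circuit_through[OF c less.prems x] by blast
      obtain w where w: "w \<in> Z" "supp w = C" using circuit_relation[OF C(1)] by blast
      define y where "y = z - fscale (z x / w x) w"
      have yZ: "y \<in> Z" using sub less.prems w by (simp add: y_def fs.subspace_diff fs.subspace_scale)
      have "supp y \<subseteq> supp z" using w C by (auto simp: y_def supp_def)
      moreover have "x \<notin> supp y" using w C by (auto simp: y_def supp_def)
      ultimately have "card (supp y) < card (supp z)"
        using x c less.prems by (intro psubset_card_mono) (auto simp: config_def intro: finite_subset)
      then have "res S y \<in> Z" using less.hyps yZ by blast
      moreover have "res S w \<in> Z"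
      proof (cases "C \<inter> S = {}")
        case True
        then have "supp (res S w) = {}" using w by simp
        then have "res S w = 0" by (simp only: supp_empty_iff)
        then show ?thesis using fs.subspace_0[OF sub] by simp
      next
        case False
        then have "res S w = w" using component_circuit[OF c S C(1)] w by (simp add: res_eq_self)
        then show ?thesis using w by simp
      qed
      moreover have "res S z = res S y + fscale (z x / w x) (res S w)"
        by (auto simp: y_def res_def fun_eq_iff)
      ultimately show ?thesis by (simp add: fs.subspace_add[OF sub] fs.subspace_scale[OF sub])
    qed
  qed
  then show ?thesis by (simp add: separator_def)
qed

lemma component_subset: "S \<in> components (mat G Z) \<Longrightarrow> S \<subseteq> G \<and> S \<noteq> {}"
  by (auto simp: components_def)

lemma components_nonempty:
  assumes "config G Z" "G \<noteq> {}"
  shows "components (mat G Z) \<noteq> {}" "finite (components (mat G Z))"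
proof -
  have fin: "finite G" using assms by (simp add: config_def)
  obtain x where x: "x \<in> G" using assms by blast
  define F where "F = {T. T \<noteq> {} \<and> T \<subseteq> G \<and> common_circuit_set (mat G Z) T}"
  have "finite F" by (rule finite_subset[of _ "Pow G"]) (use fin in \<open>auto simp: F_def\<close>)
  moreover have "{x} \<in> F" using x by (auto simp: F_def common_circuit_set_def)
  ultimately obtain S where S: "S \<in> F" "\<And>T. T \<in> F \<Longrightarrow> S \<subseteq> T \<Longrightarrow> S = T"
    using finite_has_maximal[of F] by (metis empty_iff)
  have "S \<in> components (mat G Z)"
    unfolding components_def mem_Collect_eq ground_mat
  proof (intro conjI allI impI)
    show "S \<noteq> {}" "S \<subseteq> G" "common_circuit_set (mat G Z) S" using S(1) by (auto simp: F_def)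
    fix T assume T: "S \<subseteq> T \<and> T \<subseteq> G \<and> common_circuit_set (mat G Z) T"
    then have "T \<in> F" using \<open>S \<noteq> {}\<close> by (auto simp: F_def)
    then show "T = S" using S(2) T by blast
  qed
  then show "components (mat G Z) \<noteq> {}" by blast
  show "finite (components (mat G Z))"
    by (rule finite_subset[of _ "Pow G"]) (use fin in \<open>auto simp: components_def\<close>)
qed

lemma part_self: "config G Z \<Longrightarrow> part Z G = Z"
  by (auto simp: part_def config_def)

lemma part_part: "S \<subseteq> X \<Longrightarrow> part (part Z X) S = part Z S"
  by (auto simp: part_def)

lemma connected_component:
  assumes c: "config G Z" and con: "connected_matroid (mat G Z)" and "G \<noteq> {}"
  shows "S \<in> components (mat G Z) \<longleftrightarrow> S = G"
  using assms by (auto simp: components_def connected_matroid_def)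

text \<open>A connected matroid is its own only component, so the connected and the disconnected
  case obey one rule and depth can be bounded component by component.\<close>

lemma cdd_le_iff_components:
  assumes c: "config G Z" and ne: "G \<noteq> {}" and k: "1 \<le> k"
  shows "cdd_le (mat G Z) k \<longleftrightarrow> (\<forall>S\<in>components (mat G Z). cdd_le (mat S (part Z S)) k)"
proof (cases "connected_matroid (mat G Z)")
  case True
  then show ?thesis using connected_component[OF c True ne] part_self[OF c] by auto
next
  case False
  have fin: "finite G" using c by (simp add: config_def)
  have 2: "card (ground (mat G Z)) \<ge> 2"
  proof (rule ccontr)
    assume "\<not> ?thesis"
    then have "card G = 1" using ne fin by (cases "card G") auto
    then obtain x where "G = {x}" by (metis card_1_singletonE)
    then show False using False by (auto simp: connected_matroid_def common_circuit_set_def)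
  qed
  have fc: "finite (components (mat G Z))" "components (mat G Z) \<noteq> {}"
    using components_nonempty[OF c ne] by auto
  have restr: "restrict_matroid (mat G Z) S = mat S (part Z S)" if "S \<in> components (mat G Z)" for S
    using mat_restrict component_subset[OF that] by blast
  show ?thesis
  proof
    assume "cdd_le (mat G Z) k"
    then obtain d where d: "d \<le> k" "has_cdd (mat G Z) d" by (auto simp: cdd_le_def)
    from d(2) show "\<forall>S\<in>components (mat G Z). cdd_le (mat S (part Z S)) k"
    proof cases
      case single
      then show ?thesis using 2 by simp
    next
      case (disconnected f)
      show ?thesis
      proof
        fix S assume S: "S \<in> components (mat G Z)"
        then have "f S \<le> d" using disconnected fc by simp
        then show "cdd_le (mat S (part Z S)) k"
          using disconnected S d restr[OF S] unfolding cdd_le_def by (metis order_trans)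
      qed
    next
      case (connected g h)
      then show ?thesis using False by simp
    qed
  next
    assume "\<forall>S\<in>components (mat G Z). cdd_le (mat S (part Z S)) k"
    then have "\<forall>S\<in>components (mat G Z). \<exists>d. d \<le> k \<and> has_cdd (restrict_matroid (mat G Z) S) d"
      using restr by (auto simp: cdd_le_def)
    then obtain f where f: "\<forall>S\<in>components (mat G Z). f S \<le> k \<and> has_cdd (restrict_matroid (mat G Z) S) (f S)"
      by metis
    then have "has_cdd (mat G Z) (Max (f ` components (mat G Z)))"
      using has_cdd.disconnected[OF 2 False] by blast
    moreover have "Max (f ` components (mat G Z)) \<le> k" using f fc by simp
    ultimately show "cdd_le (mat G Z) k" unfolding cdd_le_def by blast
  qed
qed

lemma common_circuit_part:
  assumes "X \<subseteq> G" "T \<subseteq> X" "separator Z X"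
  shows "common_circuit_set (mat X (part Z X)) T \<longleftrightarrow> common_circuit_set (mat G Z) T"
proof -
  have "(\<exists>C. circuit (mat X (part Z X)) C \<and> x \<in> C \<and> y \<in> C)
    \<longleftrightarrow> (\<exists>C. circuit (mat G Z) C \<and> x \<in> C \<and> y \<in> C)" if "x \<in> T" for x y
  proof -
    have "C \<subseteq> X" if "circuit (mat G Z) C" "x \<in> C" for C
      using separator_circuit[OF assms(3) that(1)] that(2) \<open>x \<in> T\<close> assms(2) by blast
    then show ?thesis unfolding circuit_part[OF assms(1)] by blast
  qed
  then show ?thesis unfolding common_circuit_set_def by auto
qed

text \<open>Circuits meeting a separator stay inside it, so a set with common circuits that meets
  \<open>X\<close> cannot leave \<open>X\<close>, and maximality means the same in both
  matroids.\<close>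

lemma components_part:
  assumes X: "X \<subseteq> G" and sep: "separator Z X"
  shows "components (mat X (part Z X)) = {S \<in> components (mat G Z). S \<inter> X \<noteq> {}}"
proof -
  have sub: "T \<subseteq> X" if T: "common_circuit_set (mat G Z) T" "T \<inter> X \<noteq> {}" for T
  proof
    fix y assume y: "y \<in> T"
    obtain x where x: "x \<in> T" "x \<in> X" using T by blast
    show "y \<in> X"
    proof (cases "x = y")
      case False
      then obtain C where "circuit (mat G Z) C" "x \<in> C" "y \<in> C"
        using T x y by (auto simp: common_circuit_set_def)
      then show ?thesis using separator_circuit[OF sep, of G C] x by blast
    qed (use x in simp)
  qed
  show ?thesis
  proof (intro set_eqI iffI)
    fix S assume "S \<in> components (mat X (part Z X))"
    then have S: "S \<noteq> {}" "S \<subseteq> X" "common_circuit_set (mat X (part Z X)) S"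
      "\<And>T. S \<subseteq> T \<Longrightarrow> T \<subseteq> X \<Longrightarrow> common_circuit_set (mat X (part Z X)) T \<Longrightarrow> T = S"
      by (auto simp: components_def)
    have "T = S" if T: "S \<subseteq> T" "T \<subseteq> G" "common_circuit_set (mat G Z) T" for T
    proof -
      have "T \<subseteq> X" using sub[OF T(3)] S T by blast
      then show ?thesis using S(4)[of T] T common_circuit_part[OF X _ sep] by blast
    qed
    then show "S \<in> {S \<in> components (mat G Z). S \<inter> X \<noteq> {}}"
      using S X common_circuit_part[OF X S(2) sep] by (auto simp: components_def)
  next
    fix S assume "S \<in> {S \<in> components (mat G Z). S \<inter> X \<noteq> {}}"
    then have S: "S \<noteq> {}" "S \<subseteq> G" "common_circuit_set (mat G Z) S" "S \<inter> X \<noteq> {}"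
      "\<And>T. S \<subseteq> T \<Longrightarrow> T \<subseteq> G \<Longrightarrow> common_circuit_set (mat G Z) T \<Longrightarrow> T = S"
      by (auto simp: components_def)
    have SX: "S \<subseteq> X" using sub S by blast
    have "T = S" if T: "S \<subseteq> T" "T \<subseteq> X" "common_circuit_set (mat X (part Z X)) T" for T
      using S(5)[of T] T common_circuit_part[OF X T(2) sep] X by blast
    then show "S \<in> components (mat X (part Z X))"
      using S SX common_circuit_part[OF X SX sep] by (auto simp: components_def)
  qed
qed

lemma cdd_le_separator:
  assumes c: "config G Z" and X: "X \<subseteq> G" "X \<noteq> {}" and sep: "separator Z X"
    and k: "cdd_le (mat G Z) k" "1 \<le> k"
  shows "cdd_le (mat X (part Z X)) k"
proof -
  have "G \<noteq> {}" using X by blast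
  then have all: "\<forall>S\<in>components (mat G Z). cdd_le (mat S (part Z S)) k"
    using cdd_le_iff_components[OF c _ k(2)] k(1) by blast
  have "cdd_le (mat S (part (part Z X) S)) k" if "S \<in> components (mat X (part Z X))" for S
    using all that components_part[OF X(1) sep] component_subset[OF that] by (simp add: part_part)
  then show ?thesis
    using cdd_le_iff_components[OF config_part[OF c X(1)] X(2) k(2)] by blast
qed

text \<open>Each component lies in a single summand and is a component there, so the summands share
  the bound \<open>k\<close> and their depths do not add up.\<close>

lemma cdd_le_direct_sum:
  assumes c: "config G Z" and ne: "G \<noteq> {}" and G: "G = \<Union>P"
    and sep: "\<And>X. X \<in> P \<Longrightarrow> separator Z X"
    and le: "\<And>X. X \<in> P \<Longrightarrow> X \<noteq> {} \<Longrightarrow> cdd_le (mat X (part Z X)) k" and k: "1 \<le> k"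
  shows "cdd_le (mat G Z) k"
  unfolding cdd_le_iff_components[OF c ne k]
proof
  fix S assume S: "S \<in> components (mat G Z)"
  then obtain X where X: "X \<in> P" "S \<inter> X \<noteq> {}" using G component_subset[OF S] by blast
  then have XG: "X \<subseteq> G" "X \<noteq> {}" using G by auto
  have S': "S \<in> components (mat X (part Z X))"
    using components_part[OF XG(1) sep[OF X(1)]] S X by blast
  then have "cdd_le (mat S (part (part Z X) S)) k"
    using le[OF X(1) XG(2)] cdd_le_iff_components[OF config_part[OF c XG(1)] XG(2) k] by blast
  then show "cdd_le (mat S (part Z S)) k"
    using component_subset[OF S'] by (simp add: part_part)
qed

text \<open>The recursion removes elements from connected matroids only, so the argument runs per
  component \<open>S\<close>. The component containing \<open>e\<close> pays 1 for removing it and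
  any other one is unaffected. In both cases \<open>S - {e}\<close> is a separator of the smaller
  matroid and inherits the bound \<open>k\<close>.\<close>

lemma cdd_le_remove:
  assumes c: "config G Z" and e: "e \<in> G" "G \<noteq> {e}" and k: "1 \<le> k"
    and le: "cdd_le (mat (G - {e}) (part Z (G - {e}))) k \<or> cdd_le (mat (G - {e}) (res (G - {e}) ` Z)) k"
  shows "cdd_le (mat G Z) (k + 1)"
proof -
  have ne: "G \<noteq> {}" "1 \<le> k + 1" using e by auto
  have cP: "config (G - {e}) (part Z (G - {e}))" "config (G - {e}) (res (G - {e}) ` Z)"
    using config_part[OF c] config_res[OF c] by auto
  show ?thesis
    unfolding cdd_le_iff_components[OF c ne]
  proof
    fix S assume S: "S \<in> components (mat G Z)"
    have SG: "S \<subseteq> G" "S \<noteq> {}" using component_subset[OF S] by auto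
    have sep: "res S z \<in> Z" if "z \<in> Z" for z
      using component_separator[OF c S] that by (simp add: separator_def)
    have cS: "config S (part Z S)" using config_part[OF c SG(1)] .
    show "cdd_le (mat S (part Z S)) (k + 1)"
    proof (cases "S = {e}")
      case True
      then show ?thesis by (intro cdd_le_single) auto
    next
      case False
      define X where "X = S - {e}"
      have X: "X \<subseteq> G - {e}" "X \<noteq> {}" using SG False by (auto simp: X_def)
      have resX: "res X z = res S (res (G - {e}) z)" for z :: "'a \<Rightarrow> 'b"
        using SG by (auto simp: X_def res_def fun_eq_iff)
      have resX': "res X z = res (G - {e}) (res S z)" for z :: "'a \<Rightarrow> 'b"
        using SG by (auto simp: X_def res_def fun_eq_iff)
      have sep1: "separator (part Z (G - {e})) X"
        unfolding separator_def
      proof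
        fix z assume "z \<in> part Z (G - {e})"
        then have z: "z \<in> Z" "supp z \<subseteq> G - {e}" by (auto simp: part_def)
        then have "res X z = res S z" by (simp add: resX res_eq_self)
        then show "res X z \<in> part Z (G - {e})" using z sep[OF z(1)] by (auto simp: part_def)
      qed
      have sep2: "separator (res (G - {e}) ` Z) X"
        unfolding separator_def
      proof
        fix z assume "z \<in> res (G - {e}) ` Z"
        then obtain y where y: "y \<in> Z" "z = res (G - {e}) y" by blast
        then have "res X z = res (G - {e}) (res S y)"
          using SG by (auto simp: X_def res_def fun_eq_iff)
        then show "res X z \<in> res (G - {e}) ` Z" using sep[OF y(1)] by blast
      qed
      have p1: "part (part Z (G - {e})) X = part (part Z S) X"
        using X by (auto simp: part_def X_def)
      \<comment> \<open>Contracting \<open>e\<close> commutes with restricting to \<open>S\<close>: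
        a projected dependency supported in \<open>X\<close> may come from a large \<open>y\<close>,
        but the separator allows replacing \<open>y\<close> by its trace on
        \<open>S\<close>.\<close>
      have p2: "part (res (G - {e}) ` Z) X = res X ` part Z S"
      proof (intro set_eqI iffI)
        fix z assume "z \<in> part (res (G - {e}) ` Z) X"
        then obtain y where y: "y \<in> Z" "z = res (G - {e}) y" "supp z \<subseteq> X" by (auto simp: part_def)
        have "z = res X z" using y(3) by (simp add: res_eq_self)
        also have "\<dots> = res X (res S y)" using y(2) SG by (auto simp: X_def res_def fun_eq_iff)
        finally have "z = res X (res S y)" .
        moreover have "res S y \<in> part Z S" using sep[OF y(1)] by (simp add: part_def)
        ultimately show "z \<in> res X ` part Z S" by blast
      next
        fix z assume "z \<in> res X ` part Z S"
        then obtain y where y: "y \<in> Z" "supp y \<subseteq> S" "z = res X y" by (auto simp: part_def)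
        have "z = res (G - {e}) y" using y by (simp add: resX' res_eq_self)
        moreover have "supp z \<subseteq> X" using y by simp
        ultimately show "z \<in> part (res (G - {e}) ` Z) X" using y(1) by (auto simp: part_def)
      qed
      have le': "cdd_le (mat X (part (part Z S) X)) k \<or> cdd_le (mat X (res X ` part Z S)) k"
        using le cdd_le_separator[OF cP(1) X sep1 _ k] cdd_le_separator[OF cP(2) X sep2 _ k]
        unfolding p1 p2 by blast
      show ?thesis
      proof (cases "e \<in> S")
        case True
        have con: "connected_matroid (mat S (part Z S))"
          using common_circuit_part[OF SG(1) order_refl component_separator[OF c S]] S
          by (auto simp: connected_matroid_def components_def)
        have fin: "finite S" using cS by (simp add: config_def)
        have 2: "card S \<ge> 2"
        proof -
          obtain x where "x \<in> X" using X by blast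
          then have "{e, x} \<subseteq> S" "e \<noteq> x" using True by (auto simp: X_def)
          then show ?thesis using card_mono[OF fin, of "{e, x}"] by simp
        qed
        have "contract (mat S (part Z S)) {e} = mat X (res X ` part Z S)"
          using mat_contract[OF cS, of "{e}"] True by (simp add: X_def)
        moreover have "delete (mat S (part Z S)) {e} = mat X (part (part Z S) X)"
          by (simp add: mat_delete X_def)
        ultimately show ?thesis
          using cdd_le_connected[of "mat S (part Z S)" e k] fin 2 con True le' by auto
      next
        case False
        then have XS: "X = S" by (auto simp: X_def)
        have "part (part Z S) S = part Z S" by (simp add: part_part)
        moreover have "res S ` part Z S = part Z S"
          by (auto simp: part_def res_eq_self image_iff)
        ultimately have "cdd_le (mat S (part Z S)) k" using le' XS by simp
        then show ?thesis using cdd_le_mono by (metis le_add1)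
      qed
    qed
  qed
qed

section \<open>Expansions\<close>

definition unit :: "'e \<Rightarrow> 'e \<Rightarrow> 'f::field" where
  "unit x = (\<lambda>y. if y = x then 1 else 0)"

lemma unit_apply: "unit x y = (if y = x then 1 else 0)"
  by (simp add: unit_def)

lemma supp_unit [simp]: "supp (unit x :: 'e \<Rightarrow> 'f::field) = {x}"
  by (auto simp: supp_def unit_def)

section \<open>Relative bases and hyperplanes\<close>

lemma mem_span_insert:
  assumes "fs.subspace S"
  shows "z \<in> fs.span (insert a S) \<longleftrightarrow> (\<exists>c. z - fscale c a \<in> S)"
  using fs.span_breakdown_eq[of z a S] fs.span_eq_iff[THEN iffD2, OF assms] by simp

lemma res_sum: "res A (\<Sum>B\<in>P. f B) = (\<Sum>B\<in>P. res A (f B :: 'e \<Rightarrow> 'f::field))"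
  by (auto simp: fun_eq_iff res_apply sum_fun_apply)

lemma res_Union:
  assumes "finite P" "disjoint P"
  shows "res (\<Union>P) z = (\<Sum>A\<in>P. res A (z :: 'e \<Rightarrow> 'f::field))"
proof
  fix x
  show "res (\<Union>P) z x = (\<Sum>A\<in>P. res A z) x"
  proof (cases "x \<in> \<Union>P")
    case True
    then obtain B where B: "B \<in> P" "x \<in> B" by blast
    have "(\<Sum>A\<in>P. res A z x) = (\<Sum>A\<in>P. if A = B then z x else 0)"
      using assms B by (intro sum.cong) (auto simp: res_apply disjoint_def)
    then show ?thesis using B assms True by (simp add: sum_fun_apply res_apply)
  next
    case False
    then show ?thesis by (auto simp: sum_fun_apply res_apply intro!: sum.neutral)
  qed
qed

lemma span_units:
  assumes "finite G"
  shows "{z. supp z \<subseteq> G} \<subseteq> fs.span (unit ` G :: ('e \<Rightarrow> 'f::field) set)"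
proof
  fix z :: "'e \<Rightarrow> 'f" assume "z \<in> {z. supp z \<subseteq> G}"
  then have z: "supp z \<subseteq> G" by simp
  have "z = (\<Sum>x\<in>G. fscale (z x) (unit x))"
  proof
    fix y
    have "(\<Sum>x\<in>G. z x * unit x y) = (\<Sum>x\<in>G. if y = x then z y else 0)"
      by (intro sum.cong) (auto simp: unit_apply)
    also have "\<dots> = z y" using assms z by (auto simp: supp_def)
    finally show "z y = (\<Sum>x\<in>G. fscale (z x) (unit x)) y" by (simp add: sum_fun_apply)
  qed
  moreover have "(\<Sum>x\<in>G. fscale (z x) (unit x)) \<in> fs.span (unit ` G)"
    by (intro fs.span_sum fs.span_scale fs.span_base) auto
  ultimately show "z \<in> fs.span (unit ` G)" by simp
qed

text \<open>Bases of \<open>V0\<close>, \<open>V\<close> and \<open>V'\<close> are chosen to extend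
  one another, and the basis of \<open>V0\<close> is then dropped. The sets
  \<open>T \<subseteq> T'\<close> so record the dimensions of \<open>V\<close> and \<open>V'\<close>
  modulo \<open>V0\<close>; if \<open>V\<close> is a proper subspace, \<open>T\<close> is strictly
  smaller than \<open>T'\<close>.\<close>

lemma relative_basis:
  fixes V :: "('e \<Rightarrow> 'f::field) set"
  assumes fin: "finite G" "finite S" and V0: "fs.subspace V0" and V: "V \<subseteq> V'"
    and sub: "V0 \<subseteq> V" "V' \<subseteq> {z. supp z \<subseteq> G}" and sp: "V' \<subseteq> fs.span (V0 \<union> S)"
    and sV: "fs.subspace V" "fs.subspace V'"
  shows "\<exists>T T'. finite T' \<and> T \<subseteq> T' \<and> card T' \<le> card S \<and> T' \<subseteq> V' \<and> V = fs.span (V0 \<union> T) \<and> V' = fs.span (V0 \<union> T')"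
proof -
  obtain B0 where B0: "B0 \<subseteq> V0" "fs.independent B0" "V0 \<subseteq> fs.span B0"
    using fs.maximal_independent_subset by blast
  have "B0 \<subseteq> V" using B0 sub by blast
  then obtain B1 where B1: "B0 \<subseteq> B1" "B1 \<subseteq> V" "fs.independent B1" "V \<subseteq> fs.span B1"
    using fs.maximal_independent_subset_extend B0(2) by metis
  have "B1 \<subseteq> V'" using B1 V by blast
  then obtain B2 where B2: "B1 \<subseteq> B2" "B2 \<subseteq> V'" "fs.independent B2" "V' \<subseteq> fs.span B2"
    using fs.maximal_independent_subset_extend B1(3) by metis
  have "B2 \<subseteq> fs.span (unit ` G)" using B2 sub span_units[OF fin(1)] by blast
  then have finB2: "finite B2" using fs.independent_span_bound[of "unit ` G" B2] fin B2 by blast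
  then have finB: "finite B0" using B1 B2 by (meson finite_subset)
  have "fs.span (V0 \<union> S) \<subseteq> fs.span (B0 \<union> S)"
  proof (rule fs.span_minimal)
    show "V0 \<union> S \<subseteq> fs.span (B0 \<union> S)"
      using B0(3) fs.span_mono[of B0 "B0 \<union> S"] fs.span_superset[of "B0 \<union> S"] by blast
  qed simp
  then have "B2 \<subseteq> fs.span (B0 \<union> S)" using B2 sp by blast
  then have "card B2 \<le> card (B0 \<union> S)"
    using fs.independent_span_bound[of "B0 \<union> S" B2] finB fin B2 by blast
  also have "\<dots> \<le> card B0 + card S" by (rule card_Un_le)
  finally have c: "card (B2 - B0) \<le> card S"
    using card_Diff_subset[OF finB, of B2] B1 B2 by auto
  have span_eq: "W = fs.span (V0 \<union> (B - B0))"
    if "fs.subspace W" "V0 \<subseteq> W" "B \<subseteq> W" "W \<subseteq> fs.span B" for W B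
  proof
    have "B \<subseteq> V0 \<union> (B - B0)" using B0 by blast
    then show "W \<subseteq> fs.span (V0 \<union> (B - B0))" using fs.span_mono that(4) by blast
    show "fs.span (V0 \<union> (B - B0)) \<subseteq> W" using that by (intro fs.span_minimal) auto
  qed
  have "V = fs.span (V0 \<union> (B1 - B0))" using span_eq B1 sV sub by blast
  moreover have "V' = fs.span (V0 \<union> (B2 - B0))" using span_eq[of V' B2] B2 sV sub V by blast
  ultimately show ?thesis using c finB2 B2
    by (intro exI[of _ "B1 - B0"] exI[of _ "B2 - B0"]) auto
qed

text \<open>A basis of \<open>L\<close> together with \<open>t\<close> extends to a basis of
  \<open>V\<close>; leaving out \<open>t\<close> gives \<open>H\<close>.\<close>

lemma hyperplane:
  assumes V: "fs.subspace V" and L: "fs.subspace L" "L \<subseteq> V" and t: "t \<in> V" "t \<notin> L"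
  obtains H where "fs.subspace H" "L \<subseteq> H" "H \<subseteq> V" "t \<notin> H" "V = fs.span (insert t H)"
proof -
  obtain B0 where B0: "B0 \<subseteq> L" "fs.independent B0" "L \<subseteq> fs.span B0"
    using fs.maximal_independent_subset by blast
  have "fs.span B0 \<subseteq> L" using B0 L by (simp add: fs.span_minimal)
  then have "t \<notin> fs.span B0" using t by blast
  then have ind: "fs.independent (insert t B0)" using B0 by (simp add: fs.independent_insertI)
  have "insert t B0 \<subseteq> V" using B0 L t by blast
  then obtain B where B: "insert t B0 \<subseteq> B" "B \<subseteq> V" "fs.independent B" "V \<subseteq> fs.span B"
    using fs.maximal_independent_subset_extend ind by metis
  define H where "H = fs.span (B - {t})"
  have tH: "t \<notin> H" using B by (auto simp: H_def fs.dependent_def)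
  have "B0 \<subseteq> B - {t}" using B B0 t by blast
  then have LH: "L \<subseteq> H" using B0(3) fs.span_mono unfolding H_def by blast
  have HV: "H \<subseteq> V" unfolding H_def using B V by (intro fs.span_minimal) auto
  have "V = fs.span (insert t H)"
  proof
    have "B \<subseteq> insert t H" using fs.span_superset[of "B - {t}"] by (auto simp: H_def)
    then show "V \<subseteq> fs.span (insert t H)" using B(4) fs.span_mono by blast
    show "fs.span (insert t H) \<subseteq> V" using t HV V by (intro fs.span_minimal) auto
  qed
  then show ?thesis using that[of H] LH HV tH by (simp add: H_def)
qed

text \<open>Contracting the new elements \<open>Q\<close> and deleting the new elements \<open>K\<close> of a configuration
  of small depth yields \<open>(X, Z)\<close>.\<close>
definition expansion ::
  "'e set \<Rightarrow> 'e set \<Rightarrow> ('e \<Rightarrow> 'f::field) set \<Rightarrow> nat \<Rightarrow> 'e set \<Rightarrow> 'e set \<Rightarrow> ('e \<Rightarrow> 'f) set \<Rightarrow> bool" where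
  "expansion F X Z k Q K ZN \<longleftrightarrow> Q \<inter> K = {} \<and> (Q \<union> K) \<inter> (F \<union> X) = {}
     \<and> config (X \<union> Q \<union> K) ZN \<and> res X ` part ZN (- K) = Z \<and> cdd_le (mat (X \<union> Q \<union> K) ZN) k"

text \<open>The quantification over \<open>F\<close> makes it possible to choose the new elements fresh.\<close>
definition expandable :: "'e set \<Rightarrow> ('e \<Rightarrow> 'f::field) set \<Rightarrow> nat \<Rightarrow> bool" where
  "expandable X Z k \<longleftrightarrow> (\<forall>F. finite F \<longrightarrow> (\<exists>Q K ZN. expansion F X Z k Q K ZN))"

lemma expandable_mono:
  assumes "expandable X Z k" "k \<le> l"
  shows "expandable X Z l"
proof -
  have "expansion F X Z l Q K ZN" if "expansion F X Z k Q K ZN" for F Q K ZN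
    using that cdd_le_mono[OF _ assms(2)] by (auto simp: expansion_def)
  then show ?thesis using assms(1) unfolding expandable_def by meson
qed

lemma config_span_insert:
  assumes "config G Z" "finite G'" "G \<subseteq> G'" "supp t \<subseteq> G'"
  shows "config G' (fs.span (insert t Z))"
proof -
  have "fs.span (insert t Z) \<subseteq> {z. supp z \<subseteq> G'}"
    using assms by (intro fs.span_minimal subspace_supp) (auto simp: config_def)
  then show ?thesis using assms by (auto simp: config_def)
qed

text \<open>The new element \<open>q\<close> is marked in \<open>u = t + unit q\<close>. Contracting
  \<open>q\<close> turns \<open>u\<close> into the wanted generator \<open>t\<close>. Deleting
  \<open>q\<close> forbids every multiple of \<open>u\<close> and returns the old space
  \<open>ZN\<close>, which costs 1 in the depth.\<close>

lemma expandable_extend_relation: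
  fixes Z :: "('e \<Rightarrow> 'f::field) set"
  assumes inf: "infinite (UNIV :: 'e set)" and ne: "X \<noteq> {}" and k: "1 \<le> k"
    and c: "config X Z" and t: "supp t \<subseteq> X" and g: "expandable X Z k"
  shows "expandable X (fs.span (insert t Z)) (k + 1)"
  unfolding expandable_def
proof (intro allI impI)
  fix F :: "'e set" assume F: "finite F"
  have finX: "finite X" using c by (simp add: config_def)
  obtain q where q: "q \<notin> F \<union> X" using inf F finX by (metis ex_new_if_finite finite_UnI)
  have "finite (insert q F)" using F by simp
  then obtain Q K ZN where "expansion (insert q F) X Z k Q K ZN"
    using g unfolding expandable_def by blast
  then have N: "Q \<inter> K = {}" "(Q \<union> K) \<inter> (insert q F \<union> X) = {}"
    "config (X \<union> Q \<union> K) ZN" "res X ` part ZN (- K) = Z" "cdd_le (mat (X \<union> Q \<union> K) ZN) k"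
    by (auto simp: expansion_def)
  define G where "G = X \<union> Q \<union> K"
  define u where "u = t + unit q"
  define ZN' where "ZN' = fs.span (insert u ZN)"
  have sub: "fs.subspace ZN" "\<And>z. z \<in> ZN \<Longrightarrow> supp z \<subseteq> G" "finite G"
    using N(3) by (auto simp: config_def G_def)
  have qG: "q \<notin> G" using q N(2) by (auto simp: G_def)
  have ZN': "z \<in> ZN' \<longleftrightarrow> (\<exists>c. z - fscale c u \<in> ZN)" for z
    unfolding ZN'_def using mem_span_insert[OF sub(1)] .
  have su: "supp u \<subseteq> insert q X" using t supp_add[of t "unit q"] by (auto simp: u_def)
  have tq: "t q = 0" using t q by (auto simp: supp_def)
  have uq: "u q = 1" by (simp add: u_def unit_apply tq)
  have resu: "res X u = t"
    using q t by (auto simp: u_def res_def unit_apply fun_eq_iff supp_def)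
  have c': "config (insert q G) ZN'"
    unfolding ZN'_def by (rule config_span_insert[of G]) (use N(3) su sub in \<open>auto simp: G_def\<close>)
  have zq: "z q = 0" if "z \<in> ZN" for z using sub(2)[OF that] qG by (auto simp: supp_def)
  have del: "part ZN' (insert q G - {q}) = ZN"
  proof (intro set_eqI iffI)
    fix z assume "z \<in> part ZN' (insert q G - {q})"
    then have z: "z \<in> ZN'" "supp z \<subseteq> G" using qG by (auto simp: part_def)
    then obtain a where a: "z - fscale a u \<in> ZN" using ZN' by blast
    have "z q = 0" using z(2) qG by (auto simp: supp_def)
    then have "a = 0" using zq[OF a] uq by simp
    then show "z \<in> ZN" using a by simp
  next
    fix z assume z: "z \<in> ZN"
    then have "z \<in> ZN'" by (auto simp: ZN'_def intro: fs.span_base)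
    then show "z \<in> part ZN' (insert q G - {q})" using sub(2)[OF z] qG by (auto simp: part_def)
  qed
  have suK: "supp u \<subseteq> - K" using su N(2) q by blast
  have minor: "res X ` part ZN' (- K) = fs.span (insert t Z)"
  proof (intro set_eqI iffI)
    fix y assume "y \<in> res X ` part ZN' (- K)"
    then obtain z where z: "z \<in> ZN'" "supp z \<subseteq> - K" "y = res X z" by (auto simp: part_def)
    then obtain a where a: "z - fscale a u \<in> ZN" using ZN' by blast
    have "supp (z - fscale a u) \<subseteq> - K"
      using z(2) suK supp_diff[of z "fscale a u"] supp_fscale[of a u] by blast
    then have "res X (z - fscale a u) \<in> Z" using a N(4) by (auto simp: part_def)
    then have "y - fscale a t \<in> Z" by (simp add: res_diff res_fscale resu z)
    then show "y \<in> fs.span (insert t Z)" using mem_span_insert c by (auto simp: config_def)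
  next
    fix y assume "y \<in> fs.span (insert t Z)"
    then obtain a where "y - fscale a t \<in> Z"
      using mem_span_insert[of Z y t] c by (auto simp: config_def)
    then obtain w where w: "w \<in> ZN" "supp w \<subseteq> - K" "y - fscale a t = res X w"
      using N(4) by (auto simp: part_def)
    have "w + fscale a u \<in> ZN'" unfolding ZN' using w by (intro exI[of _ a]) simp
    moreover have "supp (w + fscale a u) \<subseteq> - K"
      using w(2) suK supp_add[of w "fscale a u"] supp_fscale[of a u] by blast
    moreover have "res X (w + fscale a u) = y"
      using w(3)[symmetric] by (simp add: res_add res_fscale resu)
    ultimately show "y \<in> res X ` part ZN' (- K)" by (force simp: part_def)
  qed
  have "cdd_le (mat (insert q G) ZN') (k + 1)"
  proof (rule cdd_le_remove[OF c' _ _ k])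
    show "insert q G \<noteq> {q}" using ne qG by (auto simp: G_def)
    have "insert q G - {q} = G" using qG by simp
    then have "cdd_le (mat (insert q G - {q}) (part ZN' (insert q G - {q}))) k"
      using del N(5) by (simp only: G_def)
    then show "cdd_le (mat (insert q G - {q}) (part ZN' (insert q G - {q}))) k
      \<or> cdd_le (mat (insert q G - {q}) (res (insert q G - {q}) ` ZN')) k" ..
  qed simp
  moreover have "insert q G = X \<union> insert q Q \<union> K" by (auto simp: G_def)
  ultimately have "expansion F X (fs.span (insert t Z)) (k + 1) (insert q Q) K ZN'"
    using N(1,2) q minor c' by (auto simp: expansion_def)
  then show "\<exists>Q K ZN. expansion F X (fs.span (insert t Z)) (k + 1) Q K ZN" by blast
qed

text \<open>Here \<open>q\<close> is deleted to obtain the minor and contracted to bound the depth.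
  The generator \<open>t\<close> exists only in the minor, so a lift \<open>s\<close> in
  \<open>ZN\<close> has to be marked instead, and \<open>ZN\<close> must be split as
  \<open>s\<close> plus a hyperplane \<open>H\<close> whose members with support off
  \<open>K\<close> project exactly onto \<open>Z\<close>.\<close>

lemma expandable_restrict_relation:
  fixes Z :: "('e \<Rightarrow> 'f::field) set"
  assumes inf: "infinite (UNIV :: 'e set)" and ne: "X \<noteq> {}" and k: "1 \<le> k"
    and c: "config X Z" and g: "expandable X (fs.span (insert t Z)) k"
  shows "expandable X Z (k + 1)"
proof (cases "t \<in> Z")
  case True
  then have "fs.span (insert t Z) = Z"
    using c fs.span_eq_iff[of Z] by (simp add: insert_absorb config_def)
  then show ?thesis using g expandable_mono by (metis le_add1)
next
  case tZ: False
  show ?thesis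
    unfolding expandable_def
  proof (intro allI impI)
    fix F :: "'e set" assume F: "finite F"
    have finX: "finite X" and sZ: "fs.subspace Z" using c by (auto simp: config_def)
    obtain q where q: "q \<notin> F \<union> X" using inf F finX by (metis ex_new_if_finite finite_UnI)
    have "finite (insert q F)" using F by simp
    then obtain Q K ZN where "expansion (insert q F) X (fs.span (insert t Z)) k Q K ZN"
      using g unfolding expandable_def by blast
    then have N: "Q \<inter> K = {}" "(Q \<union> K) \<inter> (insert q F \<union> X) = {}"
      "config (X \<union> Q \<union> K) ZN" "res X ` part ZN (- K) = fs.span (insert t Z)"
      "cdd_le (mat (X \<union> Q \<union> K) ZN) k"
      by (auto simp: expansion_def)
    define G where "G = X \<union> Q \<union> K"
    have sub: "fs.subspace ZN" "\<And>z. z \<in> ZN \<Longrightarrow> supp z \<subseteq> G" "finite G"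
      using N(3) by (auto simp: config_def G_def)
    have qG: "q \<notin> G" using q N(2) by (auto simp: G_def)
    have "t \<in> res X ` part ZN (- K)" unfolding N(4) by (simp add: fs.span_base)
    then obtain s where s: "s \<in> ZN" "supp s \<subseteq> - K" "t = res X s" by (auto simp: part_def)
    \<comment> \<open>\<open>L\<close> collects the members of \<open>ZN\<close> that survive the
      deletion of \<open>K\<close> and project into \<open>Z\<close>. They must remain unmarked,
      hence \<open>L \<subseteq> H\<close>; since \<open>t \<notin> Z\<close>, the lift
      \<open>s\<close> is not among them.\<close>
    define L where "L = part ZN (- K) \<inter> {z. res X z \<in> Z}"
    have "fs.subspace {z. res X z \<in> Z}"
      using sZ unfolding fs.subspace_def by (simp add: res_add res_fscale)
    then have L: "fs.subspace L"
      unfolding L_def using subspace_part[OF sub(1)] by (intro fs.subspace_inter)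
    have LZ: "L \<subseteq> ZN" "s \<notin> L" using tZ s by (auto simp: L_def part_def)
    obtain H where H: "fs.subspace H" "L \<subseteq> H" "H \<subseteq> ZN" "s \<notin> H" "ZN = fs.span (insert s H)"
      using hyperplane[OF sub(1) L LZ(1) s(1) LZ(2)] by blast
    define u where "u = s + unit q"
    define ZN' where "ZN' = fs.span (insert u H)"
    have ZN': "z \<in> ZN' \<longleftrightarrow> (\<exists>c. z - fscale c u \<in> H)" for z
      unfolding ZN'_def using mem_span_insert[OF H(1)] .
    have ZN: "z \<in> ZN \<longleftrightarrow> (\<exists>c. z - fscale c s \<in> H)" for z
      by (subst H(5)) (rule mem_span_insert[OF H(1)])
    have zq: "z q = 0" if "z \<in> ZN" for z using sub(2)[OF that] qG by (auto simp: supp_def)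
    have uq: "u q = 1" by (simp add: u_def unit_apply zq[OF s(1)])
    have su: "supp u \<subseteq> insert q G" using sub(2)[OF s(1)] supp_add[of s "unit q"] by (auto simp: u_def)
    have cH: "config G H" using H sub by (auto simp: config_def)
    have c': "config (insert q G) ZN'"
      unfolding ZN'_def by (rule config_span_insert[OF cH]) (use su sub in auto)
    have Gq: "insert q G - {q} = G" using qG by simp
    have resG: "res G z = z" if "z \<in> ZN" for z using sub(2)[OF that] by (rule res_eq_self)
    have resu: "res G u = s"
    proof -
      have "res G (unit q) = (0 :: 'e \<Rightarrow> 'f)" using qG by (auto simp: res_def unit_apply fun_eq_iff)
      then show ?thesis using resG[OF s(1)] by (simp add: u_def res_add)
    qed
    have con: "res G ` ZN' = ZN"
    proof (intro set_eqI iffI)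
      fix y assume "y \<in> res G ` ZN'"
      then obtain z a where z: "y = res G z" "z - fscale a u \<in> H" using ZN' by blast
      then have "res G (z - fscale a u) = z - fscale a u" using H(3) resG by blast
      then have "y - fscale a s = z - fscale a u" by (simp add: res_diff res_fscale resu z)
      then show "y \<in> ZN" using z ZN by metis
    next
      fix y assume y: "y \<in> ZN"
      then obtain a where a: "y - fscale a s \<in> H" using ZN by blast
      have "(y - fscale a s + fscale a u) - fscale a u \<in> H" using a by simp
      then have "y - fscale a s + fscale a u \<in> ZN'" using ZN' by blast
      moreover have "res G (y - fscale a s + fscale a u) = y"
        using y s(1) by (simp add: res_add res_diff res_fscale resu resG)
      ultimately show "y \<in> res G ` ZN'" by (metis imageI)
    qed
    have minor: "res X ` part ZN' (- insert q K) = Z"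
    proof (intro set_eqI iffI)
      fix y assume "y \<in> res X ` part ZN' (- insert q K)"
      then obtain z a where z: "y = res X z" "z - fscale a u \<in> H" "supp z \<subseteq> - insert q K"
        using ZN' by (auto simp: part_def)
      have "z q = 0" using z(3) by (auto simp: supp_def)
      moreover have "(z - fscale a u) q = 0" using z(2) H(3) zq by blast
      ultimately have "a = 0" using uq by simp
      then have zH: "z \<in> H" using z by simp
      have zK: "supp z \<subseteq> - K" using z(3) by blast
      have "y \<in> res X ` part ZN (- K)" using z(1) zH H(3) zK by (auto simp: part_def)
      then obtain b where b: "y - fscale b t \<in> Z" using N(4) mem_span_insert[OF sZ] by blast
      \<comment> \<open>Subtracting \<open>fscale b s\<close> moves \<open>z\<close> into
        \<open>L \<subseteq> H\<close>. As \<open>z\<close> itself is in \<open>H\<close>, so is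
        \<open>fscale b s\<close>, and \<open>s \<notin> H\<close> leaves only
        \<open>b = 0\<close>.\<close>
      have "z - fscale b s \<in> ZN" using zH H(3) s(1) sub(1) by (auto intro!: fs.subspace_diff fs.subspace_scale)
      moreover have "supp (z - fscale b s) \<subseteq> - K"
        using zK s(2) supp_diff[of z "fscale b s"] supp_fscale[of b s] by blast
      moreover have "res X (z - fscale b s) \<in> Z"
        using b s(3) z(1) by (simp add: res_diff res_fscale)
      ultimately have "z - fscale b s \<in> H" using H(2) by (auto simp: L_def part_def)
      then have "z - (z - fscale b s) \<in> H" by (rule fs.subspace_diff[OF H(1) zH])
      then have bs: "fscale b s \<in> H" by simp
      have "b = 0"
      proof (rule ccontr)
        assume "b \<noteq> 0"
        then have "s = fscale (1 / b) (fscale b s)" by (auto simp: fun_eq_iff)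
        then show False using bs H(1,4) by (metis fs.subspace_scale)
      qed
      then show "y \<in> Z" using b by simp
    next
      fix y assume y: "y \<in> Z"
      then have "y \<in> fs.span (insert t Z)" by (simp add: fs.span_base)
      then obtain w where w: "w \<in> ZN" "supp w \<subseteq> - K" "y = res X w"
        using N(4) by (auto simp: part_def)
      then have "w \<in> H" using H(2) y by (auto simp: L_def part_def)
      then have "w \<in> ZN'" by (simp add: ZN'_def fs.span_base)
      moreover have "supp w \<subseteq> - insert q K" using w sub(2)[OF w(1)] qG by blast
      ultimately show "y \<in> res X ` part ZN' (- insert q K)" using w(3) by (auto simp: part_def)
    qed
    have "cdd_le (mat (insert q G) ZN') (k + 1)"
    proof (rule cdd_le_remove[OF c' _ _ k])
      show "insert q G \<noteq> {q}" using ne qG by (auto simp: G_def)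
      have "cdd_le (mat (insert q G - {q}) (res (insert q G - {q}) ` ZN')) k"
        unfolding Gq con using N(5) by (simp only: G_def)
      then show "cdd_le (mat (insert q G - {q}) (part ZN' (insert q G - {q}))) k
        \<or> cdd_le (mat (insert q G - {q}) (res (insert q G - {q}) ` ZN')) k" ..
    qed simp
    moreover have "insert q G = X \<union> Q \<union> insert q K" by (auto simp: G_def)
    ultimately have "expansion F X Z (k + 1) Q (insert q K) ZN'"
      using N(1,2) q minor c' by (auto simp: expansion_def)
    then show "\<exists>Q K ZN. expansion F X Z (k + 1) Q K ZN" by blast
  qed
qed

text \<open>The members of \<open>P\<close> are served one after another, each avoiding
  \<open>F\<close> and everything chosen before, which is again a finite set.\<close>

lemma fresh_choice:
  assumes "finite P"
    and ex: "\<And>A F. A \<in> P \<Longrightarrow> finite F \<Longrightarrow> \<exists>n. R A n \<and> finite (s n) \<and> s n \<inter> F = {}"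
    and "finite F"
  shows "\<exists>N. (\<forall>A\<in>P. R A (N A) \<and> finite (s (N A)) \<and> s (N A) \<inter> F = {})
    \<and> (\<forall>A\<in>P. \<forall>B\<in>P. A \<noteq> B \<longrightarrow> s (N A) \<inter> s (N B) = {})"
  using assms(1,2)
proof (induction P rule: finite_induct)
  case empty
  then show ?case by simp
next
  case (insert A P)
  have "\<exists>N. (\<forall>A\<in>P. R A (N A) \<and> finite (s (N A)) \<and> s (N A) \<inter> F = {})
    \<and> (\<forall>A\<in>P. \<forall>B\<in>P. A \<noteq> B \<longrightarrow> s (N A) \<inter> s (N B) = {})"
    by (rule insert.IH) (use insert.prems in auto)
  then obtain N where N: "\<And>B. B \<in> P \<Longrightarrow> R B (N B) \<and> finite (s (N B)) \<and> s (N B) \<inter> F = {}"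
    "\<And>B C. B \<in> P \<Longrightarrow> C \<in> P \<Longrightarrow> B \<noteq> C \<Longrightarrow> s (N B) \<inter> s (N C) = {}" by metis
  have "finite (F \<union> (\<Union>B\<in>P. s (N B)))" using N insert.hyps \<open>finite F\<close> by auto
  then obtain n where n: "R A n" "finite (s n)" "s n \<inter> (F \<union> (\<Union>B\<in>P. s (N B))) = {}"
    using insert.prems[of A] by blast
  have n': "s n \<inter> s (N B) = {}" if "B \<in> P" for B using n(3) that by blast
  have "s n \<inter> F = {}" using n(3) by blast
  then show ?case
    using n(1,2) N n' insert.hyps by (intro exI[of _ "N(A := n)"]) (auto simp: Int_commute)
qed

text \<open>The parts are expanded separately with disjoint sets of new elements, and the expansions
  are put together as a direct sum. Every \<open>G A\<close> is a separator there, so the depth does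
  not grow.\<close>

lemma expandable_direct_sum:
  fixes Y :: "('e \<Rightarrow> 'f::field) set"
  assumes P: "finite P" "disjoint P" "P \<noteq> {}" "{} \<notin> P" and k: "1 \<le> k"
    and c: "config (\<Union>P) Y" and closed: "\<And>A y. A \<in> P \<Longrightarrow> y \<in> Y \<Longrightarrow> res A y \<in> Y"
    and ex: "\<And>A. A \<in> P \<Longrightarrow> expandable A (res A ` Y) k"
  shows "expandable (\<Union>P) Y k"
  unfolding expandable_def
proof (intro allI impI)
  fix F :: "'e set" assume F: "finite F"
  define X where "X = \<Union>P"
  have finX: "finite X" and sY: "fs.subspace Y" and suppY: "\<And>y. y \<in> Y \<Longrightarrow> supp y \<subseteq> X"
    using c by (auto simp: config_def X_def)
  define R where "R A n = (case n of (Q, K, ZN) \<Rightarrow> expansion (F \<union> X) A (res A ` Y) k Q K ZN)" for A n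
  define s :: "'e set \<times> 'e set \<times> ('e \<Rightarrow> 'f) set \<Rightarrow> 'e set" where "s n = fst n \<union> fst (snd n)" for n
  have "\<exists>n. R A n \<and> finite (s n) \<and> s n \<inter> F' = {}" if A: "A \<in> P" and F': "finite F'" for A F'
  proof -
    \<comment> \<open>An expansion of \<open>A\<close> by itself avoids only \<open>A\<close> and
      the forbidden set, so the other parts are forbidden by including all of
      \<open>X\<close>.\<close>
    have "finite (F \<union> X \<union> F')" using F finX F' by simp
    then obtain Q K ZN where e: "expansion (F \<union> X \<union> F') A (res A ` Y) k Q K ZN"
      using ex[OF A] unfolding expandable_def by meson
    then have "R A (Q, K, ZN)" "finite (Q \<union> K)" "(Q \<union> K) \<inter> F' = {}"
      unfolding R_def expansion_def config_def by auto
    then show ?thesis by (intro exI[of _ "(Q, K, ZN)"]) (simp add: s_def)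
  qed
  from fresh_choice[of P R s "F \<union> X", OF P(1) this] F finX
  obtain N where N: "\<And>A. A \<in> P \<Longrightarrow> R A (N A)"
    "\<And>A B. A \<in> P \<Longrightarrow> B \<in> P \<Longrightarrow> A \<noteq> B \<Longrightarrow> s (N A) \<inter> s (N B) = {}"
    by (metis finite_UnI)
  define Q where "Q A = fst (N A)" for A
  define K where "K A = fst (snd (N A))" for A
  define ZN where "ZN A = snd (snd (N A))" for A
  define G where "G A = A \<union> Q A \<union> K A" for A
  have NA: "N A = (Q A, K A, ZN A)" for A by (simp add: Q_def K_def ZN_def)
  have e: "expansion (F \<union> X) A (res A ` Y) k (Q A) (K A) (ZN A)" if "A \<in> P" for A
    using N(1)[OF that] by (simp add: R_def NA)
  have QK: "Q A \<inter> K A = {}" "(Q A \<union> K A) \<inter> (F \<union> X) = {}" "config (G A) (ZN A)"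
    "res A ` part (ZN A) (- K A) = res A ` Y" "cdd_le (mat (G A) (ZN A)) k" if "A \<in> P" for A
    using e[OF that] by (auto simp: expansion_def G_def)
  have disj: "(Q A \<union> K A) \<inter> (Q B \<union> K B) = {}" if "A \<in> P" "B \<in> P" "A \<noteq> B" for A B
    using N(2)[OF that] by (simp add: s_def NA)
  have AX: "A \<subseteq> X" if "A \<in> P" for A using that by (auto simp: X_def)
  have GA: "G A \<inter> X = A" if "A \<in> P" for A using QK(2)[OF that] AX[OF that] by (auto simp: G_def)
  have dG: "G A \<inter> G B = {}" if "A \<in> P" "B \<in> P" "A \<noteq> B" for A B
  proof -
    have "A \<inter> B = {}" using that P(2) by (auto simp: disjoint_def)
    then show ?thesis
      using disj[OF that] QK(2)[OF that(1)] QK(2)[OF that(2)] AX[OF that(1)] AX[OF that(2)]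
      unfolding G_def by blast
  qed
  have finG: "finite (G A)" "fs.subspace (ZN A)" "\<And>z. z \<in> ZN A \<Longrightarrow> supp z \<subseteq> G A" if "A \<in> P" for A
    using QK(3)[OF that] by (auto simp: config_def)
  define QQ where "QQ = (\<Union>A\<in>P. Q A)"
  define KK where "KK = (\<Union>A\<in>P. K A)"
  define GG where "GG = (\<Union>A\<in>P. G A)"
  have GG: "GG = X \<union> QQ \<union> KK" by (auto simp: GG_def G_def QQ_def KK_def X_def)
  \<comment> \<open>The direct sum is described by its projections, which makes membership of sums
    and restrictions immediate.\<close>
  define W where "W = {z. supp z \<subseteq> GG \<and> (\<forall>A\<in>P. res (G A) z \<in> ZN A)}"
  have sW: "fs.subspace W"
    unfolding fs.subspace_def
  proof (intro conjI ballI allI)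
    show "0 \<in> W" using finG(2) by (auto simp: W_def fs.subspace_0)
    show "x + y \<in> W" if "x \<in> W" "y \<in> W" for x y
      using that finG(2) supp_add[of x y] by (auto simp: W_def res_add intro!: fs.subspace_add)
    show "fscale a x \<in> W" if "x \<in> W" for a x
      using that finG(2) supp_fscale[of a x] by (auto simp: W_def res_fscale intro!: fs.subspace_scale)
  qed
  have cW: "config GG W" using sW finG(1) P(1) by (auto simp: config_def W_def GG_def)
  have resB: "res (G B) z = 0" if "A \<in> P" "B \<in> P" "A \<noteq> B" "supp z \<subseteq> G A" for A B and z :: "'e \<Rightarrow> 'f"
  proof -
    have "supp (res (G B) z) = {}" using that(4) dG[OF that(1-3)] by auto
    then show ?thesis by (simp only: supp_empty_iff)
  qed
  have WA: "z \<in> W" if A: "A \<in> P" and z: "z \<in> ZN A" for A z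
  proof -
    have sz: "supp z \<subseteq> G A" using finG(3) that by blast
    have "res (G B) z \<in> ZN B" if B: "B \<in> P" for B
    proof (cases "A = B")
      case True
      then show ?thesis using z res_eq_self[OF sz] by simp
    next
      case False
      then show ?thesis using resB[OF A B _ sz] fs.subspace_0[OF finG(2)[OF B]] by simp
    qed
    then show ?thesis using sz A by (auto simp: W_def GG_def)
  qed
  have pW: "part W (G A) = ZN A" if A: "A \<in> P" for A
  proof (intro set_eqI iffI)
    fix z assume "z \<in> part W (G A)"
    then have z: "supp z \<subseteq> G A" "res (G A) z \<in> ZN A" using A by (auto simp: part_def W_def)
    then show "z \<in> ZN A" by (simp add: res_eq_self)
  next
    fix z assume "z \<in> ZN A"
    then show "z \<in> part W (G A)" using WA A finG(3)[OF A] by (auto simp: part_def)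
  qed
  have sep: "separator W (G A)" if A: "A \<in> P" for A
    unfolding separator_def
  proof
    fix z assume "z \<in> W"
    then have "res (G A) z \<in> ZN A" using A by (auto simp: W_def)
    then show "res (G A) z \<in> W" using WA A by blast
  qed
  have "cdd_le (mat GG W) k"
  proof (rule cdd_le_direct_sum[OF cW, of "G ` P"])
    show "GG \<noteq> {}" using P(3,4) by (auto simp: GG X_def)
  qed (use sep QK(5) pW k in \<open>auto simp: GG_def\<close>)
  moreover have "res X ` part W (- KK) = Y"
  proof (intro set_eqI iffI)
    fix y assume "y \<in> res X ` part W (- KK)"
    then obtain z where z: "z \<in> W" "supp z \<subseteq> - KK" "y = res X z" by (auto simp: part_def)
    have "res A z \<in> Y" if A: "A \<in> P" for A
    proof -
      have "res (G A) z \<in> ZN A" using z A by (auto simp: W_def)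
      moreover have "supp (res (G A) z) \<subseteq> - K A" using z(2) A by (auto simp: KK_def)
      ultimately have "res A (res (G A) z) \<in> res A ` Y"
        using QK(4)[OF A] by (metis (no_types, lifting) imageI mem_Collect_eq part_def)
      moreover have "res A (res (G A) z) = res A z" by (auto simp: G_def res_def fun_eq_iff)
      ultimately show ?thesis using closed[OF A] by auto
    qed
    then have "(\<Sum>A\<in>P. res A z) \<in> Y" by (intro fs.subspace_sum[OF sY])
    then show "y \<in> Y" using res_Union[OF P(1,2), of z] z(3) by (simp add: X_def)
  next
    fix y assume y: "y \<in> Y"
    have "\<exists>z. z \<in> ZN A \<and> supp z \<subseteq> - K A \<and> res A z = res A y" if A: "A \<in> P" for A
    proof -
      have "res A y \<in> res A ` part (ZN A) (- K A)" using QK(4)[OF A] y by blast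
      then show ?thesis by (auto simp: part_def)
    qed
    then obtain zf where zf: "\<And>A. A \<in> P \<Longrightarrow> zf A \<in> ZN A \<and> supp (zf A) \<subseteq> - K A \<and> res A (zf A) = res A y"
      by metis
    define z where "z = (\<Sum>A\<in>P. zf A)"
    have "z \<in> W" unfolding z_def using zf WA by (intro fs.subspace_sum[OF sW]) blast
    moreover have "z \<in> {z. supp z \<subseteq> - KK}" unfolding z_def
    proof (rule fs.subspace_sum[OF subspace_supp])
      fix A assume A: "A \<in> P"
      have "supp (zf A) \<subseteq> G A" using zf[OF A] finG(3)[OF A] by blast
      moreover have "G A \<inter> KK \<subseteq> K A"
      proof
        fix x assume x: "x \<in> G A \<inter> KK"
        then obtain B where B: "B \<in> P" "x \<in> K B" by (auto simp: KK_def)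
        then have "x \<in> G B" by (auto simp: G_def)
        then have "A = B" using dG[OF A B(1)] x by blast
        then show "x \<in> K A" using B by simp
      qed
      ultimately show "zf A \<in> {z. supp z \<subseteq> - KK}" using zf[OF A] by blast
    qed
    moreover have "res X z = y"
    proof -
      have "res X (zf A) = res A y" if A: "A \<in> P" for A
      proof -
        have "res X (zf A) = res X (res (G A) (zf A))"
          using zf[OF A] finG(3)[OF A] by (metis res_eq_self)
        also have "\<dots> = res A (zf A)" using GA[OF A] by (simp add: Int_commute)
        finally show ?thesis using zf[OF A] by simp
      qed
      then have "res X z = (\<Sum>A\<in>P. res A y)" by (simp add: z_def res_sum)
      also have "\<dots> = res X y" using res_Union[OF P(1,2), of y] by (simp add: X_def)
      also have "\<dots> = y" using suppY[OF y] by (rule res_eq_self)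
      finally show ?thesis .
    qed
    ultimately show "y \<in> res X ` part W (- KK)" by (force simp: part_def)
  qed
  moreover have "QQ \<inter> KK = {}"
    using QK(1) disj unfolding QQ_def KK_def by blast
  moreover have "(QQ \<union> KK) \<inter> (F \<union> X) = {}"
    using QK(2) unfolding QQ_def KK_def by blast
  ultimately have "expansion F X Y k QQ KK W"
    using cW unfolding expansion_def GG by blast
  then show "\<exists>Q K ZN. expansion F (\<Union>P) Y k Q K ZN" unfolding X_def by meson
qed

section \<open>Perturbing a space into a direct sum\<close>

lemma subspace_res_vimage: "fs.subspace V \<Longrightarrow> fs.subspace {y. res A y \<in> V}"
  unfolding fs.subspace_def by (simp add: res_add res_fscale)

lemma span_Un_span: "fs.span (fs.span A \<union> B) = fs.span (A \<union> B)"
proof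
  show "fs.span (fs.span A \<union> B) \<subseteq> fs.span (A \<union> B)"
    using fs.span_mono[of A "A \<union> B"] fs.span_superset[of "A \<union> B"]
    by (intro fs.span_minimal) auto
  show "fs.span (A \<union> B) \<subseteq> fs.span (fs.span A \<union> B)"
    using fs.span_superset[of A] by (intro fs.span_mono) auto
qed

lemma span_Un_span': "fs.span (A \<union> fs.span B) = fs.span (A \<union> B)"
  using span_Un_span[of B A] by (simp only: Un_commute)

lemma Union_Diff_disjoint:
  assumes P: "disjoint P" and sub: "I \<subseteq> P" "D \<subseteq> I"
  shows "\<Union>I - \<Union>D = \<Union>(I - D)"
proof -
  have "x \<notin> C" if "B \<in> I - D" "C \<in> D" "x \<in> B" for x B C
    using disjointD[OF P, of B C] that sub by blast
  then show ?thesis by blast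
qed

text \<open>\<open>part Z (\<Union>I)\<close> and the direct sum \<open>Y\<close> differ by at most \<open>n\<close> generators each from the common
  subspace \<open>Z0\<close>.\<close>
definition direct_perturbation ::
  "('e \<Rightarrow> 'f::field) set \<Rightarrow> 'e set set \<Rightarrow> nat \<Rightarrow> ('e \<Rightarrow> 'f) set \<Rightarrow> ('e \<Rightarrow> 'f) set
    \<Rightarrow> ('e \<Rightarrow> 'f) set \<Rightarrow> ('e \<Rightarrow> 'f) set \<Rightarrow> bool" where
  "direct_perturbation Z I n Y Z0 T T' \<longleftrightarrow>
     finite T \<and> finite T' \<and> card T \<le> n \<and> card T' \<le> n \<and> fs.subspace Z0
     \<and> part Z (\<Union>I) = fs.span (Z0 \<union> T') \<and> Y = fs.span (Z0 \<union> T) \<and> (\<forall>y\<in>Y. supp y \<subseteq> \<Union>I)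
     \<and> (\<forall>A\<in>I. (\<forall>y\<in>Y. res A y \<in> Y) \<and> part Z A \<subseteq> Y \<and> res A ` Y \<subseteq> res A ` part Z (\<Union>I))"

text \<open>Induction on the bound \<open>m\<close> for the boundary dimension of the single parts,
  measured in the dependencies supported on the parts still present. At \<open>m = 0\<close> every
  trace on a part is already a dependency there, so the space splits. In the step, the parts in
  \<open>D\<close> are settled by the projection \<open>V\<close> of \<open>W\<close> to their
  union, and the induction hypothesis treats \<open>W'\<close>, the dependencies supported on the
  other parts.\<close>

lemma direct_perturbation_exists:
  fixes Z :: "('e \<Rightarrow> 'f::field) set"
  assumes P: "finite P" "disjoint P" and c: "config (\<Union>P) Z"
    and cut: "\<And>Q. Q \<subseteq> P \<Longrightarrow> cut Z r (\<Union>Q)"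
  shows "I \<subseteq> P \<Longrightarrow> (\<And>A. A \<in> I \<Longrightarrow> \<exists>S. finite S \<and> card S \<le> m \<and> res A ` part Z (\<Union>I) \<subseteq> fs.span (part Z A \<union> S))
    \<Longrightarrow> \<exists>Y Z0 T T'. direct_perturbation Z I (m * r) Y Z0 T T'"
proof (induction m arbitrary: I)
  case 0
  have sW: "fs.subspace (part Z (\<Union>I))" using c by (simp add: config_def subspace_part)
  have sp: "fs.span (part Z (\<Union>I)) = part Z (\<Union>I)" using sW by simp
  have pA: "part Z A \<subseteq> part Z (\<Union>I)" if "A \<in> I" for A using that by (intro part_mono) auto
  have "res A y \<in> part Z (\<Union>I)" if A: "A \<in> I" and y: "y \<in> part Z (\<Union>I)" for A y
  proof -
    obtain S where "finite S" "card S \<le> 0" "res A ` part Z (\<Union>I) \<subseteq> fs.span (part Z A \<union> S)"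
      using 0(2)[OF A] by blast
    then have "res A y \<in> fs.span (part Z A)" using y by auto
    also have "fs.span (part Z A) = part Z A" using c by (simp add: config_def subspace_part)
    finally show ?thesis using pA[OF A] by blast
  qed
  moreover have "\<forall>y\<in>part Z (\<Union>I). supp y \<subseteq> \<Union>I" by (simp add: part_def)
  ultimately have "direct_perturbation Z I (0 * r) (part Z (\<Union>I)) (part Z (\<Union>I)) {} {}"
    unfolding direct_perturbation_def using sW sp sp[symmetric] pA by (simp del: fs.span_eq_iff)
  then show ?case by meson
next
  case (Suc m)
  define W where "W = part Z (\<Union>I)"
  have sZ: "fs.subspace Z" and finX: "finite (\<Union>P)" using c by (auto simp: config_def)
  have sW: "fs.subspace W" using sZ by (simp add: W_def subspace_part)
  \<comment> \<open>Splitting means that the projection of \<open>W\<close> to the union of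
    \<open>D\<close> contains the trace on each single part of \<open>D\<close>, extended by
    zero.\<close>
  define split where "split D \<longleftrightarrow> D \<subseteq> I \<and> (\<forall>z\<in>W. \<forall>A\<in>D. \<exists>z'\<in>W. res (\<Union>D) z' = res A z)" for D
  have "finite {D. split D}"
    by (rule finite_subset[of _ "Pow P"]) (use P Suc.prems(1) in \<open>auto simp: split_def\<close>)
  moreover have "{} \<in> {D. split D}" by (simp add: split_def)
  ultimately obtain D where D: "split D" and Dmax: "\<And>D'. split D' \<Longrightarrow> D \<subseteq> D' \<Longrightarrow> D = D'"
    using finite_has_maximal[of "{D. split D}"] by (metis empty_iff mem_Collect_eq)
  have DI: "D \<subseteq> I" using D by (simp add: split_def)
  define I' where "I' = I - D"
  define W' where "W' = part Z (\<Union>I')"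
  have sW': "fs.subspace W'" using sZ by (simp add: W'_def subspace_part)
  have I'P: "I' \<subseteq> P" using Suc.prems by (auto simp: I'_def)
  have W'W: "W' \<subseteq> W" unfolding W_def W'_def by (rule part_mono) (auto simp: I'_def)
  have dP: "A \<inter> B = {}" if "A \<in> I" "B \<in> I" "A \<noteq> B" for A B
    using P(2) Suc.prems(1) that by (auto simp: disjoint_def)
  have W'I: "z \<in> W'" if "z \<in> W" "res (\<Union>D) z = 0" for z
  proof -
    have "supp (res (\<Union>D) z) = {}" using that by simp
    then have "supp z \<subseteq> \<Union>I - \<Union>D" using that(1) by (auto simp: W_def part_def)
    then show ?thesis
      using that(1) Union_Diff_disjoint[OF P(2) Suc.prems(1) DI] by (auto simp: W_def W'_def part_def I'_def)
  qed
  have W'D: "res (\<Union>D) z = 0" if "supp z \<subseteq> \<Union>I'" for z :: "'e \<Rightarrow> 'f"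
  proof -
    have "\<Union>I' \<inter> \<Union>D = {}" using Union_Diff_disjoint[OF P(2) Suc.prems(1) DI] by (auto simp: I'_def)
    then have "supp (res (\<Union>D) z) = {}" using that by auto
    then show ?thesis by (simp only: supp_empty_iff)
  qed
  have drop: "\<exists>S. finite S \<and> card S \<le> m \<and> res A ` part Z (\<Union>I') \<subseteq> fs.span (part Z A \<union> S)"
    if A: "A \<in> I'" for A
  proof -
    have AI: "A \<in> I" "A \<notin> D" "A \<subseteq> \<Union>I'" using A by (auto simp: I'_def)
    obtain S where S: "finite S" "card S \<le> Suc m" "res A ` W \<subseteq> fs.span (part Z A \<union> S)"
      using Suc.prems(2)[OF AI(1)] unfolding W_def by blast
    \<comment> \<open>If \<open>W'\<close> had all traces of \<open>W\<close> on \<open>A\<close>,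
      then \<open>A\<close> could join \<open>D\<close>: a suitable member of \<open>W'\<close>,
      which vanishes on \<open>D\<close>, realises a trace on \<open>A\<close> alone or cancels an
      unwanted one.\<close>
    have neq: "res A ` W' \<noteq> res A ` W"
    proof
      assume eq: "res A ` W' = res A ` W"
      have "split (insert A D)"
        unfolding split_def
      proof (intro conjI ballI)
        show "insert A D \<subseteq> I" using AI DI by blast
        fix z B assume z: "z \<in> W" and B: "B \<in> insert A D"
        have ins: "res (A \<union> \<Union>D) w = res A w + res (\<Union>D) w" for w :: "'e \<Rightarrow> 'f"
        proof -
          have "A \<inter> \<Union>D = {}" using dP[OF AI(1)] DI AI(2) by blast
          then show ?thesis by (auto simp: res_def fun_eq_iff)
        qed
        show "\<exists>z'\<in>W. res (\<Union>(insert A D)) z' = res B z"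
        proof (cases "B = A")
          case True
          have "res A z \<in> res A ` W'" using eq z by blast
          then obtain w where w: "w \<in> W'" "res A w = res A z" by auto
          moreover have "res (\<Union>D) w = 0" using w by (intro W'D) (simp add: W'_def part_def)
          ultimately show ?thesis using W'W True by (intro bexI[of _ w]) (auto simp: ins)
        next
          case False
          then have BD: "B \<in> D" using B by simp
          obtain z' where z': "z' \<in> W" "res (\<Union>D) z' = res B z" using D z BD unfolding split_def by meson
          have "res A z' \<in> res A ` W'" using eq z' by blast
          then obtain w where w: "w \<in> W'" "res A w = res A z'" by auto
          have "res (\<Union>D) w = 0" using w by (intro W'D) (simp add: W'_def part_def)
          then have "res (\<Union>(insert A D)) (z' - w) = res B z" using z' w by (simp add: ins res_diff)
          moreover have "z' - w \<in> W" using z' w W'W sW by (auto intro: fs.subspace_diff)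
          ultimately show ?thesis by blast
        qed
      qed
      then show False using Dmax[of "insert A D"] AI by blast
    qed
    have "\<exists>T T'. finite T' \<and> T \<subseteq> T' \<and> card T' \<le> card S \<and> T' \<subseteq> res A ` W
      \<and> res A ` W' = fs.span (part Z A \<union> T) \<and> res A ` W = fs.span (part Z A \<union> T')"
    proof (rule relative_basis[OF finX S(1)])
      show "part Z A \<subseteq> res A ` W'"
      proof
        fix z assume "z \<in> part Z A"
        then have "z \<in> W'" "res A z = z" using AI(3) by (auto simp: W'_def part_def res_eq_self)
        then show "z \<in> res A ` W'" by (metis imageI)
      qed
      show "res A ` W \<subseteq> {z. supp z \<subseteq> \<Union>P}" using Suc.prems(1) AI(1) by auto
    qed (use sZ sW sW' W'W S(3) in \<open>auto intro: subspace_part subspace_res\<close>)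
    then obtain T T' where T: "finite T'" "T \<subseteq> T'" "card T' \<le> card S"
      "res A ` W' = fs.span (part Z A \<union> T)" "res A ` W = fs.span (part Z A \<union> T')" by metis
    have "T \<noteq> T'" using T neq by auto
    then have "card T < card T'" using T by (intro psubset_card_mono) auto
    then have "card T \<le> m" using T(3) S(2) by linarith
    then show ?thesis using T finite_subset[OF T(2,1)] unfolding W'_def[symmetric]
      by (intro exI[of _ T]) auto
  qed
  obtain Y' Z0' T1 T1' where "direct_perturbation Z I' (m * r) Y' Z0' T1 T1'"
    using Suc.IH[OF I'P drop] by meson
  then have IH: "finite T1" "finite T1'" "card T1 \<le> m * r" "card T1' \<le> m * r" "fs.subspace Z0'"
      "W' = fs.span (Z0' \<union> T1')" "Y' = fs.span (Z0' \<union> T1)" "\<And>y. y \<in> Y' \<Longrightarrow> supp y \<subseteq> \<Union>I'"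
      "\<And>A y. A \<in> I' \<Longrightarrow> y \<in> Y' \<Longrightarrow> res A y \<in> Y'" "\<And>A. A \<in> I' \<Longrightarrow> part Z A \<subseteq> Y'"
      "\<And>A. A \<in> I' \<Longrightarrow> res A ` Y' \<subseteq> res A ` W'"
    unfolding direct_perturbation_def W'_def[symmetric]
    by meson+
  define ZD where "ZD = part Z (\<Union>D)"
  define V where "V = res (\<Union>D) ` W"
  have sV: "fs.subspace V" using sW by (simp add: V_def subspace_res)
  have sZD: "fs.subspace ZD" using sZ by (simp add: ZD_def subspace_part)
  have ZDW: "ZD \<subseteq> W" unfolding ZD_def W_def using DI by (intro part_mono) auto
  have ZDV: "ZD \<subseteq> V"
  proof
    fix z assume "z \<in> ZD"
    moreover from this have "res (\<Union>D) z = z" by (simp add: ZD_def part_def res_eq_self)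
    ultimately show "z \<in> V" using ZDW unfolding V_def by (metis imageI subsetD)
  qed
  have "D \<subseteq> P" using DI Suc.prems(1) by blast
  then obtain S where S: "finite S" "card S \<le> r" "res (\<Union>D) ` Z \<subseteq> fs.span (ZD \<union> S)"
    using cut[of D] unfolding cut_def ZD_def by meson
  have "\<exists>T T'. finite T' \<and> T \<subseteq> T' \<and> card T' \<le> card S \<and> T' \<subseteq> V
      \<and> V = fs.span (ZD \<union> T) \<and> V = fs.span (ZD \<union> T')"
  proof (rule relative_basis[OF finX S(1) sZD order_refl ZDV _ _ sV sV])
    have "\<Union>D \<subseteq> \<Union>P" using \<open>D \<subseteq> P\<close> by (rule Union_mono)
    then show "V \<subseteq> {z. supp z \<subseteq> \<Union>P}" by (auto simp: V_def)
    have "V \<subseteq> res (\<Union>D) ` Z" unfolding V_def W_def using part_subset by (intro image_mono)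
    then show "V \<subseteq> fs.span (ZD \<union> S)" using S(3) by (rule order_trans)
  qed
  then obtain T where T: "finite T" "card T \<le> r" "T \<subseteq> V" "V = fs.span (ZD \<union> T)"
    using S(2) by (meson order_trans)
  \<comment> \<open>The same at most \<open>r\<close> generators are used twice: as elements of
    \<open>V\<close> they are added to the direct sum, and through their lifts to \<open>W\<close>
    they are the ones dropped from \<open>W\<close>.\<close>
  have "\<forall>t\<in>T. \<exists>w. w \<in> W \<and> res (\<Union>D) w = t" using T(3) by (auto simp: V_def)
  then obtain l where l: "\<And>t. t \<in> T \<Longrightarrow> l t \<in> W \<and> res (\<Union>D) (l t) = t" by metis
  define T' where "T' = l ` T"
  define U where "U = fs.span (W' \<union> ZD \<union> T')"
  have UW: "U \<subseteq> W" unfolding U_def using W'W ZDW l sW by (intro fs.span_minimal) (auto simp: T'_def)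
  \<comment> \<open>The kernel of the projection from \<open>W\<close> to the union of
    \<open>D\<close> is \<open>W'\<close>, so \<open>W'\<close> and any lifts of generators of the
    image \<open>V\<close> generate \<open>W\<close>.\<close>
  have WU: "W = U"
  proof
    show "W \<subseteq> U"
    proof
      fix z assume z: "z \<in> W"
      have sU: "fs.subspace (res (\<Union>D) ` U)" by (simp add: U_def subspace_res)
      have "ZD \<union> T \<subseteq> res (\<Union>D) ` U"
      proof
        fix w assume "w \<in> ZD \<union> T"
        then consider "w \<in> ZD" | "w \<in> T" by blast
        then show "w \<in> res (\<Union>D) ` U"
        proof cases
          case 1
          then have "res (\<Union>D) w = w" "w \<in> U"
            by (auto simp: ZD_def part_def res_eq_self U_def intro: fs.span_base)
          then show ?thesis by (metis imageI)
        next
          case 2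
          then have "l w \<in> U" by (auto simp: U_def T'_def intro: fs.span_base)
          then show ?thesis using l[OF 2] by (metis imageI)
        qed
      qed
      then have "V \<subseteq> res (\<Union>D) ` U" unfolding T(4) using sU by (rule fs.span_minimal)
      then obtain u where u: "u \<in> U" "res (\<Union>D) u = res (\<Union>D) z" using z by (auto simp: V_def)
      have "z - u \<in> W" using z u UW sW by (auto intro: fs.subspace_diff)
      then have "z - u \<in> W'" using u(2) by (intro W'I) (auto simp: res_diff)
      then have "z - u \<in> U" by (simp add: U_def fs.span_base)
      then have "(z - u) + u \<in> U" using u(1) unfolding U_def by (rule fs.span_add)
      then show "z \<in> U" by simp
    qed
  qed (rule UW)
  define Z0 where "Z0 = fs.span (Z0' \<union> ZD)"
  have Weq: "W = fs.span (Z0 \<union> (T1' \<union> T'))"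
  proof -
    have "W = fs.span (fs.span (Z0' \<union> T1') \<union> (ZD \<union> T'))"
      unfolding WU U_def IH(6) by (simp add: Un_assoc)
    also have "\<dots> = fs.span (Z0' \<union> ZD \<union> (T1' \<union> T'))"
      unfolding span_Un_span by (simp add: Un_ac)
    also have "\<dots> = fs.span (Z0 \<union> (T1' \<union> T'))" unfolding Z0_def span_Un_span ..
    finally show ?thesis .
  qed
  define Y where "Y = fs.span (Z0 \<union> (T1 \<union> T))"
  have Yeq: "Y = fs.span (Y' \<union> V)"
  proof -
    have "Y = fs.span ((Z0' \<union> T1) \<union> (ZD \<union> T))"
      unfolding Y_def Z0_def span_Un_span by (simp add: Un_ac)
    also have "\<dots> = fs.span (fs.span (ZD \<union> T) \<union> fs.span (Z0' \<union> T1))"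
      unfolding span_Un_span span_Un_span' by (rule arg_cong[OF Un_commute])
    finally show ?thesis unfolding IH(7) T(4) by (simp add: Un_commute)
  qed
  have sY: "fs.subspace Y" by (simp add: Y_def)
  have Y'Y: "Y' \<subseteq> Y" "V \<subseteq> Y" unfolding Yeq using fs.span_superset[of "Y' \<union> V"] by auto
  have I'I: "\<Union>I' \<subseteq> \<Union>I" by (auto simp: I'_def)
  have supY: "\<forall>y\<in>Y. supp y \<subseteq> \<Union>I"
  proof -
    have "Y' \<subseteq> {y. supp y \<subseteq> \<Union>I}" using IH(8) I'I by blast
    moreover have "V \<subseteq> {y. supp y \<subseteq> \<Union>I}" using Union_mono[OF DI] by (auto simp: V_def)
    ultimately have "Y \<subseteq> {y. supp y \<subseteq> \<Union>I}"
      unfolding Yeq by (intro fs.span_minimal subspace_supp) simp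
    then show ?thesis by blast
  qed
  have res0: "res A y = 0" if "A \<inter> B = {}" "supp y \<subseteq> B" for A B and y :: "'e \<Rightarrow> 'f"
  proof -
    have "supp (res A y) = {}" using that by auto
    then show ?thesis by (simp only: supp_empty_iff)
  qed
  have AD: "A \<inter> \<Union>D = {}" if "A \<in> I'" for A using dP that DI by (auto simp: I'_def)
  have AI': "A \<inter> \<Union>I' = {}" if "A \<in> D" for A using dP[of A] that DI by (auto simp: I'_def)
  have main: "(\<forall>y\<in>Y. res A y \<in> Y) \<and> part Z A \<subseteq> Y \<and> res A ` Y \<subseteq> res A ` W" if A: "A \<in> I" for A
  proof -
    have s1: "fs.subspace {y. res A y \<in> Y}" using sY by (rule subspace_res_vimage)
    have s2: "fs.subspace (res A ` W)" using sW by (rule subspace_res)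
    have s2': "fs.subspace {y. res A y \<in> res A ` W}" using s2 by (rule subspace_res_vimage)
    note z12 = fs.subspace_0[OF sY] fs.subspace_0[OF s2]
    \<comment> \<open>The conditions on \<open>Y\<close> are linear, so they are checked on
      \<open>Y'\<close> and \<open>V\<close>. Members of \<open>V\<close> vanish on parts outside
      \<open>D\<close>, and members of \<open>Y'\<close> vanish on parts in
      \<open>D\<close>.\<close>
    have gens: "(\<forall>y\<in>Y'. res A y \<in> Y \<and> res A y \<in> res A ` W) \<and> (\<forall>y\<in>V. res A y \<in> Y \<and> res A y \<in> res A ` W)
       \<and> part Z A \<subseteq> Y"
    proof (cases "A \<in> D")
      case True
      have "res A y = 0" if "y \<in> Y'" for y using res0[OF AI'[OF True] IH(8)[OF that]] .
      moreover have "res A y \<in> V \<and> res A y \<in> res A ` W" if y: "y \<in> V" for y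
      proof -
        obtain z where z: "z \<in> W" "y = res (\<Union>D) z" using y by (auto simp: V_def)
        have "A \<inter> \<Union>D = A" using True by blast
        then have "res A y = res A z" using z(2) by simp
        moreover have "res A z \<in> V" using D z(1) True unfolding split_def V_def by (metis imageI)
        ultimately show ?thesis using z(1) by simp
      qed
      moreover have "part Z A \<subseteq> Y"
      proof -
        have "part Z A \<subseteq> ZD" unfolding ZD_def using True by (intro part_mono) auto
        then show ?thesis using ZDV Y'Y by blast
      qed
      ultimately show ?thesis using z12 Y'Y by auto
    next
      case False
      then have A': "A \<in> I'" using A by (simp add: I'_def)
      have "res A y = 0" if "y \<in> V" for y
        by (rule res0[OF AD[OF A']]) (use that in \<open>auto simp: V_def\<close>)
      moreover have "res A y \<in> Y' \<and> res A y \<in> res A ` W" if "y \<in> Y'" for y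
        using IH(9)[OF A' that] IH(11)[OF A'] that W'W by blast
      ultimately show ?thesis using z12 Y'Y IH(10)[OF A'] by auto
    qed
    have "Y' \<union> V \<subseteq> {y. res A y \<in> Y}" "Y' \<union> V \<subseteq> {y. res A y \<in> res A ` W}"
      using gens by auto
    then have "Y \<subseteq> {y. res A y \<in> Y}" "Y \<subseteq> {y. res A y \<in> res A ` W}"
      using fs.span_minimal[OF _ s1, of "Y' \<union> V"] fs.span_minimal[OF _ s2', of "Y' \<union> V"]
      unfolding Yeq[symmetric] by auto
    then show ?thesis using gens by blast
  qed
  have "card (T1 \<union> T) \<le> Suc m * r" using card_Un_le[of T1 T] IH(3) T(2) by simp
  moreover have "card (T1' \<union> T') \<le> Suc m * r"
    using card_Un_le[of T1' T'] IH(4) T(2) card_image_le[OF T(1), of l] by (simp add: T'_def)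
  moreover have "finite (T1 \<union> T)" "finite (T1' \<union> T')" using IH T by (auto simp: T'_def)
  moreover have "fs.subspace Z0" by (simp add: Z0_def)
  ultimately have "direct_perturbation Z I (Suc m * r) Y Z0 (T1 \<union> T) (T1' \<union> T')"
    unfolding direct_perturbation_def W_def[symmetric] using Weq Y_def supY ballI[OF main] by (intro conjI)
  then show ?case by meson
qed

lemma span_insert_span: "fs.span (Z \<union> insert t T) = fs.span (insert t (fs.span (Z \<union> T)))"
  using span_Un_span'[of "{t}" "Z \<union> T"] by simp

lemma config_span_Un:
  assumes "config X Z" "\<forall>t\<in>T. supp t \<subseteq> X"
  shows "config X (fs.span (Z \<union> T))"
proof -
  have "fs.span (Z \<union> T) \<subseteq> {z. supp z \<subseteq> X}"
    using assms by (intro fs.span_minimal subspace_supp) (auto simp: config_def)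
  then show ?thesis using assms by (auto simp: config_def)
qed

lemma expandable_extend:
  fixes Z :: "('e \<Rightarrow> 'f::field) set"
  assumes "infinite (UNIV :: 'e set)" "X \<noteq> {}" "1 \<le> k" "config X Z" "expandable X Z k" "finite T"
  shows "\<forall>t\<in>T. supp t \<subseteq> X \<Longrightarrow> expandable X (fs.span (Z \<union> T)) (k + card T)"
  using \<open>finite T\<close>
proof (induction T rule: finite_induct)
  case empty
  have "fs.span Z = Z" using assms(4) by (simp add: config_def)
  then show ?case using assms(5) by (simp del: fscale_apply fs.span_eq_iff)
next
  case (insert t T)
  have "config X (fs.span (Z \<union> T))" using insert.prems by (intro config_span_Un[OF assms(4)]) simp
  moreover have "expandable X (fs.span (Z \<union> T)) (k + card T)"
    using insert.prems by (intro insert.IH) simp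
  ultimately have "expandable X (fs.span (insert t (fs.span (Z \<union> T)))) (k + card T + 1)"
    using insert.prems assms(3) by (intro expandable_extend_relation[OF assms(1,2)]) auto
  then show ?case using insert.hyps by (simp add: span_insert_span[symmetric] del: fscale_apply)
qed

lemma expandable_restrict:
  fixes Z :: "('e \<Rightarrow> 'f::field) set"
  assumes "infinite (UNIV :: 'e set)" "X \<noteq> {}" "config X Z" "finite T"
  shows "1 \<le> k \<Longrightarrow> \<forall>t\<in>T. supp t \<subseteq> X \<Longrightarrow> expandable X (fs.span (Z \<union> T)) k \<Longrightarrow> expandable X Z (k + card T)"
  using \<open>finite T\<close>
proof (induction T arbitrary: k rule: finite_induct)
  case empty
  have "fs.span Z = Z" using assms(3) by (simp add: config_def)
  then show ?case using empty by (simp del: fscale_apply fs.span_eq_iff)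
next
  case (insert t T)
  have "config X (fs.span (Z \<union> T))" using insert.prems by (intro config_span_Un[OF assms(3)]) simp
  moreover have "expandable X (fs.span (insert t (fs.span (Z \<union> T)))) k"
    using insert.prems(3) unfolding span_insert_span .
  ultimately have "expandable X (fs.span (Z \<union> T)) (k + 1)"
    using insert.prems(1) by (intro expandable_restrict_relation[OF assms(1,2)])
  then have "expandable X Z (k + 1 + card T)" using insert.prems by (intro insert.IH) (simp_all del: fscale_apply)
  then show ?case using insert.hyps by simp
qed

text \<open>The boundary of one part is itself a cut, so the perturbation starts with
  \<open>m = r\<close> and needs at most \<open>r * r\<close> generators on either side. The
  assumption on the children covers every space between restriction and contraction, because the
  perturbed summand is not known in advance.\<close>

lemma expandable_node:
  fixes Z :: "('e \<Rightarrow> 'f::field) set"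
  assumes inf: "infinite (UNIV :: 'e set)" and P: "finite P" "disjoint P" "P \<noteq> {}" "{} \<notin> P"
    and c: "config (\<Union>P) Z" and cut: "\<And>Q. Q \<subseteq> P \<Longrightarrow> cut Z r (\<Union>Q)" and k: "1 \<le> k"
    and child: "\<And>A Y. A \<in> P \<Longrightarrow> config A Y \<Longrightarrow> part Z A \<subseteq> Y \<Longrightarrow> Y \<subseteq> res A ` Z \<Longrightarrow> expandable A Y k"
  shows "expandable (\<Union>P) Z (k + 2 * r * r)"
proof -
  define X where "X = \<Union>P"
  have ne: "X \<noteq> {}" using P(3,4) by (auto simp: X_def)
  have Z: "part Z X = Z" using part_self[OF c] by (simp add: X_def)
  have "\<exists>S. finite S \<and> card S \<le> r \<and> res A ` part Z (\<Union>P) \<subseteq> fs.span (part Z A \<union> S)" if "A \<in> P" for A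
    using cut[of "{A}"] that Z by (simp add: cut_def X_def)
  then obtain Y Z0 T T' where "direct_perturbation Z P (r * r) Y Z0 T T'"
    using direct_perturbation_exists[OF P(1,2) c cut order_refl] by meson
  then have d: "finite T" "finite T'" "card T \<le> r * r" "card T' \<le> r * r" "fs.subspace Z0"
      "Z = fs.span (Z0 \<union> T')" "Y = fs.span (Z0 \<union> T)" "\<And>y. y \<in> Y \<Longrightarrow> supp y \<subseteq> X"
      "\<And>A y. A \<in> P \<Longrightarrow> y \<in> Y \<Longrightarrow> res A y \<in> Y" "\<And>A. A \<in> P \<Longrightarrow> part Z A \<subseteq> Y"
      "\<And>A. A \<in> P \<Longrightarrow> res A ` Y \<subseteq> res A ` Z"
    unfolding direct_perturbation_def X_def[symmetric] Z by meson+
  have cY: "config X Y" unfolding config_def using c d(7,8) by (auto simp: config_def X_def)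
  have "expandable A (res A ` Y) k" if A: "A \<in> P" for A
  proof (rule child[OF A])
    show "config A (res A ` Y)" using A by (intro config_res[OF cY]) (auto simp: X_def)
    show "part Z A \<subseteq> res A ` Y"
    proof
      fix z assume z: "z \<in> part Z A"
      then have "res A z = z" by (simp add: part_def res_eq_self)
      moreover have "z \<in> Y" using d(10)[OF A] z by blast
      ultimately show "z \<in> res A ` Y" by (metis imageI)
    qed
    show "res A ` Y \<subseteq> res A ` Z" by (rule d(11)[OF A])
  qed
  then have "expandable X Y k"
    unfolding X_def using cY d(9) by (intro expandable_direct_sum[OF P k]) (simp_all add: X_def)
  then have eY: "expandable X (fs.span (Z0 \<union> T)) k" by (simp add: d(7))
  have sub: "Z0 \<union> T' \<subseteq> Z" "Z0 \<union> T \<subseteq> Y"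
    unfolding d(6,7) by (rule fs.span_superset)+
  have supZ: "supp z \<subseteq> X" if "z \<in> Z" for z using c that by (simp add: config_def X_def)
  have cZ0: "config X Z0" using c d(5) sub(1) supZ by (auto simp: config_def X_def)
  have "\<forall>t\<in>T. supp t \<subseteq> X" "\<forall>t\<in>T'. supp t \<subseteq> X" using sub supZ d(8) by blast+
  \<comment> \<open>From the direct sum one first passes down to the common subspace
    \<open>Z0\<close>, dropping \<open>T\<close>, and then up to \<open>Z\<close>, adding
    \<open>T'\<close>. Each generator costs one new element.\<close>
  then have "expandable X (fs.span (Z0 \<union> T')) (k + card T + card T')"
    using expandable_restrict[OF inf ne cZ0 d(1) k _ eY] k
    by (intro expandable_extend[OF inf ne _ cZ0 _ d(2)]) auto
  then have "expandable X Z (k + card T + card T')" by (simp add: d(6)[symmetric])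
  moreover have "k + card T + card T' \<le> k + 2 * r * r" using d(3,4) by simp
  ultimately show ?thesis unfolding X_def by (rule expandable_mono)
qed

text \<open>A rooted decomposition tree reduced to its nested partitions, with \<open>f\<close> the
  condition on unions of parts at every node. A leaf is allowed at any height, so branches of
  different lengths fit under one node.\<close>

inductive hierarchy :: "('e set \<Rightarrow> bool) \<Rightarrow> nat \<Rightarrow> 'e set \<Rightarrow> bool" for f where
  leaf: "hierarchy f h {x}"
| node: "finite P \<Longrightarrow> P \<noteq> {} \<Longrightarrow> disjoint P \<Longrightarrow> (\<And>A. A \<in> P \<Longrightarrow> hierarchy f h A)
    \<Longrightarrow> (\<And>Q. Q \<subseteq> P \<Longrightarrow> f (\<Union>Q)) \<Longrightarrow> hierarchy f (Suc h) (\<Union>P)"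

lemma hierarchy_nonempty: "hierarchy f h X \<Longrightarrow> X \<noteq> {}"
  by (induction rule: hierarchy.induct) auto

text \<open>\<open>Z\<close> varies in the induction because a child continues with its perturbed
  summand. Each level adds \<open>2 * r * r\<close>, and the final 1 is the depth of a single
  element.\<close>

lemma hierarchy_expandable:
  fixes Z :: "('e \<Rightarrow> 'f::field) set"
  assumes inf: "infinite (UNIV :: 'e set)"
  shows "hierarchy f h X \<Longrightarrow> config X Z \<Longrightarrow> (\<And>A. A \<subseteq> X \<Longrightarrow> f A \<Longrightarrow> cut Z r A)
    \<Longrightarrow> expandable X Z (2 * r * r * h + 1)"
proof (induction arbitrary: Z rule: hierarchy.induct)
  case (leaf h x)
  have "res {x} z = z" if "z \<in> Z" for z
    using leaf(1) that by (intro res_eq_self) (simp add: config_def)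
  then have "res {x} ` part Z (- {}) = Z" by (auto simp: part_def)
  moreover have "cdd_le (mat {x} Z) (2 * r * r * h + 1)" by (rule cdd_le_single) simp_all
  ultimately have "expansion F {x} Z (2 * r * r * h + 1) {} {} Z" for F
    using leaf(1) by (simp add: expansion_def)
  then show ?case unfolding expandable_def by meson
next
  case (node P h)
  have sub: "A' \<subseteq> \<Union>P" if "A' \<subseteq> A" "A \<in> P" for A A' using that by blast
  have "expandable (\<Union>P) Z (2 * r * r * h + 1 + 2 * r * r)"
  proof (rule expandable_node[OF inf])
    show "{} \<notin> P" using node.hyps(4) hierarchy_nonempty by blast
    show "cut Z r (\<Union>Q)" if "Q \<subseteq> P" for Q
      using node.hyps(5)[OF that] Union_mono[OF that] by (intro node.prems(2))
    fix A Y assume A: "A \<in> P" and Y: "config A Y" "part Z A \<subseteq> Y" "Y \<subseteq> res A ` Z"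
    show "expandable A Y (2 * r * r * h + 1)"
    proof (rule node.IH[OF A Y(1)])
      fix A' assume A': "A' \<subseteq> A" "f A'"
      have "cut Z r A'" using A' sub[OF A'(1) A] by (intro node.prems(2))
      moreover have "res A' ` Y \<subseteq> res A' ` Z"
      proof
        fix w assume "w \<in> res A' ` Y"
        then obtain y where "y \<in> Y" "w = res A' y" by blast
        moreover from this obtain z where "z \<in> Z" "y = res A z" using Y(3) by blast
        moreover have "A' \<inter> A = A'" using A'(1) by blast
        ultimately show "w \<in> res A' ` Z" by simp
      qed
      moreover have "part Z A' \<subseteq> part Y A'" using Y(2) A'(1) by (auto simp: part_def)
      ultimately show "cut Y r A'" by (rule cut_mono)
    qed
  qed (use node in simp_all)
  then show ?case by (simp add: algebra_simps)
qed

section \<open>Trees and hierarchies\<close>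

lemma within_iff_rtranclp: "(\<exists>n. within G n u v) \<longleftrightarrow> G\<^sup>*\<^sup>* u v"
proof
  have "within G n u v \<Longrightarrow> G\<^sup>*\<^sup>* u v" for n
    by (induction n arbitrary: u) (auto intro: converse_rtranclp_into_rtranclp)
  then show "\<exists>n. within G n u v \<Longrightarrow> G\<^sup>*\<^sup>* u v" by blast
next
  assume "G\<^sup>*\<^sup>* u v"
  then show "\<exists>n. within G n u v"
  proof (induction rule: converse_rtranclp_induct)
    case base
    then show ?case using within.simps(1) by metis
  next
    case (step y z)
    then show ?case using within.simps(2) by metis
  qed
qed

lemma within_mono: "within G n u v \<Longrightarrow> n \<le> m \<Longrightarrow> within G m u v"
  by (induction m) (auto simp: le_Suc_eq)

lemma within_snoc: "within G n u v \<Longrightarrow> G v w \<Longrightarrow> within G (Suc n) u w"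
proof (induction n arbitrary: u)
  case 0
  then show ?case by auto
next
  case (Suc n)
  then show ?case using within.simps(2)[of G "Suc n" u w] within.simps(2)[of G n u v] by blast
qed

lemma within_sym:
  assumes "\<And>a b. G a b \<Longrightarrow> G b a"
  shows "within G n u v \<Longrightarrow> within G n v u"
proof (induction n arbitrary: u)
  case 0
  then show ?case by simp
next
  case (Suc n)
  then show ?case using assms within_snoc[of G n v _ u] within_mono[of G n v u "Suc n"]
    by (metis le_add2 plus_1_eq_Suc within.simps(2))
qed

lemma rtranclp_sym:
  assumes "\<And>a b. R a b \<Longrightarrow> R b a"
  shows "R\<^sup>*\<^sup>* u v \<Longrightarrow> R\<^sup>*\<^sup>* v u"
  by (induction rule: rtranclp_induct) (auto intro: converse_rtranclp_into_rtranclp assms)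

text \<open>Requiring every edge to join a vertex to its parent, with depth growing by one, replaces
  all reasoning about the absence of cycles.\<close>

locale rooted_tree =
  fixes V :: "'v set" and G :: "'v \<Rightarrow> 'v \<Rightarrow> bool" and c :: 'v and p :: "'v \<Rightarrow> 'v" and depth :: "'v \<Rightarrow> nat"
  assumes finV: "finite V" and root: "c \<in> V" and depth_root: "depth c = 0"
    and parent: "\<And>v. v \<in> V \<Longrightarrow> v \<noteq> c \<Longrightarrow> p v \<in> V \<and> depth v = Suc (depth (p v))"
    and edge: "\<And>u v. G u v \<longleftrightarrow> (u \<in> V \<and> u \<noteq> c \<and> v = p u) \<or> (v \<in> V \<and> v \<noteq> c \<and> u = p v)"

text \<open>\<open>is_tree\<close> excludes cycles only by counting edges. Each vertex other than
  the root has an edge to a neighbour nearer to the root; these edges are distinct and already as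
  many as the tree has, so there are no others.\<close>

lemma rooted_tree_of_is_tree:
  assumes t: "is_tree V G" and c: "c \<in> V" and d: "\<And>v. v \<in> V \<Longrightarrow> within G d c v"
  shows "\<exists>p depth. rooted_tree V G c p depth \<and> (\<forall>v\<in>V. depth v \<le> d)"
proof -
  have fin: "finite V" and G: "\<And>u v. G u v \<Longrightarrow> u \<in> V \<and> v \<in> V \<and> u \<noteq> v \<and> G v u"
    and cd: "card {{u, v} | u v. G u v} + 1 = card V"
    using t by (auto simp: is_tree_def)
  define depth where "depth v = (LEAST n. within G n v c)" for v
  have wi: "within G (depth v) v c" "depth v \<le> d" if "v \<in> V" for v
  proof -
    have "within G d v c" using within_sym[of G d c v] G d[OF that] by blast
    then show "within G (depth v) v c" "depth v \<le> d"
      unfolding depth_def by (auto intro: LeastI Least_le)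
  qed
  have "\<exists>w. G v w \<and> depth v = Suc (depth w)" if v: "v \<in> V" "v \<noteq> c" for v
  proof -
    have w: "within G (depth v) v c" using wi v by blast
    then obtain n where n: "depth v = Suc n" using v(2) by (cases "depth v") auto
    have "\<not> within G n v c"
    proof
      assume "within G n v c"
      then have "depth v \<le> n" unfolding depth_def by (rule Least_le)
      then show False using n by simp
    qed
    then obtain x where x: "G v x" "within G n x c" using w n by auto
    have "depth x \<le> n" unfolding depth_def using x(2) by (rule Least_le)
    moreover have "within G (Suc (depth x)) v c" using x(1) G wi(1)[of x] by auto
    then have "depth v \<le> Suc (depth x)" unfolding depth_def[of v] by (rule Least_le)
    ultimately show ?thesis using x(1) n by (intro exI[of _ x]) auto
  qed
  then obtain p where p: "\<And>v. v \<in> V \<Longrightarrow> v \<noteq> c \<Longrightarrow> G v (p v) \<and> depth v = Suc (depth (p v))" by metis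
  define E where "E = {{u, v} | u v. G u v}"
  have "E \<subseteq> Pow V" using G by (auto simp: E_def)
  then have finE: "finite E" using fin by (meson finite_Pow_iff finite_subset)
  define e where "e v = {v, p v}" for v
  have inj: "inj_on e (V - {c})"
  proof (rule inj_onI)
    fix v w assume vw: "v \<in> V - {c}" "w \<in> V - {c}" "e v = e w"
    show "v = w"
    proof (rule ccontr)
      assume "v \<noteq> w"
      then have "v = p w" "w = p v" using vw(3) by (auto simp: e_def doubleton_eq_iff)
      then have "depth v = Suc (depth w)" "depth w = Suc (depth v)" using p vw by (metis DiffD1 DiffD2 insertI1)+
      then show False by simp
    qed
  qed
  have "e ` (V - {c}) \<subseteq> E" using p by (auto simp: e_def E_def)
  moreover have "card (e ` (V - {c})) = card E"
    using card_image[OF inj] cd c fin by (simp add: E_def)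
  ultimately have eE: "e ` (V - {c}) = E" using finE by (intro card_subset_eq)
  have "G u v \<longleftrightarrow> (u \<in> V \<and> u \<noteq> c \<and> v = p u) \<or> (v \<in> V \<and> v \<noteq> c \<and> u = p v)" for u v
  proof
    assume "G u v"
    then have "{u, v} \<in> e ` (V - {c})" unfolding eE by (auto simp: E_def)
    then obtain w where "w \<in> V" "w \<noteq> c" "{u, v} = {w, p w}" by (auto simp: e_def)
    then show "(u \<in> V \<and> u \<noteq> c \<and> v = p u) \<or> (v \<in> V \<and> v \<noteq> c \<and> u = p v)"
      by (auto simp: doubleton_eq_iff)
  next
    assume "(u \<in> V \<and> u \<noteq> c \<and> v = p u) \<or> (v \<in> V \<and> v \<noteq> c \<and> u = p v)"
    then show "G u v" using p G by blast
  qed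
  moreover have "depth c = 0"
  proof -
    have "within G 0 c c" by simp
    then have "depth c \<le> 0" unfolding depth_def by (rule Least_le)
    then show ?thesis by simp
  qed
  ultimately have "rooted_tree V G c p depth"
    using fin c p G by unfold_locales blast+
  then show ?thesis using wi(2) by blast
qed

context rooted_tree
begin

inductive_set desc :: "'v \<Rightarrow> 'v set" for v where
  self: "v \<in> V \<Longrightarrow> v \<in> desc v"
| step: "w \<in> V \<Longrightarrow> w \<noteq> c \<Longrightarrow> p w \<in> desc v \<Longrightarrow> w \<in> desc v"

definition children :: "'v \<Rightarrow> 'v set" where
  "children v = {u \<in> V. u \<noteq> c \<and> p u = v}"

lemma desc_V: "w \<in> desc v \<Longrightarrow> w \<in> V"
  by (induction rule: desc.induct)

lemma desc_depth: "w \<in> desc v \<Longrightarrow> w = v \<or> depth v < depth w"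
proof (induction rule: desc.induct)
  case (step w)
  then show ?case using parent[of w] by auto
qed simp

lemma desc_parent: "w \<in> desc v \<Longrightarrow> w \<noteq> v \<Longrightarrow> w \<noteq> c \<and> p w \<in> desc v"
  by (cases rule: desc.cases) auto

lemma desc_trans: "w \<in> desc u \<Longrightarrow> u \<in> desc v \<Longrightarrow> w \<in> desc v"
  by (induction rule: desc.induct) (auto intro: desc.step)

lemma desc_root: "v \<in> V \<Longrightarrow> v \<in> desc c"
proof (induction "depth v" arbitrary: v)
  case 0
  then show ?case using parent[of v] root by (cases "v = c") (auto intro: desc.self)
next
  case (Suc n)
  show ?case
  proof (cases "v = c")
    case False
    then show ?thesis using parent[of v] Suc by (auto intro: desc.step)
  qed (use root in \<open>auto intro: desc.self\<close>)
qed

lemma child_desc: "u \<in> children v \<Longrightarrow> v \<in> V \<Longrightarrow> u \<in> desc v"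
  by (auto simp: children_def intro: desc.step desc.self)

lemma child_depth: "u \<in> children v \<Longrightarrow> depth u = Suc (depth v)"
  using parent by (auto simp: children_def)

lemma not_desc_child: "u \<in> children v \<Longrightarrow> v \<notin> desc u"
  using desc_depth[of v u] child_depth[of u v] by fastforce

lemma desc_children: "v \<in> V \<Longrightarrow> desc v = insert v (\<Union>u\<in>children v. desc u)"
proof
  assume v: "v \<in> V"
  show "desc v \<subseteq> insert v (\<Union>u\<in>children v. desc u)"
  proof
    fix w assume "w \<in> desc v"
    then show "w \<in> insert v (\<Union>u\<in>children v. desc u)"
    proof (induction rule: desc.induct)
      case (step w)
      show ?case
      proof (cases "p w = v")
        case True
        then have "w \<in> children v" "w \<in> desc w" using step by (auto simp: children_def intro: desc.self)
        then show ?thesis by blast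
      next
        case False
        then show ?thesis using step by (auto intro: desc.step)
      qed
    qed simp
  qed
  show "insert v (\<Union>u\<in>children v. desc u) \<subseteq> desc v"
    using v child_desc desc_trans desc.self by blast
qed

text \<open>Both \<open>u\<close> and \<open>u'\<close> lie on the path from \<open>w\<close> to the
  root, which has only one vertex of each depth.\<close>

lemma desc_disjoint: "w \<in> desc u \<Longrightarrow> w \<in> desc u' \<Longrightarrow> depth u = depth u' \<Longrightarrow> u = u'"
proof (induction rule: desc.induct)
  case self
  then show ?case using desc_depth[of u u'] by auto
next
  case (step w)
  show ?case
  proof (cases "w = u'")
    case True
    have "w \<in> desc u" using step by (auto intro: desc.step)
    then show ?thesis using True desc_depth[of u' u] step.prems by auto
  next
    case False
    then show ?thesis using step desc_parent[of w u'] by blast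
  qed
qed

lemma comp_minus_iff: "w \<in> comp_minus G v u \<longleftrightarrow> (\<lambda>a b. G a b \<and> a \<noteq> v \<and> b \<noteq> v)\<^sup>*\<^sup>* u w"
  unfolding comp_minus_def mem_Collect_eq within_iff_rtranclp ..

text \<open>The only edge leaving the subtree of \<open>u\<close> leads to \<open>v\<close>, which
  is removed.\<close>

lemma comp_minus_child:
  assumes u: "u \<in> children v"
  shows "comp_minus G v u = desc u"
proof (intro set_eqI iffI)
  have uV: "u \<in> V" using u by (simp add: children_def)
  fix w assume "w \<in> comp_minus G v u"
  then show "w \<in> desc u"
    unfolding comp_minus_iff
  proof (induction rule: rtranclp_induct)
    case base
    then show ?case using uV by (rule desc.self)
  next
    case (step a b)
    from step(2) consider "a \<noteq> c" "b = p a" | "b \<in> V" "b \<noteq> c" "a = p b" using edge by blast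
    then show ?case
    proof cases
      case 1
      then have "a \<noteq> u" using u step(2) by (auto simp: children_def)
      then show ?thesis using desc_parent[OF step(3)] 1 by simp
    next
      case 2
      then show ?thesis using step(3) by (auto intro: desc.step)
    qed
  qed
next
  fix w assume "w \<in> desc u"
  then show "w \<in> comp_minus G v u"
    unfolding comp_minus_iff
  proof (induction rule: desc.induct)
    case (step w)
    have "w \<in> desc u" using step by (auto intro: desc.step)
    then have "w \<noteq> v" "p w \<noteq> v" using not_desc_child[OF u] step(3) by auto
    moreover have "G (p w) w" using step edge by blast
    ultimately show ?case using step.IH by (auto intro: rtranclp.rtrancl_into_rtrancl)
  qed simp
qed

text \<open>Outside the subtree of \<open>v\<close> one can climb to the root without meeting
  \<open>v\<close>, so all these vertices are connected to \<open>p v\<close>.\<close>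

lemma comp_minus_parent:
  assumes v: "v \<in> V" "v \<noteq> c"
  shows "comp_minus G v (p v) = V - desc v"
proof (intro set_eqI iffI)
  let ?R = "\<lambda>a b. G a b \<and> a \<noteq> v \<and> b \<noteq> v"
  have pv: "p v \<in> V - desc v"
    using parent[OF v] desc_depth[of "p v" v] by fastforce
  have up: "?R\<^sup>*\<^sup>* w c" if "w \<in> V - desc v" for w
    using that
  proof (induction "depth w" arbitrary: w rule: less_induct)
    case less
    show ?case
    proof (cases "w = c")
      case False
      have "p w \<in> V - desc v" using less.prems False parent[of w] by (auto intro: desc.step)
      moreover have "w \<noteq> v" "p w \<noteq> v" using less.prems calculation desc.self[OF v(1)] by auto
      moreover have "G w (p w)" using False less.prems edge by blast
      moreover have "depth (p w) < depth w" using parent[of w] less.prems False by auto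
      ultimately show ?thesis using less.hyps[of "p w"] by (auto intro: converse_rtranclp_into_rtranclp)
    qed simp
  qed
  have sym: "?R a b \<Longrightarrow> ?R b a" for a b using edge by blast
  fix w
  {
    assume "w \<in> comp_minus G v (p v)"
    then show "w \<in> V - desc v"
      unfolding comp_minus_iff
    proof (induction rule: rtranclp_induct)
      case base
      then show ?case by (rule pv)
    next
      case (step a b)
      from step(2) consider "a \<noteq> c" "b = p a" | "b \<in> V" "b \<noteq> c" "a = p b" using edge by blast
      then show ?case
      proof cases
        case 1
        then have "b \<notin> desc v" using step(3) by (auto intro: desc.step)
        then show ?thesis using 1 step(3) parent[of a] by blast
      next
        case 2
        then have "b \<notin> desc v" using desc_parent[of b v] step by blast
        then show ?thesis using 2 by blast
      qed
    qed
  next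
    assume "w \<in> V - desc v"
    then have "?R\<^sup>*\<^sup>* w c" by (rule up)
    then have "?R\<^sup>*\<^sup>* c w" using rtranclp_sym[of ?R, OF sym] by blast
    then show "w \<in> comp_minus G v (p v)"
      unfolding comp_minus_iff using up[OF pv] by (meson rtranclp_trans)
  }
qed

lemma neighbours_eq:
  "v \<in> V \<Longrightarrow> neighbours G v = (if v = c then children v else insert (p v) (children v))"
  using edge by (auto simp: neighbours_def children_def)

lemma finite_children: "finite (children v)"
  using finV by (simp add: children_def)

lemma parent_not_child: "v \<in> V \<Longrightarrow> v \<noteq> c \<Longrightarrow> p v \<notin> children v"
  using parent[of v] child_depth[of "p v" v] by auto

lemma leaf_iff: "v \<in> V \<Longrightarrow> v \<noteq> c \<Longrightarrow> v \<in> leaves V G \<longleftrightarrow> children v = {}"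
  using finite_children[of v] parent_not_child[of v] by (simp add: leaves_def neighbours_eq)

lemma children_subset: "children v \<subseteq> V"
  by (auto simp: children_def)

lemma disjoint_children: "u \<in> children v \<Longrightarrow> u' \<in> children v \<Longrightarrow> u \<noteq> u' \<Longrightarrow> desc u \<inter> desc u' = {}"
  using desc_disjoint[of _ u u'] child_depth[of _ v] by auto

text \<open>Treats root and other vertices alike: the components not chosen, including that of the
  parent, make up the full complement, so \<open>lambda_star\<close> at \<open>v\<close> bounds
  connectivities of sets with their complements.\<close>

lemma comp_minus_union:
  assumes v: "v \<in> V" and I: "I \<subseteq> children v"
  shows "(\<Union>u\<in>neighbours G v - I. comp_minus G v u) = V - {v} - (\<Union>u\<in>I. desc u)"
proof -
  have "desc v = V" if "v = c" using that desc_root desc_V by blast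
  then have 1: "(\<Union>u\<in>neighbours G v - I. comp_minus G v u) = (V - desc v) \<union> (\<Union>u\<in>children v - I. desc u)"
  proof (cases "v = c")
    case True
    have "(\<Union>u\<in>children v - I. comp_minus G v u) = (\<Union>u\<in>children v - I. desc u)"
      using comp_minus_child by auto
    then show ?thesis using True v \<open>v = c \<Longrightarrow> desc v = V\<close> by (simp add: neighbours_eq)
  next
    case False
    have "neighbours G v - I = insert (p v) (children v - I)"
      using False v I parent_not_child[of v] by (auto simp: neighbours_eq)
    moreover have "(\<Union>u\<in>children v - I. comp_minus G v u) = (\<Union>u\<in>children v - I. desc u)"
      using comp_minus_child by auto
    ultimately show ?thesis using comp_minus_parent[OF v False] by simp
  qed
  have 2: "(\<Union>u\<in>children v - I. desc u) \<inter> (\<Union>u\<in>I. desc u) = {}"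
    using disjoint_children I by blast
  have 3: "v \<notin> (\<Union>u\<in>children v. desc u)" using not_desc_child by blast
  have 4: "desc v \<subseteq> V" using desc_V by blast
  have 5: "(\<Union>u\<in>children v. desc u) = (\<Union>u\<in>children v - I. desc u) \<union> (\<Union>u\<in>I. desc u)"
    using I by blast
  define A where "A = (\<Union>u\<in>children v - I. desc u)"
  define B where "B = (\<Union>u\<in>I. desc u)"
  have "desc v = insert v (A \<union> B)" using desc_children[OF v] 5 by (simp only: A_def B_def)
  moreover have "A \<inter> B = {}" "v \<notin> A \<union> B"
    using 2 3 5 unfolding A_def B_def by simp_all
  ultimately have "(V - desc v) \<union> A = V - {v} - B" using 4 by blast
  then show ?thesis unfolding 1 A_def B_def .
qed

text \<open>A union of leaf sets below some children of \<open>v\<close> is one side of a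
  bipartition considered by \<open>lambda_star\<close> at \<open>v\<close>, and the other side is
  its complement in \<open>E\<close>.\<close>

lemma hierarchy_inner:
  assumes bij: "bij_betw f (leaves V G) E"
    and l: "lambda_star M (neighbours G v) (\<lambda>u. f ` (leaves V G \<inter> comp_minus G v u)) \<le> int r"
    and v: "v \<in> V" "v \<notin> leaves V G"
    and ch: "\<And>u. u \<in> children v \<Longrightarrow> hierarchy F h (f ` (leaves V G \<inter> desc u))"
    and F: "\<And>A. A \<subseteq> E \<Longrightarrow> conn_lambda M A (E - A) \<le> int r \<Longrightarrow> F A"
  shows "hierarchy F (Suc h) (f ` (leaves V G \<inter> desc v))"
proof -
  let ?L = "leaves V G"
  define X where "X u = f ` (?L \<inter> desc u)" for u
  have inj: "inj_on f ?L" and img: "f ` ?L = E" using bij by (auto simp: bij_betw_def)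
  have ne: "children v \<noteq> {}"
  proof
    assume "children v = {}"
    then have "card (neighbours G v) \<le> 1" using v by (cases "v = c") (simp_all add: neighbours_eq)
    then show False using v by (simp add: leaves_def)
  qed
  have Xv: "f ` (?L \<inter> desc v) = \<Union>(X ` children v)"
    using v desc_children[OF v(1)] by (auto simp: X_def)
  show ?thesis
    unfolding Xv
  proof (rule hierarchy.node)
    show "finite (X ` children v)" "X ` children v \<noteq> {}" using finite_children ne by auto
    show "disjoint (X ` children v)"
    proof (rule disjointI)
      fix A B assume "A \<in> X ` children v" "B \<in> X ` children v" "A \<noteq> B"
      then obtain a b where ab: "a \<in> children v" "b \<in> children v" "A = X a" "B = X b" "a \<noteq> b" by blast
      then have "(?L \<inter> desc a) \<inter> (?L \<inter> desc b) = {}" using disjoint_children by blast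
      then show "A \<inter> B = {}"
        unfolding ab(3,4) X_def using inj_on_image_Int[OF inj, of "?L \<inter> desc a" "?L \<inter> desc b"] by simp
    qed
    show "hierarchy F h A" if "A \<in> X ` children v" for A
      using that ch by (auto simp: X_def)
    fix Q assume "Q \<subseteq> X ` children v"
    then obtain I where I: "I \<subseteq> children v" "Q = X ` I" by (auto simp: subset_image_iff)
    let ?N = "neighbours G v" and ?C = "\<lambda>u. f ` (?L \<inter> comp_minus G v u)"
    have IN: "I \<subseteq> ?N" using I v by (auto simp: neighbours_eq)
    have finN: "finite ?N" using finite_children v by (simp add: neighbours_eq)
    have "conn_lambda M (\<Union>i\<in>I. ?C i) (\<Union>i\<in>?N - I. ?C i) \<le> lambda_star M ?N ?C"
      unfolding lambda_star_def using finN IN by (intro Max_ge) auto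
    moreover have "(\<Union>i\<in>I. ?C i) = \<Union>Q"
    proof -
      have "?C i = X i" if "i \<in> I" for i
        using comp_minus_child[of i v] I(1) that by (auto simp: X_def)
      then show ?thesis by (simp add: I(2))
    qed
    moreover have "(\<Union>i\<in>?N - I. ?C i) = E - \<Union>Q"
    proof -
      have "(\<Union>i\<in>?N - I. ?C i) = f ` (?L \<inter> (\<Union>i\<in>?N - I. comp_minus G v i))" by blast
      also have "\<dots> = f ` (?L \<inter> (V - {v} - (\<Union>u\<in>I. desc u)))"
        unfolding comp_minus_union[OF v(1) I(1)] ..
      also have "?L \<inter> (V - {v} - (\<Union>u\<in>I. desc u)) = ?L - (?L \<inter> (\<Union>u\<in>I. desc u))"
        using v(2) by (auto simp: leaves_def)
      also have "f ` (?L - (?L \<inter> (\<Union>u\<in>I. desc u))) = f ` ?L - f ` (?L \<inter> (\<Union>u\<in>I. desc u))"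
        by (rule inj_on_image_set_diff[OF inj]) auto
      also have "f ` (?L \<inter> (\<Union>u\<in>I. desc u)) = \<Union>Q" by (auto simp: I X_def)
      finally show ?thesis using img by simp
    qed
    ultimately have "conn_lambda M (\<Union>Q) (E - \<Union>Q) \<le> int r" using l by simp
    moreover have "\<Union>Q \<subseteq> E" using img by (auto simp: I X_def)
    ultimately show "F (\<Union>Q)" using F by blast
  qed
qed

text \<open>The root is a centre of the tree and may itself be a leaf, for instance when the tree is
  one edge. No bound from \<open>lambda_star\<close> is given at such a root, and \<open>F0\<close>
  and \<open>F1\<close> stand in for it.\<close>

lemma hierarchy_root:
  assumes bij: "bij_betw f (leaves V G) E"
    and l: "\<And>v. v \<in> V - leaves V G \<Longrightarrow>
      lambda_star M (neighbours G v) (\<lambda>u. f ` (leaves V G \<inter> comp_minus G v u)) \<le> int r"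
    and d: "\<And>v. v \<in> V \<Longrightarrow> depth v \<le> d"
    and F: "\<And>A. A \<subseteq> E \<Longrightarrow> conn_lambda M A (E - A) \<le> int r \<Longrightarrow> F A"
    and F0: "F {}" "F E" and F1: "\<And>x. x \<in> E \<Longrightarrow> V \<noteq> {c} \<Longrightarrow> F {x} \<and> F (E - {x})"
  shows "hierarchy F d E"
proof -
  let ?L = "leaves V G"
  have inj: "inj_on f ?L" and img: "f ` ?L = E" using bij by (auto simp: bij_betw_def)
  have below: "v \<in> V \<Longrightarrow> v \<noteq> c \<Longrightarrow> hierarchy F (d - depth v) (f ` (?L \<inter> desc v))" for v
  proof (induction "d - depth v" arbitrary: v rule: less_induct)
    case less
    show ?case
    proof (cases "v \<in> ?L")
      case True
      then have "desc v = {v}" using leaf_iff less.prems desc_children by simp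
      then have "f ` (?L \<inter> desc v) = {f v}" using True by auto
      then show ?thesis by (simp add: hierarchy.leaf)
    next
      case False
      then obtain u where u: "u \<in> children v" using leaf_iff less.prems by blast
      then have "Suc (depth v) \<le> d" using child_depth[OF u] d[of u] children_subset by fastforce
      then have h: "d - depth v = Suc (d - Suc (depth v))" by simp
      have "hierarchy F (Suc (d - Suc (depth v))) (f ` (?L \<inter> desc v))"
      proof (rule hierarchy_inner[OF bij l less.prems(1) False _ F])
        fix u assume u: "u \<in> children v"
        have "hierarchy F (d - depth u) (f ` (?L \<inter> desc u))"
          using u h child_depth[OF u] by (intro less.hyps) (auto simp: children_def)
        then show "hierarchy F (d - Suc (depth v)) (f ` (?L \<inter> desc u))" by (simp add: child_depth[OF u])
      qed (use less.prems False in auto)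
      then show ?thesis by (simp only: h)
    qed
  qed
  have "desc c = V" using desc_root desc_V by blast
  then have Vc: "V = insert c (\<Union>u\<in>children c. desc u)" using desc_children[OF root] by simp
  have LV: "?L \<subseteq> V" by (auto simp: leaves_def)
  show ?thesis
  proof (cases "children c = {}")
    case True
    then have "V = {c}" using Vc by simp
    moreover from this have "c \<in> ?L" using True by (simp add: leaves_def neighbours_eq)
    ultimately have "?L = {c}" using LV by auto
    then have "E = {f c}" using img by auto
    then show ?thesis by (simp add: hierarchy.leaf)
  next
    case False
    then obtain u0 where u0: "u0 \<in> children c" by blast
    have u0V: "u0 \<in> V" "u0 \<noteq> c" using u0 by (auto simp: children_def)
    have dc: "depth u = Suc (depth c)" if "u \<in> children c" for u using child_depth[OF that] .
    have d1: "Suc (depth c) \<le> d" using d[OF u0V(1)] dc[OF u0] by simp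
    have chl: "hierarchy F (d - Suc 0) (f ` (?L \<inter> desc u))" if u: "u \<in> children c" for u
      using below[of u] u child_depth[OF u] by (simp add: children_def depth_root)
    obtain d' where d': "d = Suc d'" using d1 by (cases d) auto
    show ?thesis
    \<comment> \<open>A root of degree 1 carries the element \<open>f c\<close> and has one child.
      It becomes a node with the parts \<open>{f c}\<close> and \<open>E - {f c}\<close>, so that
      its own element is not lost.\<close>
    proof (cases "c \<in> ?L")
      case True
      have "card (children c) \<le> 1" using True root by (simp add: leaves_def neighbours_eq)
      then have "\<forall>x\<in>children c. x = u0"
        using u0 card_le_Suc0_iff_eq[OF finite_children[of c]] by auto
      then have ch: "children c = {u0}" using u0 by blast
      have cu: "c \<notin> desc u0" using not_desc_child[OF u0] .
      define B where "B = f ` (?L \<inter> desc u0)"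
      have "?L - {c} = ?L \<inter> desc u0" using LV Vc ch cu by auto
      moreover have "f ` (?L - {c}) = f ` ?L - f ` {c}"
        by (rule inj_on_image_set_diff[OF inj]) (use True in auto)
      ultimately have B: "B = E - {f c}" using img by (simp add: B_def)
      have fc: "f c \<in> E" using True img by blast
      have "hierarchy F (Suc d') (\<Union>{{f c}, B})"
      proof (rule hierarchy.node)
        show "disjoint {{f c}, B}" using B by (auto simp: disjoint_def)
        show "hierarchy F d' A" if "A \<in> {{f c}, B}" for A
          using that chl[OF u0] d' by (auto simp: B_def intro: hierarchy.leaf)
        fix Q assume "Q \<subseteq> {{f c}, B}"
        then have "Q \<in> Pow {{f c}, B}" by blast
        then have "\<Union>Q \<in> {{}, {f c}, B, E}" using B fc by (auto simp: Pow_insert)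
        moreover have "V \<noteq> {c}" using u0V by blast
        then have "F {f c}" "F B" using F1[OF fc] B by simp_all
        then have "\<forall>S\<in>{{}, {f c}, B, E}. F S" using F0 by simp
        ultimately show "F (\<Union>Q)" by (rule bspec[rotated])
      qed auto
      moreover have "\<Union>{{f c}, B} = E" using B fc by auto
      ultimately show ?thesis by (simp add: d')
    next
      case cL: False
      have "hierarchy F (Suc d') (f ` (?L \<inter> desc c))"
        by (rule hierarchy_inner[OF bij l root cL _ F]) (use chl cL root d' in auto)
      moreover have "?L \<inter> desc c = ?L" using LV \<open>desc c = V\<close> by auto
      ultimately show ?thesis using img d' by simp
    qed
  qed
qed

end

section \<open>From a decomposition to an expansion\<close>

lemma cut_co_singleton:
  assumes c: "config G Z" and r: "1 \<le> r"
  shows "cut Z r (G - {x})"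
proof (cases "\<exists>w\<in>Z. w x \<noteq> 0")
  case True
  then obtain w where w: "w \<in> Z" "w x \<noteq> 0" by blast
  have sZ: "fs.subspace Z" and supZ: "\<And>z. z \<in> Z \<Longrightarrow> supp z \<subseteq> G" using c by (auto simp: config_def)
  have "res (G - {x}) z \<in> fs.span (part Z (G - {x}) \<union> {res (G - {x}) w})" if z: "z \<in> Z" for z
  proof -
    define y where "y = z - fscale (z x / w x) w"
    have yZ: "y \<in> Z" unfolding y_def using z w sZ by (intro fs.subspace_diff fs.subspace_scale)
    have "x \<notin> supp y" using w by (simp add: y_def supp_def)
    then have y: "y \<in> part Z (G - {x})" using yZ supZ[OF yZ] by (auto simp: part_def)
    then have "res (G - {x}) y = y" by (simp add: part_def res_eq_self)
    moreover have "z = y + fscale (z x / w x) w" by (simp add: y_def)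
    ultimately have "res (G - {x}) z = y + fscale (z x / w x) (res (G - {x}) w)"
      by (metis res_add res_fscale)
    then show ?thesis using y by (auto intro: fs.span_add fs.span_scale fs.span_base)
  qed
  then have "res (G - {x}) ` Z \<subseteq> fs.span (part Z (G - {x}) \<union> {res (G - {x}) w})" by (rule image_subsetI)
  then show ?thesis
    unfolding cut_def using r by (intro exI[of _ "{res (G - {x}) w}"]) simp
next
  case False
  have "res (G - {x}) z \<in> part Z (G - {x})" if z: "z \<in> Z" for z
  proof -
    have "supp z \<subseteq> G" using c z by (simp add: config_def)
    then have "supp z \<subseteq> G - {x}" using False z by (auto simp: supp_def)
    then show ?thesis using z by (simp add: part_def res_eq_self)
  qed
  then have "res (G - {x}) ` Z \<subseteq> fs.span (part Z (G - {x}) \<union> {})"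
    using fs.span_superset by (auto intro: fs.span_base)
  then show ?thesis unfolding cut_def using r by (intro exI[of _ "{}"]) simp
qed

lemma hierarchy_image:
  assumes "inj g"
  shows "hierarchy f h X \<Longrightarrow> (\<And>A. A \<subseteq> X \<Longrightarrow> f A \<Longrightarrow> f' (g ` A)) \<Longrightarrow> hierarchy f' h (g ` X)"
proof (induction rule: hierarchy.induct)
  case (leaf h x)
  then show ?case by (simp add: hierarchy.leaf)
next
  case (node P h)
  have eq: "g ` \<Union>P = \<Union>((`) g ` P)" by blast
  show ?case
    unfolding eq
  proof (rule hierarchy.node)
    show "disjoint ((`) g ` P)"
    proof (rule disjointI)
      fix A B assume "A \<in> (`) g ` P" "B \<in> (`) g ` P" "A \<noteq> B"
      then obtain A' B' where "A' \<in> P" "B' \<in> P" "A' \<noteq> B'" "A = g ` A'" "B = g ` B'" by blast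
      moreover from this have "A' \<inter> B' = {}" using node.hyps(3) by (simp add: disjointD)
      ultimately show "A \<inter> B = {}" using image_Int[OF assms, of A' B'] by simp
    qed
    show "hierarchy f' h A" if A: "A \<in> (`) g ` P" for A
    proof -
      obtain B where B: "B \<in> P" "A = g ` B" using A by blast
      have "hierarchy f' h (g ` B)"
      proof (rule node.IH[OF B(1)])
        fix C assume "C \<subseteq> B" "f C"
        then show "f' (g ` C)" using node.prems[of C] B(1) by blast
      qed
      then show ?thesis by (simp add: B(2))
    qed
    fix Q assume "Q \<subseteq> (`) g ` P"
    then obtain R where R: "R \<subseteq> P" "Q = (`) g ` R" by (auto simp: subset_image_iff)
    have "f' (g ` \<Union>R)" using node.hyps(5)[OF R(1)] Union_mono[OF R(1)] by (intro node.prems)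
    moreover have "g ` \<Union>R = \<Union>Q" using R(2) by blast
    ultimately show "f' (\<Union>Q)" by simp
  qed (use node.hyps in auto)
qed

lemma rank_map_matroid:
  assumes "inj g"
  shows "rank (map_matroid g M) (g ` A) = rank M A"
proof -
  have "card ` {I \<in> indep (map_matroid g M). I \<subseteq> g ` A} = card ` {I \<in> indep M. I \<subseteq> A}"
  proof -
    have "{I \<in> indep (map_matroid g M). I \<subseteq> g ` A} = (`) g ` {I \<in> indep M. I \<subseteq> A}"
      using inj_image_subset_iff[OF assms] by (auto simp: map_matroid_def)
    moreover have "card (g ` I) = card I" for I
      using assms by (intro card_image inj_on_subset[OF assms]) simp
    ultimately show ?thesis by (simp add: image_image)
  qed
  then show ?thesis by (simp add: rank_def)
qed

lemma conn_lambda_map_matroid: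
  assumes "inj g"
  shows "conn_lambda (map_matroid g M) (g ` A) (g ` B) = conn_lambda M A B"
  using rank_map_matroid[OF assms, of M] by (simp add: conn_lambda_def image_Un[symmetric])

text \<open>\<open>Z\<close> is the space of linear relations among the representing vectors. It is
  carried along \<open>g\<close> at once, because the expansion happens in a type with room for new
  elements.\<close>

lemma map_matroid_eq_mat:
  fixes M :: "'a matroid" and g :: "'a \<Rightarrow> 'e"
  assumes rep: "representable_over TYPE('f::field) M" and g: "inj g"
  obtains Z :: "('e \<Rightarrow> 'f::field) set" where "config (g ` ground M) Z" "map_matroid g M = mat (g ` ground M) Z"
proof -
  obtain \<phi> :: "'a \<Rightarrow> nat \<Rightarrow> 'f" where
    \<phi>: "\<And>X. X \<in> indep M \<longleftrightarrow> X \<subseteq> ground M \<and> lin_indep_family \<phi> X" and m: "is_matroid M"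
    using rep unfolding representable_over_def by meson
  have fin: "finite (ground M)" using m by (simp add: is_matroid_def)
  define Z where "Z = {z. supp z \<subseteq> g ` ground M \<and> (\<forall>i. (\<Sum>x\<in>ground M. z (g x) * \<phi> x i) = 0)}"
  have "fs.subspace Z"
    unfolding fs.subspace_def
  proof (intro conjI ballI allI)
    show "0 \<in> Z" by (simp add: Z_def)
    show "x + y \<in> Z" if "x \<in> Z" "y \<in> Z" for x y
      using that supp_add[of x y] by (auto simp: Z_def distrib_right sum.distrib)
    show "fscale a x \<in> Z" if "x \<in> Z" for a x
      using that supp_fscale[of a x] by (auto simp: Z_def mult.assoc sum_distrib_left[symmetric])
  qed
  then have c: "config (g ` ground M) Z" using fin by (auto simp: config_def Z_def)
  have main: "lin_indep_family \<phi> I \<longleftrightarrow> (\<forall>z\<in>Z. supp z \<subseteq> g ` I \<longrightarrow> z = 0)" if I: "I \<subseteq> ground M" for I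
  proof
    assume li: "lin_indep_family \<phi> I"
    show "\<forall>z\<in>Z. supp z \<subseteq> g ` I \<longrightarrow> z = 0"
    proof (intro ballI impI)
      fix z assume z: "z \<in> Z" "supp z \<subseteq> g ` I"
      have "(\<Sum>x\<in>I. z (g x) * \<phi> x i) = 0" for i
      proof -
        have "z (g x) = 0" if "x \<in> ground M - I" for x
          using z(2) that g by (auto simp: supp_def inj_eq)
        then have "(\<Sum>x\<in>I. z (g x) * \<phi> x i) = (\<Sum>x\<in>ground M. z (g x) * \<phi> x i)"
          using fin I by (intro sum.mono_neutral_left) auto
        then show ?thesis using z(1) by (simp add: Z_def)
      qed
      then have "\<forall>x\<in>I. z (g x) = 0"
        using li[unfolded lin_indep_family_def, THEN conjunct2, rule_format, of "\<lambda>x. z (g x)"] by simp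
      then have "supp z = {}" using z(2) by (auto simp: supp_def)
      then show "z = 0" by simp
    qed
  next
    assume a: "\<forall>z\<in>Z. supp z \<subseteq> g ` I \<longrightarrow> z = 0"
    have "\<forall>x\<in>I. c x = 0" if c: "\<forall>i. (\<Sum>x\<in>I. c x * \<phi> x i) = 0" for c
    proof -
      define z where "z y = (if y \<in> g ` I then c (inv g y) else 0)" for y
      have zg: "z (g x) = (if x \<in> I then c x else 0)" for x
        using g by (auto simp: z_def inj_image_mem_iff)
      have "(\<Sum>x\<in>ground M. z (g x) * \<phi> x i) = (\<Sum>x\<in>I. c x * \<phi> x i)" for i
        using fin I by (intro sum.mono_neutral_cong_right) (auto simp: zg)
      moreover have "supp z \<subseteq> g ` I" by (auto simp: z_def supp_def)
      moreover have "g ` I \<subseteq> g ` ground M" using I by (rule image_mono)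
      ultimately have "z \<in> Z" using c by (simp add: Z_def)
      then have "z = 0" using a \<open>supp z \<subseteq> g ` I\<close> by blast
      then have "z (g x) = 0" for x by simp
      then show ?thesis unfolding zg by (metis (full_types))
    qed
    then show "lin_indep_family \<phi> I"
      using finite_subset[OF I fin] by (simp add: lin_indep_family_def)
  qed
  have "(\<lambda>I. g ` I) ` indep M = indep (mat (g ` ground M) Z)"
  proof (intro set_eqI iffI)
    fix J assume "J \<in> (\<lambda>I. g ` I) ` indep M"
    then obtain I where I: "I \<in> indep M" "J = g ` I" by blast
    then show "J \<in> indep (mat (g ` ground M) Z)"
      unfolding indep_mat using \<phi>[of I] main[of I] by (simp add: image_mono)
  next
    fix J assume J: "J \<in> indep (mat (g ` ground M) Z)"
    then obtain I where I: "I \<subseteq> ground M" "J = g ` I" by (auto simp: indep_mat subset_image_iff)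
    then show "J \<in> (\<lambda>I. g ` I) ` indep M"
      using J \<phi>[of I] main[of I] by (simp add: indep_mat)
  qed
  then have "map_matroid g M = mat (g ` ground M) Z" by (simp add: map_matroid_def mat_def)
  then show ?thesis using that c by blast
qed

text \<open>Without any decomposition the \<open>LEAST\<close> in \<open>branch_depth\<close> would
  carry no information. A star with the elements at its tips works, except for one element, where
  the centre would be a second leaf and the one-vertex tree is taken.\<close>

lemma decomposition_exists:
  assumes fin: "finite (ground M)" and ne: "ground M \<noteq> {}"
  shows "\<exists>d r. is_decomposition M d r"
proof (cases "card (ground M) = 1")
  case True
  then obtain x where x: "ground M = {x}" by (metis card_1_singletonE)
  let ?G = "\<lambda>u v :: nat. False"
  have "is_tree {0 :: nat} ?G" unfolding is_tree_def by (auto intro: exI[of _ 0])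
  moreover have L: "leaves {0 :: nat} ?G = {0}" by (auto simp: leaves_def neighbours_def)
  moreover have "bij_betw (\<lambda>_. x) {0 :: nat} (ground M)" by (simp add: x bij_betw_def)
  ultimately have "is_decomposition M (tree_radius {0 :: nat} ?G) 0"
    unfolding is_decomposition_def
    by (intro exI[of _ "{0}"] exI[of _ ?G] exI[of _ "\<lambda>_. x"]) simp
  then show ?thesis by blast
next
  case False
  define n where "n = card (ground M)"
  have n: "n \<ge> 2" using False fin ne by (cases n rule: nat.exhaust) (auto simp: n_def)
  define V where "V = {0..n}"
  define G where "G u v \<longleftrightarrow> (u = 0 \<and> v \<in> {1..n}) \<or> (v = 0 \<and> u \<in> {1..n})" for u v
  obtain f where f: "bij_betw f {1..n} (ground M)"
    using ex_bij_betw_nat_finite_1[OF fin] unfolding n_def by blast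
  have star: "G\<^sup>*\<^sup>* 0 v" "G\<^sup>*\<^sup>* v 0" if "v \<in> V" for v
    using that by (cases "v = 0"; auto simp: G_def V_def intro!: r_into_rtranclp)+
  have tree: "is_tree V G"
    unfolding is_tree_def
  proof (intro conjI ballI allI impI)
    show "finite V" "V \<noteq> {}" by (auto simp: V_def)
    show "u \<in> V" "v \<in> V" "u \<noteq> v" "G v u" if "G u v" for u v using that by (auto simp: G_def V_def)
    show "\<exists>n. within G n u v" if "u \<in> V" "v \<in> V" for u v
      unfolding within_iff_rtranclp using star that by (meson rtranclp_trans)
    have "{{u, v} | u v. G u v} = (\<lambda>v. {0, v}) ` {1..n}"
    proof
      show "{{u, v} | u v. G u v} \<subseteq> (\<lambda>v. {0, v}) ` {1..n}" by (auto simp: G_def insert_commute)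
      show "(\<lambda>v. {0, v}) ` {1..n} \<subseteq> {{u, v} | u v. G u v}"
      proof
        fix e assume "e \<in> (\<lambda>v. {0, v}) ` {1..n}"
        then obtain v where "v \<in> {1..n}" "e = {0, v}" by blast
        moreover from this have "G 0 v" by (simp add: G_def)
        ultimately show "e \<in> {{u, v} | u v. G u v}" by blast
      qed
    qed
    moreover have "card ((\<lambda>v. {0 :: nat, v}) ` {1..n}) = n"
      by (subst card_image) (auto simp: inj_on_def doubleton_eq_iff)
    ultimately show "card {{u, v} | u v. G u v} + 1 = card V" by (simp add: V_def)
  qed
  have "neighbours G 0 = {1..n}" by (auto simp: neighbours_def G_def)
  then have "0 \<notin> leaves V G" using n by (simp add: leaves_def)
  moreover have "v \<in> leaves V G" if v: "v \<in> {1..n}" for v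
  proof -
    have "neighbours G v = {0}" using v by (auto simp: neighbours_def G_def)
    then show ?thesis using v by (simp add: leaves_def V_def)
  qed
  moreover have "v = 0 \<or> v \<in> {1..n}" if "v \<in> leaves V G" for v
    using that by (auto simp: leaves_def V_def)
  ultimately have L: "leaves V G = {1..n}" by blast
  define ls where "ls = lambda_star M (neighbours G 0) (\<lambda>u. f ` (leaves V G \<inter> comp_minus G 0 u))"
  have "V - leaves V G = {0}" unfolding L by (auto simp: V_def)
  then have "\<forall>v\<in>V - leaves V G. lambda_star M (neighbours G v) (\<lambda>u. f ` (leaves V G \<inter> comp_minus G v u)) \<le> int (nat ls)"
    by (simp add: ls_def)
  then have "is_decomposition M (tree_radius V G) (nat ls)"
    unfolding is_decomposition_def using tree f L
    by (intro exI[of _ V] exI[of _ G] exI[of _ f] conjI) auto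
  then show ?thesis by blast
qed

lemma tree_centre:
  assumes "is_tree V G"
  shows "\<exists>c\<in>V. \<forall>v\<in>V. within G (tree_radius V G) c v"
proof -
  obtain c where c: "c \<in> V" using assms by (auto simp: is_tree_def)
  have fin: "finite V" using assms by (simp add: is_tree_def)
  have "\<forall>v\<in>V. \<exists>n. within G n c v" using assms c by (simp add: is_tree_def)
  then obtain n where n: "\<And>v. v \<in> V \<Longrightarrow> within G (n v) c v" by metis
  have "within G (Max (n ` V)) c v" if "v \<in> V" for v
    using n[OF that] by (rule within_mono) (use fin that in simp)
  then have "\<exists>d. \<exists>c\<in>V. \<forall>v\<in>V. within G d c v" using c by blast
  then show ?thesis unfolding tree_radius_def by (rule LeastI_ex)
qed

lemma square_less_4_power: "k * k < (4 :: nat) ^ k"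
proof -
  have "k * k < 2 ^ k * 2 ^ k" using less_exp[of k] by (intro mult_strict_mono') auto
  also have "\<dots> = (2 * 2) ^ k" by (rule power_mult_distrib[symmetric])
  finally show ?thesis by simp
qed

text \<open>Cuts are bounded by \<open>k\<close> and not by \<open>r\<close>: \<open>r\<close> may
  be 0, while the cut around a single element at a root of degree 1 is only known to be at most
  1.\<close>

lemma decomposition_expandable:
  fixes M :: "'a matroid" and Z :: "('e \<Rightarrow> 'f::field) set"
  assumes inf: "infinite (UNIV :: 'e set)" and g: "inj g" and c: "config (g ` ground M) Z"
    and mat: "map_matroid g M = mat (g ` ground M) Z"
    and dec: "is_decomposition M d r" and k: "d \<le> k" "r \<le> k"
  shows "expandable (g ` ground M) Z (2 * k * k * d + 1)"
proof -
  define E where "E = ground M"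
  obtain V :: "nat set" and G f where t: "is_tree V G" "tree_radius V G = d"
    and f: "bij_betw f (leaves V G) E"
    and l: "\<And>v. v \<in> V - leaves V G \<Longrightarrow>
      lambda_star M (neighbours G v) (\<lambda>u. f ` (leaves V G \<inter> comp_minus G v u)) \<le> int r"
    using dec unfolding is_decomposition_def E_def by blast
  obtain x where x: "x \<in> V" "\<And>v. v \<in> V \<Longrightarrow> within G d x v" using tree_centre[OF t(1)] t(2) by blast
  obtain p depth where T: "rooted_tree V G x p depth" "\<And>v. v \<in> V \<Longrightarrow> depth v \<le> d"
    using rooted_tree_of_is_tree[OF t(1) x] by blast
  define F where "F A \<longleftrightarrow> cut Z k (g ` A)" for A
  have "hierarchy F d E"
  proof (rule rooted_tree.hierarchy_root[OF T(1) f l T(2)])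
    fix A assume A: "A \<subseteq> E" "conn_lambda M A (E - A) \<le> int r"
    have "g ` E - g ` A = g ` (E - A)" using g by (simp add: image_set_diff)
    then have "conn_lambda (mat (g ` E) Z) (g ` A) (g ` E - g ` A) \<le> int k"
      using A(2) k(2) conn_lambda_map_matroid[OF g, of M A "E - A"] mat by (simp add: E_def)
    then show "F A"
      unfolding F_def using cut_if_conn_lambda[of "g ` E" Z "g ` A" k] c A(1) by (simp add: E_def image_mono)
  next
    show "F {}" "F E" using cut_trivial[OF c] by (simp_all add: F_def E_def)
  next
    fix y assume y: "y \<in> E" "V \<noteq> {x}"
    then obtain v where v: "v \<in> V" "v \<noteq> x" using x(1) by blast
    \<comment> \<open>A tree with a second vertex has positive radius, and \<open>d \<le> k\<close>
      then gives the \<open>1 \<le> k\<close> that cuts around one element require.\<close>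
    have "d \<noteq> 0"
    proof
      assume "d = 0"
      then show False using x(2)[OF v(1)] v(2) by simp
    qed
    then have "1 \<le> k" using k(1) by simp
    moreover have "g ` (E - {y}) = g ` E - {g y}" using g by (simp add: image_set_diff)
    ultimately show "F {y} \<and> F (E - {y})"
      using cut_singleton[of k Z "g y"] cut_co_singleton[OF c, of k "g y"] by (simp add: F_def E_def)
  qed
  then have "hierarchy (cut Z k) d (g ` E)"
    by (rule hierarchy_image[OF g]) (simp add: F_def)
  then show ?thesis using hierarchy_expandable[OF inf _ c] by (simp add: E_def)
qed

text \<open>\<open>expansion\<close> deletes \<open>K\<close> before projecting \<open>Q\<close>
  away, whereas \<open>is_minor\<close> contracts first. The orders agree because a projected vector
  supported in \<open>X\<close> comes from one that vanishes on \<open>K\<close>.\<close>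

lemma expansion_minor:
  assumes e: "expansion F X Z k Q K ZN"
  shows "is_minor (mat X Z) (mat (X \<union> Q \<union> K) ZN)"
proof -
  have N: "Q \<inter> K = {}" "(Q \<union> K) \<inter> X = {}" "config (X \<union> Q \<union> K) ZN" "res X ` part ZN (- K) = Z"
    using e by (auto simp: expansion_def)
  have G: "X \<union> Q \<union> K - Q = X \<union> K" "X \<union> K - K = X" using N by auto
  have "delete (contract (mat (X \<union> Q \<union> K) ZN) Q) K = mat X (part (res (X \<union> K) ` ZN) X)"
    using mat_contract[OF N(3), of Q] by (simp add: mat_delete G Un_assoc[symmetric] sup.coboundedI1)
  also have "part (res (X \<union> K) ` ZN) X = Z"
  proof (intro set_eqI iffI)
    fix y assume "y \<in> part (res (X \<union> K) ` ZN) X"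
    then obtain z where z: "z \<in> ZN" "y = res (X \<union> K) z" "supp y \<subseteq> X" by (auto simp: part_def)
    then have "supp z \<subseteq> - K" using N(2) by auto
    then have "res X z \<in> Z" using z(1) N(4) by (auto simp: part_def)
    moreover have "res X y = y" using z(3) by (rule res_eq_self)
    then have "y = res X z" using z(2) by (simp add: Int_absorb2)
    ultimately show "y \<in> Z" by simp
  next
    fix y assume "y \<in> Z"
    then obtain z where z: "z \<in> ZN" "supp z \<subseteq> - K" "y = res X z" using N(4) by (auto simp: part_def)
    have "res (X \<union> K) z = y" using z(2,3) by (auto simp: res_def fun_eq_iff supp_def)
    moreover have "supp y \<subseteq> X" using z(3) by simp
    ultimately show "y \<in> part (res (X \<union> K) ` ZN) X" using z(1) by (auto simp: part_def)
  qed
  finally show ?thesis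
    unfolding is_minor_def using N(1) by (intro exI[of _ Q] exI[of _ K]) auto
qed

theorem theorem1p2:
  fixes M :: "'a matroid"
  assumes "representable_over TYPE('f::field) M"
  shows "\<exists>N :: ('a + nat) matroid.
           representable_over TYPE('f) N
         \<and> is_minor (map_matroid Inl M) N
         \<and> (\<exists>d. has_cdd N d \<and> d \<le> 2 * branch_depth M * (4 ^ branch_depth M - 1) + 1)"
proof -
  have inf: "infinite (UNIV :: ('a + nat) set)" by (simp add: UNIV_Plus_UNIV[symmetric] del: UNIV_Plus_UNIV)
  have inj: "inj (Inl :: 'a \<Rightarrow> 'a + nat)" by simp
  define E where "E = (Inl :: 'a \<Rightarrow> 'a + nat) ` ground M"
  obtain Z :: "('a + nat \<Rightarrow> 'f) set" where c: "config E Z" and m: "map_matroid Inl M = mat E Z"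
    using map_matroid_eq_mat[OF assms inj] unfolding E_def by blast
  have fin: "finite (ground M)" using assms by (simp add: representable_over_def is_matroid_def)
  define k where "k = branch_depth M"
  have "\<exists>F Q K ZN. expansion F E Z (2 * k * (4 ^ k - 1) + 1) Q K ZN"
  proof (cases "ground M = {}")
    case True
    \<comment> \<open>The empty matroid has no decomposition and no value of \<open>has_cdd\<close>.
      One free element \<open>q\<close> is added and contracted, and the bound holds whatever
      \<open>k\<close> is, since it is at least 1.\<close>
    define q :: "'a + nat" where "q = Inr 0"
    have E: "E = {}" using True by (simp add: E_def)
    then have Z: "Z = {0}" using c fs.subspace_0[of Z] by (auto simp: config_def)
    have "expansion {} E Z (2 * k * (4 ^ k - 1) + 1) {q} {} {0}"
      unfolding expansion_def
    proof (intro conjI)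
      show "config (E \<union> {q} \<union> {}) ({0} :: ('a + nat \<Rightarrow> 'f) set)" by (simp add: E config_def fs.subspace_def)
      show "cdd_le (mat (E \<union> {q} \<union> {}) ({0} :: ('a + nat \<Rightarrow> 'f) set)) (2 * k * (4 ^ k - 1) + 1)"
        by (rule cdd_le_single) (simp_all add: E)
    qed (auto simp: E Z part_def)
    then show ?thesis by meson
  next
    case False
    obtain d0 r0 where "is_decomposition M d0 r0" using decomposition_exists[OF fin False] by blast
    then have "\<exists>k d r. d \<le> k \<and> r \<le> k \<and> is_decomposition M d r"
      by (intro exI[of _ "max d0 r0"] exI[of _ d0] exI[of _ r0]) simp
    then have "\<exists>d r. d \<le> k \<and> r \<le> k \<and> is_decomposition M d r"
      unfolding k_def branch_depth_def by (rule LeastI_ex)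
    then obtain d r where d: "d \<le> k" "r \<le> k" "is_decomposition M d r" by blast
    have "expandable E Z (2 * k * k * d + 1)"
      using decomposition_expandable[OF inf inj _ _ d(3,1,2)] c m unfolding E_def by blast
    moreover have "2 * k * k * d + 1 \<le> 2 * k * (4 ^ k - 1) + 1"
    proof -
      \<comment> \<open>The cost \<open>2 * k * k * d\<close> over all levels is
        \<open>2 * k\<close> times \<open>k * d\<close>, and only the factor \<open>k * d\<close> is
        compared with \<open>4 ^ k - 1\<close>.\<close>
      have "k * d \<le> k * k" using d(1) by simp
      also have "\<dots> \<le> 4 ^ k - 1" using square_less_4_power[of k] by linarith
      finally have "2 * k * (k * d) \<le> 2 * k * (4 ^ k - 1)" by (rule mult_le_mono2)
      then show ?thesis by (simp add: mult.assoc)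
    qed
    ultimately have "expandable E Z (2 * k * (4 ^ k - 1) + 1)" by (rule expandable_mono)
    then have "\<exists>Q K ZN. expansion {} E Z (2 * k * (4 ^ k - 1) + 1) Q K ZN"
      unfolding expandable_def by simp
    then show ?thesis by (rule exI)
  qed
  then obtain F Q K ZN where e: "expansion F E Z (2 * k * (4 ^ k - 1) + 1) Q K ZN" by meson
  define N where "N = mat (E \<union> Q \<union> K) ZN"
  have "representable_over TYPE('f) N"
    unfolding N_def using e by (intro representable_mat) (simp add: expansion_def)
  moreover have "is_minor (map_matroid Inl M) N"
    unfolding N_def m by (rule expansion_minor[OF e])
  moreover have "\<exists>d. has_cdd N d \<and> d \<le> 2 * k * (4 ^ k - 1) + 1"
    using e unfolding expansion_def cdd_le_def N_def by meson
  ultimately show ?thesis unfolding k_def by (intro exI[of _ N] conjI)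
qed

end
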